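(* The set $\widehat{\mathcal{TB}}(\mathcal O)=\mathcal{TB}(\mathcal O)/\alpha$ with the summation operation $\mathbf t_1\oplus\mathbf t_2:=\mathcal B(\mathcal D(\mathbf t_1)+\mathcal D(\mathbf t_2))$ is a commutative semigroup. This semigroup is isomorphic to the semigroup of all effective divisors on the curve $\mathcal C_{\mathcal O}$ that do not contain the points corresponding to the caustics.
   Context: Consider in $\mathbf E^d$ the confocal family $\mathcal Q_{\lambda}:\ \sum_{i=1}^d \frac{x_i^2}{a_i-\lambda}=1$ ($a_1,\dots,a_d$ distinct reals). Let $\ell$ be a line tangent to quadrics $\mathcal Q_{\alpha_1},\dots,\mathcal Q_{\alpha_{d-1}}$ of the family (the caustics), and let $\mathcal A_{\ell}$ be the set of all lines tangent to these same $d-1$ quadrics. Fix $\mathcal O\in\mathcal A_{\ell}$. Two lines intersecting at a point $P$ of a quadric $\mathcal Q$ satisfy the billiard reflection law on $\mathcal Q$ if they are coplanar with the normal to $\mathcal Q$ at $P$ and make congruent angles with it. A billiard trajectory of length $n$ is a sequence of lines $(\ell_0,\dots,\ell_n)$ in $\mathcal A_\ell$ such that $\ell_{i-1},\ell_i$ satisfy the reflection law on some quadric $\mathcal Q_i$ of the family ($1\le i\le n$). $\mathcal{TB}(\mathcal O)$ is the set of billiard trajectories with $\ell_0=\mathcal O$. Double reflection configuration (DRC): four lines $X_1Y_1,X_1Y_2,X_2Y_1,X_2Y_2$, where $X_1,X_2$ lie on a quadric $\mathcal Q_1$ and $Y_1,Y_2$ on a quadric $\mathcal Q_2$ of the family,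 such that the two lines through each of the four points satisfy the reflection law there (on $\mathcal Q_1$ at $X_1,X_2$, on $\mathcal Q_2$ at $Y_1,Y_2$) and the four tangent hyperplanes at these points belong to a pencil. The generalized Cayley curve $\mathcal C_{\mathcal O}$ is the variety of hyperplanes tangent to the quadrics of the family at the points of $\mathcal O$; it is identified with the set of lines of $\mathcal A_\ell$ intersecting $\mathcal O$, a tangent hyperplane being identified with the line obtained from $\mathcal O$ by reflection at its point of tangency. The points corresponding to the caustics are the tangent hyperplanes to the $d-1$ caustics at their points of tangency with $\mathcal O$. For $\mathbf t=(\ell_0=\mathcal O,\ell_1,\dots,\ell_n)\in\mathcal{TB}(\mathcal O)$ and each $1\le k\le n$ put $\ell_k^{(k)}=\ell_k$ and, for $k-1\ge j\ge1$, let $\ell_k^{(j)}$ be the unique line that constitutes a DRC with $\ell_{j-1},\ell_j,\ell_k^{(j+1)}$. Put $\mathcal D(\mathbf t)=(\ell_1^{(1)},\dots,\ell_n^{(1)})$, an $n$-tuple of lines intersecting $\mathcal O$. $\mathcal B$ is the inverse map, assigning to an $n$-tuple of lines intersecting $\mathcal O$ the corresponding trajectory of length $n$ with initial line $\mathcal O$. Two trajectories are $\alpha$-equivalent if one can be obtained from the other by a finite set of double reflection moves, where such a move replaces $p_1\dots p_{k-1}p_kp_{k+1}\dots p_n$ by $p_1\dots p_{k-1}p_k'p_{k+1}\dots p_n$ if $p_{k-1},p_k,p_k',p_{k+1}$ form a DRC. Two trajectories $\mathbf t_1,\mathbf t_2\in\mathcal{TB}(\mathcal O)$ are $\alpha$-equivalent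 if and only if $\mathcal D(\mathbf t_1)$ and $\mathcal D(\mathbf t_2)$ differ by a permutation, so $\mathcal D$ is regarded as a map from $\widehat{\mathcal{TB}}(\mathcal O)$ to positive divisors on $\mathcal C_{\mathcal O}$; in the definition of $\oplus$ the sum is the sum of divisors.
   Formalization: A trajectory also records the tangent hyperplane of each reflection, since two points of the Cayley curve can give the same reflected line (always for d=2). Real points only; reflection points at infinity and the degenerate quadrics λ=a_i, λ=∞ are included. *)

theory Defs
  imports "HOL-Analysis.Analysis" "HOL-Library.Multiset"
begin

text \<open>
  The ambient space is the Euclidean space \<open>real^'n\<close>, lines are sets of points of \<open>real^'n\<close>.  Completing
  a double reflection configuration can move a reflection point to infinity (in one of the
  asymptotic hyperplanes), so points of reflection and tangent hyperplanes are taken in the real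
  projective closure: a nonzero vector \<open>(x, w)\<close> stands for the point \<open>x / w\<close> if \<open>w \<noteq> 0\<close> and for the
  point at infinity in direction \<open>x\<close> if \<open>w = 0\<close>; a hyperplane is a linear hyperplane of
  \<open>real^'n \<times> real\<close>, and a pair \<open>(n, -c)\<close> with \<open>n \<noteq> 0\<close> orthogonal to it means
  that its finite part is \<open>n \<bullet> x = c\<close>.
\<close>

type_synonym 'n hvec = "(real^'n) \<times> real"
type_synonym 'n hyperpl = "'n hvec set"
type_synonym 'n line = "(real^'n) set"

definition line_through :: "real^'n::finite \<Rightarrow> real^'n \<Rightarrow> 'n line" where
  "line_through p u = range (\<lambda>t. p + t *\<^sub>R u)"

definition is_line :: "('n::finite) line \<Rightarrow> bool" where
  "is_line l \<longleftrightarrow> (\<exists>p u. u \<noteq> 0 \<and> l = line_through p u)"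

definition proj_span :: "('n::finite) line \<Rightarrow> 'n hvec set" where
  "proj_span l = span ((\<lambda>x. (x, 1)) ` l)"

definition proj_points :: "('n::finite) line \<Rightarrow> 'n hvec set" where
  "proj_points l = proj_span l - {0}"

definition hyper_inf :: "('n::finite) hyperpl" where
  "hyper_inf = {y. snd y = 0}"

definition coord_hyper :: "'n::finite \<Rightarrow> 'n hyperpl" where
  "coord_hyper i = {y. fst y $ i = 0}"


text \<open>Polar form of the homogenised equation of the confocal quadric with parameter \<open>\<mu>\<close>.\<close>

definition qform :: "real^'n::finite \<Rightarrow> real \<Rightarrow> 'n hvec \<Rightarrow> 'n hvec \<Rightarrow> real" where
  "qform a \<mu> P R = (\<Sum>i\<in>UNIV. fst P $ i * fst R $ i / (a $ i - \<mu>)) - snd P * snd R"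

text \<open>
  The parameter of the family runs over the projective line.  Its degenerate members are the
  doubled coordinate hyperplanes (\<open>\<mu> = a $ i\<close>) and the doubled hyperplane at infinity
  (\<open>\<mu> = \<infinity>\<close>); such a member is its own tangent hyperplane at each of its points.
\<close>

datatype member = Conf real | AtInfinity

definition degenerate :: "real^'n::finite \<Rightarrow> member \<Rightarrow> bool" where
  "degenerate a q \<longleftrightarrow> q = AtInfinity \<or> (\<exists>i. q = Conf (a $ i))"

fun tangent_at :: "real^'n::finite \<Rightarrow> member \<Rightarrow> 'n hvec \<Rightarrow> 'n hyperpl \<Rightarrow> bool" where
  "tangent_at a AtInfinity P H \<longleftrightarrow> P \<noteq> 0 \<and> P \<in> H \<and> H = hyper_inf"
| "tangent_at a (Conf \<mu>) P H \<longleftrightarrow> P \<noteq> 0 \<and>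
     (if \<exists>i. a $ i = \<mu>
      then P \<in> H \<and> (\<exists>i. a $ i = \<mu> \<and> H = coord_hyper i)
      else qform a \<mu> P P = 0 \<and> H = {y. qform a \<mu> P y = 0})"


text \<open>
  The lines tangent to all caustics; \<open>S\<close> is the set of parameters of the caustics.  Tangency at
  infinity (\<open>l\<close> an asymptote) is included.
\<close>

definition line_tangent :: "real^'n::finite \<Rightarrow> real \<Rightarrow> 'n line \<Rightarrow> bool" where
  "line_tangent a \<alpha> l \<longleftrightarrow> (\<exists>P \<in> proj_points l. \<exists>H. tangent_at a (Conf \<alpha>) P H \<and> proj_span l \<subseteq> H)"

definition common_tangents :: "real^'n::finite \<Rightarrow> real set \<Rightarrow> 'n line set" where
  "common_tangents a S = {l. is_line l \<and> (\<forall>\<alpha>\<in>S. line_tangent a \<alpha> l)}"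


text \<open>
  Reflection law at a finite point \<open>p\<close> of a quadric with tangent hyperplane \<open>n \<bullet> x = c\<close>.  For
  unit vectors \<open>n\<close>, \<open>u\<close>, \<open>v\<close> the number \<open>\<bar>u \<bullet> n\<bar>\<close> is the cosine of the angle between the line
  and the normal.  A line is never its own reflection, except at normal incidence; in particular
  there is no reflection at a point of tangency.
\<close>

definition reflection_law_finite ::
    "('n::finite) hyperpl \<Rightarrow> real^'n \<Rightarrow> 'n line \<Rightarrow> 'n line \<Rightarrow> bool" where
  "reflection_law_finite H p l m \<longleftrightarrow> (\<exists>n c u v.
     norm n = 1 \<and> norm u = 1 \<and> norm v = 1 \<and>
     H = {y. (n, - c) \<bullet> y = 0} \<and> n \<bullet> p = c \<and>
     l = line_through p u \<and> m = line_through p v \<and>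
     coplanar (l \<union> m \<union> line_through p n) \<and>
     \<bar>u \<bullet> n\<bar> = \<bar>v \<bullet> n\<bar> \<and>
     (l = m \<longrightarrow> l = line_through p n))"

text \<open>
  Limit of the law at a point at infinity, where \<open>l\<close> and \<open>m\<close> are parallel: for an asymptotic
  hyperplane \<open>n \<bullet> x = c\<close> the lines are mirror images in it; for the hyperplane
  at infinity, all of whose normals pass through the centre \<open>0\<close>, they are mirror images in \<open>0\<close>.
\<close>

definition reflection_law_inf ::
    "('n::finite) hyperpl \<Rightarrow> 'n line \<Rightarrow> 'n line \<Rightarrow> bool" where
  "reflection_law_inf H l m \<longleftrightarrow>
     (if H = hyper_inf then m = uminus ` l
      else l \<noteq> m \<and> (\<exists>n c. norm n = 1 \<and> H = {y. (n, - c) \<bullet> y = 0} \<and>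
             m = (\<lambda>x. x - (2 * (n \<bullet> x - c)) *\<^sub>R n) ` l))"

definition reflects ::
    "real^'n::finite \<Rightarrow> member \<Rightarrow> 'n hvec \<Rightarrow> 'n hyperpl \<Rightarrow> 'n line \<Rightarrow> 'n line \<Rightarrow> bool" where
  "reflects a q P H l m \<longleftrightarrow>
     tangent_at a q P H \<and> P \<in> proj_points l \<and> P \<in> proj_points m \<and>
     (if snd P \<noteq> 0 then reflection_law_finite H (fst P /\<^sub>R snd P) l m
      else reflection_law_inf H l m)"


text \<open>
  Double reflection configuration: \<open>l\<^sub>0 = X\<^sub>1Y\<^sub>1\<close>, \<open>l\<^sub>1 = X\<^sub>1Y\<^sub>2\<close>, \<open>l\<^sub>2 = X\<^sub>2Y\<^sub>2\<close>, \<open>l\<^sub>1' = X\<^sub>2Y\<^sub>1\<close>, with tangent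
  hyperplanes \<open>H\<close>, \<open>H'\<close> at \<open>X\<^sub>1\<close>, \<open>X\<^sub>2\<close> and \<open>K\<close>, \<open>K'\<close> at \<open>Y\<^sub>2\<close>, \<open>Y\<^sub>1\<close>.  Four hyperplanes belong to exactly
  one pencil iff their intersection has codimension 2.  Points among \<open>X\<^sub>i\<close>, \<open>Y\<^sub>j\<close> may coincide (as they do
  for \<open>l\<^sub>0, l\<^sub>1, l\<^sub>0\<close>), but the four hyperplanes may not all coincide: on a proper quadric such a
  quadruple is not a limit of configurations with distinct hyperplanes.  It is one if
  the hyperplane is a degenerate member of the family.
\<close>

definition DRC ::
    "real^'n::finite \<Rightarrow> 'n line \<Rightarrow> 'n hyperpl \<Rightarrow> 'n line \<Rightarrow> 'n hyperpl \<Rightarrow> 'n line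
       \<Rightarrow> 'n hyperpl \<Rightarrow> 'n line \<Rightarrow> 'n hyperpl \<Rightarrow> bool" where
  "DRC a l\<^sub>0 H l\<^sub>1 K l\<^sub>2 K' l\<^sub>1' H' \<longleftrightarrow> (\<exists>q\<^sub>1 q\<^sub>2 X\<^sub>1 X\<^sub>2 Y\<^sub>1 Y\<^sub>2.
     reflects a q\<^sub>1 X\<^sub>1 H l\<^sub>0 l\<^sub>1 \<and> reflects a q\<^sub>2 Y\<^sub>2 K l\<^sub>1 l\<^sub>2 \<and>
     reflects a q\<^sub>2 Y\<^sub>1 K' l\<^sub>0 l\<^sub>1' \<and> reflects a q\<^sub>1 X\<^sub>2 H' l\<^sub>1' l\<^sub>2 \<and>
     (dim (H \<inter> K \<inter> K' \<inter> H') = CARD('n) - 1 \<or>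
      H = K \<and> K = K' \<and> K' = H' \<and> degenerate a q\<^sub>1))"


text \<open>
  A trajectory is stored without its initial line, as the list of pairs (mirror, line) where the
  mirror is the hyperplane in which the preceding line is reflected.  The mirrors have to be
  recorded: where a line touches \<open>d - 2\<close> caustics at one point, its reflections in the two remaining
  confocal quadrics through that point are the same line.
\<close>

type_synonym 'n trajectory = "('n hyperpl \<times> 'n line) list"

primrec is_trajectory ::
    "real^'n::finite \<Rightarrow> real set \<Rightarrow> 'n line \<Rightarrow> 'n trajectory \<Rightarrow> bool" where
  "is_trajectory a S l [] \<longleftrightarrow> l \<in> common_tangents a S"
| "is_trajectory a S l (s # t) \<longleftrightarrow> l \<in> common_tangents a S \<and>
     (\<exists>q P. reflects a q P (fst s) l (snd s)) \<and> is_trajectory a S (snd s) t"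

definition TB :: "real^'n::finite \<Rightarrow> real set \<Rightarrow> 'n line \<Rightarrow> 'n trajectory set" where
  "TB a S l\<^sub>0 = {t. is_trajectory a S l\<^sub>0 t}"

definition final_line :: "('n::finite) line \<Rightarrow> 'n trajectory \<Rightarrow> 'n line" where
  "final_line l\<^sub>0 t = (if t = [] then l\<^sub>0 else snd (last t))"

definition double_reflection_move ::
    "real^'n::finite \<Rightarrow> real set \<Rightarrow> 'n line \<Rightarrow> ('n trajectory \<times> 'n trajectory) set" where
  "double_reflection_move a S l\<^sub>0 = {(s, t). s \<in> TB a S l\<^sub>0 \<and> t \<in> TB a S l\<^sub>0 \<and>
     (\<exists>xs ys H l K m K' l' H'.
        s = xs @ [(H, l), (K, m)] @ ys \<and> t = xs @ [(K', l'), (H', m)] @ ys \<and>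
        DRC a (final_line l\<^sub>0 xs) H l K m K' l' H')}"

definition alpha_equiv ::
    "real^'n::finite \<Rightarrow> real set \<Rightarrow> 'n line \<Rightarrow> ('n trajectory \<times> 'n trajectory) set" where
  "alpha_equiv a S l\<^sub>0 =
     {(s, t). s \<in> TB a S l\<^sub>0 \<and> t \<in> TB a S l\<^sub>0 \<and> (s, t) \<in> (double_reflection_move a S l\<^sub>0)\<^sup>*}"

definition TB_hat :: "real^'n::finite \<Rightarrow> real set \<Rightarrow> 'n line \<Rightarrow> 'n trajectory set set" where
  "TB_hat a S l\<^sub>0 = TB a S l\<^sub>0 // alpha_equiv a S l\<^sub>0"


definition cayley_curve :: "real^'n::finite \<Rightarrow> 'n line \<Rightarrow> 'n hyperpl set" where
  "cayley_curve a l = {H. \<exists>q. \<exists>P \<in> proj_points l. tangent_at a q P H}"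

definition caustic_points ::
    "real^'n::finite \<Rightarrow> real set \<Rightarrow> 'n line \<Rightarrow> 'n hyperpl set" where
  "caustic_points a S l =
     {H. \<exists>\<alpha>\<in>S. \<exists>P \<in> proj_points l. tangent_at a (Conf \<alpha>) P H \<and> proj_span l \<subseteq> H}"

text \<open>Effective divisors are finite multisets of points of the curve.\<close>

definition effective_divisors ::
    "real^'n::finite \<Rightarrow> real set \<Rightarrow> 'n line \<Rightarrow> 'n hyperpl multiset set" where
  "effective_divisors a S l = {M. set_mset M \<subseteq> cayley_curve a l - caustic_points a S l}"


text \<open>
  With \<open>l = \<ell>\<^bsub>j-1\<^esub>\<close>, \<open>m = \<ell>\<^sub>j\<close> and \<open>x\<close> consisting of \<open>\<ell>\<^sub>k\<^bsup>(j+1)\<^esup>\<close> and the hyperplane reflecting \<open>\<ell>\<^sub>j\<close> to it,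
  \<open>complete a l H m x\<close> consists of \<open>\<ell>\<^sub>k\<^bsup>(j)\<^esup>\<close> and the hyperplane reflecting \<open>\<ell>\<^bsub>j-1\<^esub>\<close> to it.  Accordingly
  \<open>lines_meeting\<close> applied to the trajectory \<open>\<ell>\<^bsub>j-1\<^esub>, \<ell>\<^sub>j, \<dots>, \<ell>\<^sub>n\<close> is \<open>(\<ell>\<^sub>j\<^bsup>(j)\<^esup>, \<dots>, \<ell>\<^sub>n\<^bsup>(j)\<^esup>)\<close>.
\<close>

definition complete ::
    "real^'n::finite \<Rightarrow> 'n line \<Rightarrow> 'n hyperpl \<Rightarrow> 'n line \<Rightarrow> 'n hyperpl \<times> 'n line
       \<Rightarrow> 'n hyperpl \<times> 'n line" where
  "complete a l H m x = (THE y. \<exists>H'. DRC a l H m (fst x) (snd x) (fst y) (snd y) H')"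

primrec lines_meeting ::
    "real^'n::finite \<Rightarrow> 'n line \<Rightarrow> 'n trajectory \<Rightarrow> ('n hyperpl \<times> 'n line) list" where
  "lines_meeting a l [] = []"
| "lines_meeting a l (s # t) = s # map (complete a l (fst s) (snd s)) (lines_meeting a (snd s) t)"

text \<open>The lines meeting \<open>l\<^sub>0\<close> are identified with points of the curve.\<close>

definition D_map :: "real^'n::finite \<Rightarrow> 'n line \<Rightarrow> 'n trajectory \<Rightarrow> 'n hyperpl list" where
  "D_map a l\<^sub>0 t = map fst (lines_meeting a l\<^sub>0 t)"

definition B_map ::
    "real^'n::finite \<Rightarrow> real set \<Rightarrow> 'n line \<Rightarrow> 'n hyperpl list \<Rightarrow> 'n trajectory" where
  "B_map a S l\<^sub>0 = inv_into (TB a S l\<^sub>0) (D_map a l\<^sub>0)"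

text \<open>
  The maps induced on \<open>\<alpha>\<close>-classes and divisors.  A divisor is represented by any tuple enumerating it;
  the union in \<open>B_hat\<close> is over equal classes.
\<close>

definition D_hat :: "real^'n::finite \<Rightarrow> 'n line \<Rightarrow> 'n trajectory set \<Rightarrow> 'n hyperpl multiset" where
  "D_hat a l\<^sub>0 c = (THE M. \<forall>t\<in>c. mset (D_map a l\<^sub>0 t) = M)"

definition B_hat ::
    "real^'n::finite \<Rightarrow> real set \<Rightarrow> 'n line \<Rightarrow> 'n hyperpl multiset \<Rightarrow> 'n trajectory set" where
  "B_hat a S l\<^sub>0 M = (\<Union>xs \<in> {xs. mset xs = M}. alpha_equiv a S l\<^sub>0 `` {B_map a S l\<^sub>0 xs})"

definition traj_sum ::
    "real^'n::finite \<Rightarrow> real set \<Rightarrow> 'n line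
       \<Rightarrow> 'n trajectory set \<Rightarrow> 'n trajectory set \<Rightarrow> 'n trajectory set" where
  "traj_sum a S l\<^sub>0 c\<^sub>1 c\<^sub>2 = B_hat a S l\<^sub>0 (D_hat a l\<^sub>0 c\<^sub>1 + D_hat a l\<^sub>0 c\<^sub>2)"


definition comm_semigroup_on :: "'a set \<Rightarrow> ('a \<Rightarrow> 'a \<Rightarrow> 'a) \<Rightarrow> bool" where
  "comm_semigroup_on A f \<longleftrightarrow>
     (\<forall>x\<in>A. \<forall>y\<in>A. f x y \<in> A) \<and>
     (\<forall>x\<in>A. \<forall>y\<in>A. \<forall>z\<in>A. f (f x y) z = f x (f y z)) \<and>
     (\<forall>x\<in>A. \<forall>y\<in>A. f x y = f y x)"

definition semigroup_iso ::
    "('a \<Rightarrow> 'b) \<Rightarrow> 'a set \<Rightarrow> ('a \<Rightarrow> 'a \<Rightarrow> 'a) \<Rightarrow> 'b set \<Rightarrow> ('b \<Rightarrow> 'b \<Rightarrow> 'b) \<Rightarrow> bool" where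
  "semigroup_iso \<phi> A f B g \<longleftrightarrow>
     bij_betw \<phi> A B \<and> (\<forall>x\<in>A. \<forall>y\<in>A. \<phi> (f x y) = g (\<phi> x) (\<phi> y))"

end

theory Submission
  imports Defs
begin

text \<open>
  A line is treated as a plane \<open>L\<close> of \<open>real^'n \<times> real\<close>, a hyperplane by its normal vector \<open>N\<close>.  The
  members \<open>q\<close> of the confocal family are the forms of a pencil on normal vectors, with \<open>N\<close> tangent to
  \<open>q\<close> iff it is isotropic; the form of \<open>AtInfinity\<close> is the Euclidean one.  If \<open>L\<close> is reflected in \<open>H\<close> and the image in \<open>K\<close>, the fourth hyperplane
  is the second isotropic vector on the pencil of \<open>H\<close> and \<open>K\<close> for the form of \<open>K\<close>: the image of \<open>K\<close>
  under the reflection in \<open>H\<close> with respect to that form.  For fixed \<open>H\<close> this is a bijection from the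
  curve of the reflected line to the curve of \<open>L\<close>.  Swapping the two isotropic vectors of
  each form on the pencil is an isometry of all forms at once, hence the products of two reflections
  along both sides of a double reflection configuration agree, for the Euclidean form (closing the
  configuration) and for all others (the transports of hyperplanes along both sides agree).
  Consequently a double reflection move transposes two neighbours in the
  divisor of a trajectory, and all permutations are reached.
\<close>

section \<open>Poles and reflections in projective space\<close>

text \<open>"Confocal" means exactly that the dual equations, the sum of
  \<open>(a $ i - \<mu>)\<close> times the squared coordinates of the normal minus the square of the
  last coordinate, depend linearly on \<mu> and contain the Euclidean form in their pencil. Hence
  the poles of one tangent hyperplane for all members lie on one projective line, the normal at the
  point of tangency, and this ties Euclidean reflections to the reflections of all other forms.
  Three obstacles shape the proof. The degenerate members have forms with a kernel, so that a
  hyperplane cannot be recovered from its pole; they are treated apart, and \<open>regular\<close>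
  forbids a line to lie in one of them. The completion of a configuration is a definite description,
  so besides the constructed solution every other one must be refuted: the pencil always offers
  \<open>K\<close> itself as a second candidate. Finally, if \<open>H = K\<close> the pencil is not
  determined by the first two mirrors; there the proof counts, a line being reflected in at most two
  tangent hyperplanes of each member.\<close>

definition hyp :: "'a::real_inner \<Rightarrow> 'a set" where
  "hyp N = {y. N \<bullet> y = 0}"

lemma hyp_scale: "c \<noteq> 0 \<Longrightarrow> hyp (c *\<^sub>R N) = hyp N"
  by (auto simp: hyp_def)

lemma hyp_subset_hyp:
  assumes "hyp N \<subseteq> hyp M"
  shows "\<exists>c. M = c *\<^sub>R N"
proof (cases "N = 0")
  case True
  then have "hyp N = UNIV" by (simp add: hyp_def)
  then have "M \<in> hyp M" using assms by blast
  then have "M = 0" by (simp add: hyp_def)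
  then show ?thesis using True by auto
next
  case False
  define c where "c = (M \<bullet> N) / (N \<bullet> N)"
  have w: "N \<bullet> (M - c *\<^sub>R N) = 0"
    using False by (simp add: c_def inner_diff_right inner_commute)
  then have "M \<bullet> (M - c *\<^sub>R N) = 0" using assms by (auto simp: hyp_def)
  then have "(M - c *\<^sub>R N) \<bullet> (M - c *\<^sub>R N) = 0"
    using w by (simp add: inner_diff_left)
  then show ?thesis by auto
qed

lemma hyp_eqE:
  assumes "hyp N = hyp M" "N \<noteq> 0" "M \<noteq> 0"
  obtains c where "c \<noteq> 0" "M = c *\<^sub>R N"
  using hyp_subset_hyp[of N M] assms by auto

lemma subspace_hyp: "subspace (hyp N)"
  unfolding hyp_def by (rule subspace_hyperplane)

lemma span_pairE:
  assumes "x \<in> span {H, K}"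
  obtains s t where "x = s *\<^sub>R H + t *\<^sub>R K"
proof -
  obtain s t where "x - s *\<^sub>R H - t *\<^sub>R K = 0"
    using assms by (auto simp: span_insert)
  then have "x = s *\<^sub>R H + t *\<^sub>R K" by (simp add: algebra_simps)
  then show ?thesis by (rule that)
qed

text \<open>Turns membership in a pencil, given by intersections, into coordinates of normals. The
  part of \<open>M\<close> orthogonal to \<open>H\<close> and \<open>K\<close> lies in both
  hyperplanes, hence in \<open>hyp M\<close>, and so is orthogonal to itself.\<close>

lemma hyp_Int_subset_hyp:
  fixes H K M :: "'a::euclidean_space"
  assumes "hyp H \<inter> hyp K \<subseteq> hyp M"
  shows "\<exists>s t. M = s *\<^sub>R H + t *\<^sub>R K"
proof -
  obtain y z where y: "y \<in> span {H, K}" and z: "\<And>w. w \<in> span {H, K} \<Longrightarrow> orthogonal z w"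
    and M: "M = y + z"
    using orthogonal_subspace_decomp_exists[of "{H, K}" M] by metis
  have "z \<in> hyp H \<inter> hyp K"
    using z[of H] z[of K] by (auto simp: hyp_def orthogonal_def span_base inner_commute)
  then have "M \<bullet> z = 0" using assms by (auto simp: hyp_def)
  moreover have "y \<bullet> z = 0" using z[OF y] by (simp add: orthogonal_def inner_commute)
  ultimately have "z = 0" using M by (simp add: inner_add_left)
  then have "M \<in> span {H, K}" using y M by simp
  then show ?thesis by (rule span_pairE) blast
qed

lemma independent_pair:
  fixes x y :: "'a::real_vector"
  assumes "x \<noteq> 0" "\<And>c. y \<noteq> c *\<^sub>R x"
  shows "independent {x, y}" "x \<noteq> y"
proof -
  show "x \<noteq> y" using assms(2)[of 1] by auto
  have "y \<notin> span {x}" using assms(2) by (auto simp: span_singleton)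
  then have "independent {y, x}" using assms(1)
    by (simp add: independent_insert)
  then show "independent {x, y}" by (simp add: insert_commute)
qed

text \<open>Source of the value \<open>CARD('n) - 1\<close> in the pencil condition: the ambient
  space \<open>real^'n \<times> real\<close> has dimension \<open>CARD('n) + 1\<close>.\<close>

lemma dim_hyp_Int:
  fixes H K :: "'a::euclidean_space"
  assumes "H \<noteq> 0" "\<And>c. K \<noteq> c *\<^sub>R H"
  shows "dim (hyp H \<inter> hyp K) = DIM('a) - 2"
proof -
  have "dim (span {H, K}) = 2"
    using independent_pair[OF assms] by (simp add: dim_eq_card_independent)
  moreover have "dim {y \<in> UNIV. \<forall>x \<in> span {H, K}. orthogonal x y} + dim (span {H, K}) = dim (UNIV :: 'a set)"
    by (rule dim_subspace_orthogonal_to_vectors) auto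
  moreover have "{y \<in> UNIV. \<forall>x \<in> span {H, K}. orthogonal x y} = hyp H \<inter> hyp K"
  proof -
    have "orthogonal x y" if "x \<in> span {H, K}" "H \<bullet> y = 0" "K \<bullet> y = 0" for x y
      using that by (elim span_pairE) (simp add: orthogonal_def inner_add_left)
    moreover have "H \<bullet> y = 0" "K \<bullet> y = 0" if "\<forall>x \<in> span {H, K}. orthogonal x y" for y
      using that span_base[of H "{H, K}"] span_base[of K "{H, K}"] by (auto simp: orthogonal_def)
    ultimately show ?thesis unfolding hyp_def by blast
  qed
  ultimately show ?thesis by simp
qed

lemma plane_coordinates:
  fixes L :: "'a::euclidean_space set"
  assumes "subspace L" "dim L = 2" "x \<in> L" "y \<in> L" "x \<noteq> 0" "\<And>c. y \<noteq> c *\<^sub>R x" "z \<in> L"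
  shows "\<exists>s t. z = s *\<^sub>R x + t *\<^sub>R y"
proof -
  have "L \<subseteq> span {x, y}"
    using card_ge_dim_independent[of "{x, y}" L] independent_pair[OF assms(5,6)] assms by auto
  then have "z \<in> span {x, y}" using assms by auto
  then show ?thesis by (rule span_pairE) blast
qed

lemma plane_eqI:
  fixes L :: "'a::euclidean_space set"
  assumes "subspace L" "dim L = 2" "subspace L'" "dim L' = 2"
    and "x \<in> L" "y \<in> L" "x \<in> L'" "y \<in> L'" "x \<noteq> 0" "\<And>c. y \<noteq> c *\<^sub>R x"
  shows "L = L'"
proof -
  have "L \<subseteq> L'" "L' \<subseteq> L"
    using plane_coordinates[OF assms(1,2,5,6,9,10)] plane_coordinates[OF assms(3,4,7,8,9,10)] assms
    by (metis subsetI subspace_add subspace_scale)+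
  then show ?thesis by simp
qed


text \<open>The matrix of the dual quadric. For a nondegenerate \<open>Conf \<mu>\<close> it inverts
  the matrix of \<open>qform\<close>, so it takes a tangent hyperplane to its point of tangency.
  Being polynomial in \<mu>, it also makes sense at \<open>a $ i\<close>; \<open>AtInfinity\<close>
  is the limit after division by \<open>- \<mu>\<close>.\<close>

definition pole :: "real^'n::finite \<Rightarrow> member \<Rightarrow> 'n hvec \<Rightarrow> 'n hvec" where
  "pole a q N = (case q of Conf \<mu> \<Rightarrow> (\<chi> i. (a $ i - \<mu>) * fst N $ i, - snd N)
                         | AtInfinity \<Rightarrow> (fst N, 0))"

text \<open>
  For \<open>q = Conf (a $ i)\<close> the isotropic vectors \<open>N\<close> are the tangent hyperplanes of the focal quadric in
  \<open>coord_hyper i\<close>; the condition on degenerate members leaves only the hyperplane itself.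
\<close>

definition dual_tangent :: "real^'n::finite \<Rightarrow> member \<Rightarrow> 'n hvec \<Rightarrow> bool" where
  "dual_tangent a q N \<longleftrightarrow>
     N \<noteq> 0 \<and> N \<bullet> pole a q N = 0 \<and> (degenerate a q \<longrightarrow> pole a q N = 0)"

text \<open>The reflection in the hyperplane at infinity is the one in the origin.\<close>

definition centre :: "('n::finite) hvec \<Rightarrow> 'n hvec" where
  "centre N = (if fst N = 0 then (0, 1 / snd N) else ((1 / (fst N \<bullet> fst N)) *\<^sub>R fst N, 0))"

text \<open>The projective involution that fixes \<open>hyp N\<close> pointwise and fixes the point
  \<open>centre N\<close>. For a finite hyperplane the centre is the point at infinity in the normal
  direction, and this is the Euclidean mirror image in homogeneous coordinates.\<close>

definition reflect :: "('n::finite) hvec \<Rightarrow> 'n hvec \<Rightarrow> 'n hvec" where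
  "reflect N v = v - (2 * (N \<bullet> v)) *\<^sub>R centre N"

lemma pole_add: "pole a q (N + M) = pole a q N + pole a q M"
  by (cases q) (auto simp: pole_def prod_eq_iff vec_eq_iff algebra_simps)

lemma pole_scale: "pole a q (c *\<^sub>R N) = c *\<^sub>R pole a q N"
  by (cases q) (auto simp: pole_def prod_eq_iff vec_eq_iff algebra_simps)

lemma pole_diff: "pole a q (N - M) = pole a q N - pole a q M"
  by (cases q) (auto simp: pole_def prod_eq_iff vec_eq_iff algebra_simps)

lemma pole_zero: "pole a q 0 = 0"
  using pole_scale[of a q 0 0] by simp

lemmas pole_linear = pole_add pole_scale pole_diff pole_zero

lemma inner_pole_commute: "M \<bullet> pole a q N = N \<bullet> pole a q M"
  by (cases q) (auto simp: pole_def inner_prod_def inner_vec_def algebra_simps)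

lemma pole_eq_0_imp:
  assumes "\<not> degenerate a q" "pole a q N = 0"
  shows "N = 0"
proof (cases q)
  case (Conf \<mu>)
  then have "a $ i - \<mu> \<noteq> 0" for i using assms(1) by (auto simp: degenerate_def)
  then show ?thesis using assms(2) Conf by (auto simp: pole_def prod_eq_iff vec_eq_iff)
qed (use assms in \<open>auto simp: degenerate_def\<close>)

lemma dual_tangent_nonzero: "dual_tangent a q N \<Longrightarrow> N \<noteq> 0"
  by (simp add: dual_tangent_def)

lemma dual_tangent_pole_orth: "dual_tangent a q N \<Longrightarrow> N \<bullet> pole a q N = 0"
  by (simp add: dual_tangent_def)

lemma dual_tangent_scale: "dual_tangent a q N \<Longrightarrow> c \<noteq> 0 \<Longrightarrow> dual_tangent a q (c *\<^sub>R N)"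
  by (auto simp: dual_tangent_def pole_linear)

lemma dual_tangent_AtInfinity: "dual_tangent a AtInfinity N \<longleftrightarrow> fst N = 0 \<and> snd N \<noteq> 0"
  by (auto simp: dual_tangent_def pole_def degenerate_def prod_eq_iff inner_prod_def)

lemma dual_tangent_Conf_fst: "dual_tangent a (Conf \<mu>) N \<Longrightarrow> fst N \<noteq> 0"
  by (auto simp: dual_tangent_def pole_def prod_eq_iff inner_prod_def)

text \<open>Linearity of the pencil: two finite members differ by a multiple of the Euclidean
  form.\<close>

lemma inner_pole_Conf:
  "N \<bullet> pole a (Conf \<mu>) M = N \<bullet> pole a (Conf \<nu>) M + (\<nu> - \<mu>) * (fst N \<bullet> fst M)"
  by (simp add: pole_def inner_prod_def inner_vec_def sum_distrib_left algebra_simps sum.distrib sum_subtractf)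

lemma inner_pole_AtInfinity: "N \<bullet> pole a AtInfinity M = fst N \<bullet> fst M"
  by (simp add: pole_def inner_prod_def)

lemma dual_tangent_other_member:
  assumes "dual_tangent a q N" "q \<noteq> q'"
  shows "N \<bullet> pole a q' N \<noteq> 0"
proof (cases q)
  case (Conf \<mu>)
  have n: "fst N \<noteq> 0" using assms Conf dual_tangent_Conf_fst by blast
  show ?thesis
  proof (cases q')
    case Conf': (Conf \<nu>)
    then show ?thesis
      using assms Conf n inner_pole_Conf[of N a \<nu> N \<mu>] dual_tangent_pole_orth[OF assms(1)] by auto
  next
    case AtInfinity
    then show ?thesis using n by (simp add: inner_pole_AtInfinity)
  qed
next
  case AtInfinity
  then obtain \<nu> where "q' = Conf \<nu>" using assms by (cases q') auto
  then show ?thesis using assms AtInfinity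
    by (simp add: dual_tangent_AtInfinity pole_def inner_prod_def)
qed

lemma centre_orth: "N \<noteq> 0 \<Longrightarrow> N \<bullet> centre N = 1"
  by (auto simp: centre_def inner_prod_def prod_eq_iff)

text \<open>Changing the member changes the pole only along \<open>(fst N, 0)\<close>, a multiple of
  the centre. The coefficient of the centre is forced, since \<open>N\<close> is orthogonal to
  \<open>pole a q N\<close> and \<open>N \<bullet> centre N = 1\<close>.\<close>

lemma pole_decomposition:
  assumes "dual_tangent a q N"
  shows "\<exists>s. pole a q' N = s *\<^sub>R pole a q N + (N \<bullet> pole a q' N) *\<^sub>R centre N"
proof (cases q)
  case (Conf \<mu>)
  have n: "fst N \<noteq> 0" using assms Conf dual_tangent_Conf_fst by blast
  then have c: "(fst N \<bullet> fst N) *\<^sub>R centre N = (fst N, 0)"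
    by (simp add: centre_def)
  show ?thesis
  proof (cases q')
    case Conf': (Conf \<nu>)
    have "N \<bullet> pole a q' N = (\<mu> - \<nu>) * (fst N \<bullet> fst N)"
      using assms Conf Conf' inner_pole_Conf[of N a \<nu> N \<mu>] by (simp add: dual_tangent_def)
    then have "(N \<bullet> pole a q' N) *\<^sub>R centre N = (\<mu> - \<nu>) *\<^sub>R (fst N, 0)"
      using c by (metis scaleR_scaleR)
    then have "pole a q' N = 1 *\<^sub>R pole a q N + (N \<bullet> pole a q' N) *\<^sub>R centre N"
      by (simp add: Conf Conf' pole_def prod_eq_iff vec_eq_iff algebra_simps)
    then show ?thesis ..
  next
    case AtInfinity
    then have "pole a q' N = 0 *\<^sub>R pole a q N + (N \<bullet> pole a q' N) *\<^sub>R centre N"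
      using c inner_pole_AtInfinity[of N a N] by (simp add: pole_def)
    then show ?thesis ..
  qed
next
  case AtInfinity
  then have N: "fst N = 0" "snd N \<noteq> 0" using assms by (auto simp: dual_tangent_AtInfinity)
  have "pole a q' N = 0 *\<^sub>R pole a q N + (N \<bullet> pole a q' N) *\<^sub>R centre N"
    using N by (cases q') (auto simp: pole_def centre_def inner_prod_def inner_vec_def prod_eq_iff vec_eq_iff)
  then show ?thesis ..
qed

section \<open>Linear reflections in hyperplanes\<close>

lemma reflect_add: "reflect N (v + w) = reflect N v + reflect N w"
  by (simp add: reflect_def algebra_simps)

lemma reflect_scale: "reflect N (c *\<^sub>R v) = c *\<^sub>R reflect N v"
  by (simp add: reflect_def algebra_simps)

lemma linear_reflect: "linear (reflect N)"
  by (intro linearI reflect_add reflect_scale)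

lemma centre_scale: "c \<noteq> 0 \<Longrightarrow> centre (c *\<^sub>R N) = (1 / c) *\<^sub>R centre N"
  by (auto simp: centre_def prod_eq_iff field_simps)

lemma reflect_scale_normal: "c \<noteq> 0 \<Longrightarrow> reflect (c *\<^sub>R N) = reflect N"
  by (auto simp: reflect_def fun_eq_iff centre_scale)

lemma inner_reflect: "N \<noteq> 0 \<Longrightarrow> N \<bullet> reflect N v = - (N \<bullet> v)"
  by (simp add: reflect_def inner_diff_right centre_orth)

lemma reflect_reflect: "N \<noteq> 0 \<Longrightarrow> reflect N (reflect N v) = v"
  using inner_reflect[of N v] by (simp add: reflect_def[of N "reflect N v"]) (simp add: reflect_def)

lemma reflect_fixed: "N \<bullet> v = 0 \<Longrightarrow> reflect N v = v"
  by (simp add: reflect_def)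

lemma reflect_image_reflect_image: "N \<noteq> 0 \<Longrightarrow> reflect N ` reflect N ` L = L"
  by (simp add: image_image reflect_reflect)

lemma inj_reflect: "N \<noteq> 0 \<Longrightarrow> inj (reflect N)"
  by (metis injI reflect_reflect)

lemma subspace_reflect: "subspace L \<Longrightarrow> subspace (reflect N ` L)"
  by (rule linear_subspace_image[OF linear_reflect])

lemma dim_reflect: "N \<noteq> 0 \<Longrightarrow> dim (reflect N ` L) = dim L"
  by (rule dim_image_eq[OF linear_reflect]) (simp add: inj_reflect inj_on_subset[OF inj_reflect])

text \<open>Normal incidence: for \<open>v\<close> in \<open>L\<close> off the mirror,
  \<open>v - reflect N v\<close> is a nonzero multiple of the centre.\<close>

lemma reflect_invariant_imp_centre:
  assumes "subspace L" "N \<noteq> 0" "\<not> L \<subseteq> hyp N" "reflect N ` L = L"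
  shows "centre N \<in> L"
proof -
  obtain v where v: "v \<in> L" "N \<bullet> v \<noteq> 0" using assms by (auto simp: hyp_def)
  have "reflect N v \<in> L" using assms v by blast
  then have "(1 / (2 * (N \<bullet> v))) *\<^sub>R (v - reflect N v) \<in> L"
    using assms v by (intro subspace_scale subspace_diff)
  then show ?thesis using v by (simp add: reflect_def)
qed

lemma centre_imp_reflect_invariant:
  assumes "subspace L" "N \<noteq> 0" "centre N \<in> L"
  shows "reflect N ` L = L"
proof -
  have "reflect N v \<in> L" if "v \<in> L" for v
    using assms that by (simp add: reflect_def subspace_diff subspace_scale)
  then show ?thesis using reflect_reflect[OF assms(2)] by (metis image_subsetI rev_image_eqI subsetI subset_antisym)
qed

section \<open>Reflection and tangency of lines with respect to a member\<close>

definition reflectable :: "real^'n::finite \<Rightarrow> member \<Rightarrow> 'n hvec \<Rightarrow> 'n hvec set \<Rightarrow> bool" where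
  "reflectable a q N L \<longleftrightarrow> dual_tangent a q N \<and> pole a q N \<in> L \<and> \<not> L \<subseteq> hyp N"

definition tangent_to :: "real^'n::finite \<Rightarrow> member \<Rightarrow> 'n hvec set \<Rightarrow> bool" where
  "tangent_to a q L \<longleftrightarrow> (\<exists>N. dual_tangent a q N \<and> pole a q N \<in> L \<and> L \<subseteq> hyp N)"

text \<open>The pole of a degenerate member at its own hyperplane is \<open>0\<close>, which lies in
  every subspace; so \<open>tangent_to\<close> says there that the line is contained in the
  hyperplane. Regular planes are the projective lines contained neither in a coordinate hyperplane
  nor in the hyperplane at infinity.\<close>

definition regular :: "real^'n::finite \<Rightarrow> 'n hvec set \<Rightarrow> bool" where
  "regular a L \<longleftrightarrow> subspace L \<and> dim L = 2 \<and> (\<forall>q. degenerate a q \<longrightarrow> \<not> tangent_to a q L)"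

text \<open>Up to scaling the second isotropic vector for \<open>q\<close> on the pencil of \<open>H\<close> and \<open>K\<close>, if \<open>K\<close> is one.\<close>

definition fourth :: "real^'n::finite \<Rightarrow> member \<Rightarrow> 'n hvec \<Rightarrow> 'n hvec \<Rightarrow> 'n hvec" where
  "fourth a q H K = (H \<bullet> pole a q H) *\<^sub>R K - (2 * (H \<bullet> pole a q K)) *\<^sub>R H"

lemma scaleR_eq_imp:
  assumes "b \<noteq> 0" "b *\<^sub>R x = d *\<^sub>R y"
  shows "x = (d / b) *\<^sub>R (y :: 'a::real_vector)"
proof -
  have "inverse b *\<^sub>R (b *\<^sub>R x) = inverse b *\<^sub>R (d *\<^sub>R y)" using assms by simp
  then show ?thesis using assms(1) by (simp add: divide_inverse mult.commute)
qed

text \<open>Reflection in \<open>hyp N\<close> with centre \<open>pole a m N\<close>. It serves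
  twice: for \<open>AtInfinity\<close> it is the Euclidean reflection of lines, and on poles it
  describes \<open>fourth a m N\<close>, the transport of hyperplanes.\<close>

definition form_reflect :: "real^'n::finite \<Rightarrow> member \<Rightarrow> 'n hvec \<Rightarrow> 'n hvec \<Rightarrow> 'n hvec" where
  "form_reflect a m N v = v - (2 * (N \<bullet> v) / (N \<bullet> pole a m N)) *\<^sub>R pole a m N"

lemma pole_in_reflect_image:
  assumes "pole a q N \<in> L" "dual_tangent a q N"
  shows "pole a q N \<in> reflect N ` L"
  by (metis assms dual_tangent_pole_orth image_eqI reflect_fixed)

lemma reflect_image_subset_hyp: "N \<noteq> 0 \<Longrightarrow> reflect N ` L \<subseteq> hyp N \<longleftrightarrow> L \<subseteq> hyp N"
  unfolding image_subset_iff hyp_def mem_Collect_eq subset_eq by (simp add: inner_reflect)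

lemma reflectableD:
  assumes "reflectable a q N L"
  shows "dual_tangent a q N" "pole a q N \<in> L" "\<not> L \<subseteq> hyp N"
  using assms unfolding reflectable_def by blast+

lemma reflectable_reflect: "reflectable a q N L \<Longrightarrow> reflectable a q N (reflect N ` L)"
  using reflectableD[of a q N L] pole_in_reflect_image[of a q N L]
    reflect_image_subset_hyp[OF dual_tangent_nonzero, of a q N L]
  unfolding reflectable_def by metis

lemma reflectable_nonzero: "reflectable a q N L \<Longrightarrow> N \<noteq> 0"
  unfolding reflectable_def using dual_tangent_nonzero by blast

lemma reflectable_scale: "c \<noteq> 0 \<Longrightarrow> subspace L \<Longrightarrow> reflectable a q N L \<Longrightarrow> reflectable a q (c *\<^sub>R N) L"
  by (simp add: reflectable_def dual_tangent_scale hyp_scale pole_linear subspace_scale)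

lemma fourth_eq_0:
  assumes "fourth a q H K = 0" "H \<bullet> pole a q H \<noteq> 0" "K \<noteq> 0"
  shows "hyp K = hyp H"
proof -
  let ?e = "2 * (H \<bullet> pole a q K) / (H \<bullet> pole a q H)"
  have K: "K = ?e *\<^sub>R H" using assms(1,2) by (intro scaleR_eq_imp) (simp_all add: fourth_def)
  then have "?e \<noteq> 0" using assms(3) by (metis scaleR_zero_left)
  then show ?thesis using K hyp_scale by metis
qed

text \<open>\<open>fourth a q H\<close> is a reflection for the form of \<open>q\<close>, multiplied
  by \<open>H \<bullet> pole a q H\<close>. Cleared of the denominator it still makes sense for
  isotropic \<open>H\<close>, where it yields a multiple of \<open>H\<close>.\<close>

lemma fourth_isotropic:
  assumes "K \<bullet> pole a q K = 0"
  shows "fourth a q H K \<bullet> pole a q (fourth a q H K) = 0"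
  using assms inner_pole_commute[of K a q H]
  by (simp add: fourth_def pole_linear inner_diff_left inner_diff_right algebra_simps)

lemma dual_tangent_fourth:
  assumes "dual_tangent a q K" "fourth a q H K \<noteq> 0"
  shows "dual_tangent a q (fourth a q H K)"
  using assms fourth_isotropic[of K a q H]
  by (auto simp: dual_tangent_def fourth_def pole_linear)

text \<open>The reflection in \<open>H\<close> for the form of \<open>q\<close> and the Euclidean
  one differ, on poles, by a multiple of the point of tangency \<open>pole a p H\<close>. As that
  point lies on the line, the pole of the fourth hyperplane does so too.\<close>

lemma pole_fourth:
  assumes "dual_tangent a p H"
  shows "\<exists>s. pole a q (fourth a q H K) =
     (H \<bullet> pole a q H) *\<^sub>R reflect H (pole a q K) - s *\<^sub>R pole a p H"
proof -
  obtain s where s: "pole a q H = s *\<^sub>R pole a p H + (H \<bullet> pole a q H) *\<^sub>R centre H"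
    using pole_decomposition[OF assms] by blast
  let ?b = "H \<bullet> pole a q H" and ?c = "H \<bullet> pole a q K"
  have "pole a q (fourth a q H K) = ?b *\<^sub>R pole a q K - (2 * ?c) *\<^sub>R pole a q H"
    by (simp add: fourth_def pole_linear)
  also have "\<dots> = ?b *\<^sub>R pole a q K - (2 * ?c) *\<^sub>R (s *\<^sub>R pole a p H + ?b *\<^sub>R centre H)"
    by (subst s) simp
  also have "\<dots> = ?b *\<^sub>R reflect H (pole a q K) - (2 * ?c * s) *\<^sub>R pole a p H"
    by (simp add: reflect_def algebra_simps)
  finally show ?thesis by blast
qed

lemma pole_fourth_mem:
  assumes "subspace L" "dual_tangent a p H" "pole a p H \<in> L" "pole a q K \<in> reflect H ` L"
  shows "pole a q (fourth a q H K) \<in> L"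
proof -
  obtain w where "w \<in> L" "pole a q K = reflect H w" using assms(4) by blast
  then have r: "reflect H (pole a q K) \<in> L"
    using reflect_reflect[OF dual_tangent_nonzero[OF assms(2)]] by simp
  obtain s where "pole a q (fourth a q H K) =
     (H \<bullet> pole a q H) *\<^sub>R reflect H (pole a q K) - s *\<^sub>R pole a p H"
    using pole_fourth[OF assms(2)] by blast
  then show ?thesis
    using r assms by (simp add: subspace_diff subspace_scale)
qed

locale confocal =
  fixes a :: "real^'n::finite"
  assumes card_ge_2: "2 \<le> CARD('n)" and inj_a: "inj (\<lambda>i. a $ i)"
begin

text \<open>As the \<open>a $ i\<close> are distinct, the kernel of a degenerate form is
  one-dimensional.\<close>

lemma degenerate_unique:
  assumes "degenerate a q" "dual_tangent a q N" "dual_tangent a q M"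
  shows "hyp N = hyp M"
proof -
  have p: "pole a q N = 0" "pole a q M = 0" "N \<noteq> 0" "M \<noteq> 0"
    using assms by (auto simp: dual_tangent_def)
  have "\<exists>c. M = c *\<^sub>R N"
  proof (cases q)
    case (Conf \<mu>)
    then obtain i where i: "\<mu> = a $ i" using assms(1) by (auto simp: degenerate_def)
    have z: "fst N $ j = 0" "fst M $ j = 0" if "j \<noteq> i" for j
      using p(1,2) that inj_a Conf i by (auto simp: pole_def prod_eq_iff vec_eq_iff inj_def)
    have s: "snd N = 0" "snd M = 0" using p(1,2) Conf by (auto simp: pole_def prod_eq_iff)
    have "fst N $ i \<noteq> 0"
    proof
      assume "fst N $ i = 0"
      then have "fst N $ j = 0" for j using z by (cases "j = i") auto
      then have "N = 0" using s by (simp add: prod_eq_iff vec_eq_iff)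
      then show False using p by simp
    qed
    then obtain c where "fst M $ i = c * fst N $ i"
      by (metis nonzero_eq_divide_eq)
    then have "fst M $ j = c * fst N $ j" for j
      using z by (cases "j = i") auto
    then have "M = c *\<^sub>R N"
      using s by (simp add: prod_eq_iff vec_eq_iff)
    then show ?thesis ..
  next
    case AtInfinity
    then have "M = (snd M / snd N) *\<^sub>R N"
      using assms by (auto simp: dual_tangent_AtInfinity prod_eq_iff)
    then show ?thesis ..
  qed
  then obtain c where c: "M = c *\<^sub>R N" by blast
  then have "c \<noteq> 0" using p(4) by auto
  then show ?thesis unfolding c by (simp add: hyp_scale)
qed

lemma dual_tangent_member_unique:
  assumes "dual_tangent a q N" "dual_tangent a q' N'" "hyp N = hyp N'"
  shows "q = q'"
proof (rule ccontr)
  assume "q \<noteq> q'"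
  obtain c where "c \<noteq> 0" "N' = c *\<^sub>R N"
    using hyp_eqE assms dual_tangent_nonzero by metis
  then have "dual_tangent a q N'" using dual_tangent_scale[OF assms(1)] by simp
  then show False
    using dual_tangent_other_member[of a q N' q'] \<open>q \<noteq> q'\<close> assms dual_tangent_pole_orth by blast
qed

lemma pole_independent:
  assumes "\<not> degenerate a q" "N \<noteq> 0" "M \<noteq> 0" "hyp N \<noteq> hyp M"
  shows "pole a q N \<noteq> 0" "pole a q M \<noteq> c *\<^sub>R pole a q N"
proof -
  show "pole a q N \<noteq> 0" using pole_eq_0_imp assms by blast
  show "pole a q M \<noteq> c *\<^sub>R pole a q N"
  proof
    assume "pole a q M = c *\<^sub>R pole a q N"
    then have "pole a q (M - c *\<^sub>R N) = 0" by (simp add: pole_linear)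
    then have c: "M = c *\<^sub>R N" using pole_eq_0_imp[OF assms(1)] by fastforce
    then have "c \<noteq> 0" using assms(3) by auto
    then show False using assms(4) unfolding c by (simp add: hyp_scale)
  qed
qed

lemma conjugate_poles_subset_hyp:
  assumes "subspace L" "dim L = 2" "\<not> degenerate a q"
    and "dual_tangent a q H" "pole a q H \<in> L" "dual_tangent a q K" "pole a q K \<in> L"
    and "hyp H \<noteq> hyp K" "H \<bullet> pole a q K = 0"
  shows "L \<subseteq> hyp H"
proof
  fix z assume "z \<in> L"
  then obtain s t where "z = s *\<^sub>R pole a q H + t *\<^sub>R pole a q K"
    using plane_coordinates[of L "pole a q H" "pole a q K" z] pole_independent[of q H K] assms
      dual_tangent_nonzero by blast
  then show "z \<in> hyp H"
    using assms(9) dual_tangent_pole_orth[OF assms(4)] by (simp add: hyp_def inner_add_right)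
qed

text \<open>If \<open>L\<close> touches \<open>q\<close> along \<open>hyp K\<close>, the pole of
  \<open>H\<close> lies in \<open>hyp K\<close>; so \<open>H\<close> and \<open>K\<close> are
  conjugate, and \<open>H\<close> is orthogonal to both poles, which span \<open>L\<close>. Tangency
  thus does not depend on the chosen hyperplane.\<close>

lemma tangent_to_imp_subset_hyp:
  assumes "subspace L" "dim L = 2" "tangent_to a q L" "dual_tangent a q H" "pole a q H \<in> L"
  shows "L \<subseteq> hyp H"
proof -
  obtain K where K: "dual_tangent a q K" "pole a q K \<in> L" "L \<subseteq> hyp K"
    using assms by (auto simp: tangent_to_def)
  show ?thesis
  proof (cases "hyp H = hyp K")
    case False
    then have "\<not> degenerate a q" using degenerate_unique K assms by blast
    moreover have "H \<bullet> pole a q K = 0"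
      using K assms(5) inner_pole_commute[of H a q K] by (auto simp: hyp_def)
    ultimately show ?thesis using conjugate_poles_subset_hyp assms K False by blast
  qed (use K in simp)
qed

text \<open>Caustics survive a reflection: the image line touches \<open>q\<close> along
  \<open>fourth a q H K\<close>.\<close>

lemma tangent_to_reflect:
  assumes L: "subspace L" "dim L = 2" and H: "reflectable a p H L" and t: "tangent_to a q L"
  shows "tangent_to a q (reflect H ` L)"
proof -
  obtain K where K: "dual_tangent a q K" "pole a q K \<in> L" "L \<subseteq> hyp K"
    using t unfolding tangent_to_def by blast
  have Ht: "dual_tangent a p H" "pole a p H \<in> L" "\<not> L \<subseteq> hyp H" "H \<noteq> 0"
    using H dual_tangent_nonzero unfolding reflectable_def by blast+
  have "p \<noteq> q" using tangent_to_imp_subset_hyp[OF L t] Ht by blast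
  let ?b = "H \<bullet> pole a q H" and ?c = "H \<bullet> pole a q K" and ?N = "fourth a q H K"
  have b: "?b \<noteq> 0" using dual_tangent_other_member Ht \<open>p \<noteq> q\<close> by blast
  have "?N \<noteq> 0" using fourth_eq_0[OF _ b dual_tangent_nonzero[OF K(1)]] K(3) Ht(3) by metis
  then have "dual_tangent a q ?N" using dual_tangent_fourth K by blast
  moreover have "pole a q ?N \<in> reflect H ` L"
    using pole_fourth_mem[of "reflect H ` L" a p H q K] L Ht K
    by (simp add: subspace_reflect pole_in_reflect_image reflect_image_reflect_image)
  moreover have "reflect H ` L \<subseteq> hyp ?N"
  proof -
    obtain s where s: "pole a q H = s *\<^sub>R pole a p H + ?b *\<^sub>R centre H"
      using pole_decomposition[OF Ht(1)] by blast
    have "K \<bullet> pole a q H = ?b * (K \<bullet> centre H)"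
      using K Ht by (subst s) (auto simp: inner_add_right hyp_def)
    \<comment> \<open>With this value \<open>?N\<close> is \<open>?b\<close> times the image of
      \<open>K\<close> under the adjoint of \<open>reflect H\<close>, so its inner product with
      \<open>reflect H w\<close> is \<open>?b * (K \<bullet> w)\<close>.\<close>
    then have c: "?c = ?b * (K \<bullet> centre H)" using inner_pole_commute by metis
    have "?N \<bullet> reflect H w = 0" if "w \<in> L" for w
    proof -
      have "K \<bullet> w = 0" using that K by (auto simp: hyp_def)
      then show ?thesis using Ht c
        by (simp add: fourth_def inner_diff_left inner_reflect) (simp add: reflect_def inner_diff_right)
    qed
    then show ?thesis by (auto simp: hyp_def)
  qed
  ultimately show ?thesis unfolding tangent_to_def by blast
qed

lemma regular_reflect:
  assumes "regular a L" "reflectable a p H L"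
  shows "regular a (reflect H ` L)"
proof -
  have H: "H \<noteq> 0" using assms by (simp add: reflectable_nonzero)
  have "\<not> tangent_to a q (reflect H ` L)" if "degenerate a q" for q
  proof
    assume "tangent_to a q (reflect H ` L)"
    then have "tangent_to a q (reflect H ` reflect H ` L)"
      using tangent_to_reflect reflectable_reflect[OF assms(2)] assms(1) H
      by (metis dim_reflect regular_def subspace_reflect)
    then show False using assms(1) that reflect_image_reflect_image[OF H] unfolding regular_def by metis
  qed
  moreover have "subspace L" "dim L = 2" using assms(1) by (simp_all add: regular_def)
  ultimately show ?thesis unfolding regular_def using H subspace_reflect dim_reflect by metis
qed

text \<open>For distinct hyperplanes the formula vanishes only if \<open>H\<close> is isotropic for
  \<open>q\<close> and conjugate to \<open>K\<close>. Then \<open>p = q\<close>, and the two poles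
  span a line inside \<open>hyp H\<close>, contrary to reflectability.\<close>

lemma fourth_nonzero:
  assumes L: "subspace L" "dim L = 2" and H: "reflectable a p H L"
    and K: "reflectable a q K (reflect H ` L)" and ne: "hyp H \<noteq> hyp K"
  shows "fourth a q H K \<noteq> 0"
proof
  let ?b = "H \<bullet> pole a q H" and ?c = "H \<bullet> pole a q K"
  assume z: "fourth a q H K = 0"
  have H0: "H \<noteq> 0" and K0: "K \<noteq> 0" using H K reflectable_nonzero by blast+
  have b: "?b = 0" using fourth_eq_0[OF z _ K0] ne by metis
  then have c: "?c = 0" using z H0 by (simp add: fourth_def)
  have "p = q" using b dual_tangent_other_member[OF reflectableD(1)[OF H]] by blast
  then have "\<not> degenerate a q"
    using degenerate_unique ne reflectableD(1)[OF H] reflectableD(1)[OF K] by blast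
  then have "reflect H ` L \<subseteq> hyp H"
    using conjugate_poles_subset_hyp[of "reflect H ` L" q H K] L reflectableD[OF K]
      reflectableD[OF reflectable_reflect[OF H]] ne c \<open>p = q\<close> H0
    by (simp add: subspace_reflect dim_reflect)
  then show False using H H0 by (simp add: reflectable_def reflect_image_subset_hyp)
qed

text \<open>A fourth hyperplane containing \<open>L\<close> would make \<open>L\<close> tangent to
  \<open>q\<close>, hence also its image, which would then lie in \<open>hyp K\<close>.\<close>

lemma fourth_reflectable:
  assumes L: "subspace L" "dim L = 2" and H: "reflectable a p H L"
    and K: "reflectable a q K (reflect H ` L)" and ne: "hyp H \<noteq> hyp K"
  shows "reflectable a q (fourth a q H K) L"
proof -
  have H0: "H \<noteq> 0" using H reflectable_nonzero by blast
  have t: "dual_tangent a q (fourth a q H K)"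
    using dual_tangent_fourth fourth_nonzero[OF assms] reflectableD[OF K] by blast
  have m: "pole a q (fourth a q H K) \<in> L"
    using pole_fourth_mem[of L a p H q K] L reflectableD[OF H] reflectableD[OF K] by blast
  have "\<not> L \<subseteq> hyp (fourth a q H K)"
  proof
    assume "L \<subseteq> hyp (fourth a q H K)"
    then have "tangent_to a q (reflect H ` L)"
      using t m tangent_to_reflect[OF L H] unfolding tangent_to_def by blast
    then have "reflect H ` L \<subseteq> hyp K"
      using tangent_to_imp_subset_hyp[of "reflect H ` L" q K] L reflectableD[OF K]
        subspace_reflect[of L H] dim_reflect[OF H0, of L] by metis
    then show False using reflectableD[OF K] by blast
  qed
  then show ?thesis unfolding reflectable_def using t m by blast
qed

end

text \<open>
  Here \<open>E\<close> and \<open>F\<close> are forms on the span of \<open>h\<close> and \<open>k\<close> with \<open>E11 = F22 = 0\<close>, and the reflections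
  are those of \<open>x * E + y * F\<close>.  Swapping \<open>h\<close> with the second isotropic vector of \<open>E\<close>, and \<open>k\<close> with that
  of \<open>F\<close>, is an isometry of both forms of determinant \<open>-1\<close>, so conjugation by it inverts products
  of two reflections.
\<close>

lemma plane_reflections:
  fixes h k v :: "'w::real_vector" and x y D E12 E22 F11 F12 :: real
  assumes nz: "x \<noteq> 0" "y \<noteq> 0" "E22 \<noteq> 0" "F11 \<noteq> 0" "D \<noteq> 0"
    and D: "D = E22 * F11 - 4 * E12 * F12"
    and p': "p' = E22 * p - 2 * E12 * r" and r': "r' = F11 * r - 2 * F12 * p"
  shows "v - (2 * p / (y * F11)) *\<^sub>R h
           - (2 * (r - 2 * p * (x * E12 + y * F12) / (y * F11)) / (x * E22)) *\<^sub>R k =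
         v - (2 * r' / (x * F11 * D)) *\<^sub>R (F11 *\<^sub>R k - (2 * F12) *\<^sub>R h)
           - (2 * (p' + 2 * r' * (x * E12 + y * F12) / (x * F11)) / (y * E22 * D))
               *\<^sub>R (E22 *\<^sub>R h - (2 * E12) *\<^sub>R k)"
proof -
  \<comment> \<open>\<open>u\<close> and \<open>w\<close> are the coefficients on the right-hand
    side. The coefficients of \<open>h\<close> and of \<open>k\<close> are compared separately,
    multiplied by \<open>x * D\<close> and by \<open>D\<close> to make the equations
    polynomial.\<close>
  define u where "u = 2 * r' / (x * F11 * D)"
  define w where "w = 2 * (p' + 2 * r' * (x * E12 + y * F12) / (x * F11)) / (y * E22 * D)"
  have u: "u * (x * F11 * D) = 2 * r'" using nz by (simp add: u_def)
  have w: "w * (x * F11 * y * E22 * D) = 2 * (p' * x * F11 + 2 * r' * (x * E12 + y * F12))"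
    using nz by (simp add: w_def field_simps)
  have h: "(w * E22 - 2 * F12 * u) * (y * F11) = 2 * p"
  proof -
    have "(w * E22 - 2 * F12 * u) * (y * F11) * (x * D) = 2 * p * (x * D)"
      using u w unfolding D p' r' by algebra
    then show ?thesis using nz by simp
  qed
  have k: "(u * F11 - 2 * E12 * w) * (x * E22 * (y * F11))
      = 2 * (r * (y * F11) - 2 * p * (x * E12 + y * F12))"
  proof -
    have "(u * F11 - 2 * E12 * w) * (x * E22 * (y * F11)) * D
      = 2 * (r * (y * F11) - 2 * p * (x * E12 + y * F12)) * D"
      using u w unfolding D p' r' by algebra
    then show ?thesis using nz by simp
  qed
  have "2 * p / (y * F11) = w * E22 - 2 * F12 * u" using h nz by (simp add: field_simps)
  moreover have "2 * (r - 2 * p * (x * E12 + y * F12) / (y * F11)) / (x * E22) = u * F11 - 2 * E12 * w"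
    using k nz by (simp add: field_simps)
  ultimately show ?thesis
    unfolding u_def[symmetric] w_def[symmetric] by (simp only:) (simp add: algebra_simps)
qed

section \<open>Products of two reflections for all forms of the pencil\<close>

lemma form_combination:
  assumes "p \<noteq> q"
  shows "\<exists>x y. \<forall>N M. N \<bullet> pole a m M = x * (N \<bullet> pole a p M) + y * (N \<bullet> pole a q M)"
proof -
  \<comment> \<open>Coordinates of a member with respect to \<open>Conf 0\<close> and the Euclidean
    form. Distinct members have independent coordinates, and \<open>x\<close>, \<open>y\<close> come
    from Cramer's rule.\<close>
  define u v :: "member \<Rightarrow> real" where uv: "u r = (case r of Conf _ \<Rightarrow> 1 | AtInfinity \<Rightarrow> 0)"
    "v r = (case r of Conf \<mu> \<Rightarrow> - \<mu> | AtInfinity \<Rightarrow> 1)" for r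
  have form: "N \<bullet> pole a r M = u r * (N \<bullet> pole a (Conf 0) M) + v r * (fst N \<bullet> fst M)" for r N M
  proof (cases r)
    case (Conf \<mu>)
    then show ?thesis using inner_pole_Conf[of N a \<mu> M 0] by (simp add: uv)
  qed (simp add: uv inner_pole_AtInfinity)
  define D where "D = u p * v q - u q * v p"
  have D: "D \<noteq> 0" using assms by (cases p; cases q) (simp_all add: D_def uv)
  define x y where xy: "x = (u m * v q - u q * v m) / D" "y = (u p * v m - u m * v p) / D"
  have xyD: "x * D = u m * v q - u q * v m" "y * D = u p * v m - u m * v p" using D by (simp_all add: xy)
  have "N \<bullet> pole a m M = x * (N \<bullet> pole a p M) + y * (N \<bullet> pole a q M)" for N M
  proof -
    have "(N \<bullet> pole a m M) * D = (x * (N \<bullet> pole a p M) + y * (N \<bullet> pole a q M)) * D"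
      using xyD unfolding form[where r = m] form[where r = p] form[where r = q] D_def by algebra
    then show ?thesis using D by simp
  qed
  then show ?thesis by blast
qed

text \<open>In the basis \<open>p\<close>, \<open>q\<close> of the pencil the isotropy of
  \<open>H\<close> for \<open>p\<close> and of \<open>K\<close> for \<open>q\<close> is the shape
  required by \<open>plane_reflections\<close>. Since \<open>m\<close> differs from both, no tangent
  vector occurring here is isotropic for \<open>m\<close>, so all denominators are nonzero.\<close>

lemma form_reflect_fourth:
  assumes H: "dual_tangent a p H" and K: "dual_tangent a q K" and pq: "p \<noteq> q"
    and nz: "fourth a p K H \<noteq> 0" "fourth a q H K \<noteq> 0" and m: "m \<noteq> p" "m \<noteq> q"
  shows "form_reflect a m K (form_reflect a m H v) =
    form_reflect a m (fourth a p K H) (form_reflect a m (fourth a q H K) v)"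
proof -
  obtain x y where xy: "\<And>N M. N \<bullet> pole a m M = x * (N \<bullet> pole a p M) + y * (N \<bullet> pole a q M)"
    using form_combination[OF pq, of a m] by blast
  define E12 E22 F11 F12 where d: "E12 = K \<bullet> pole a p H" "E22 = K \<bullet> pole a p K"
    "F11 = H \<bullet> pole a q H" "F12 = H \<bullet> pole a q K"
  define D where "D = E22 * F11 - 4 * E12 * F12"
  define H' where "H' = fourth a p K H"
  define K' where "K' = fourth a q H K"
  have H': "H' = E22 *\<^sub>R H - (2 * E12) *\<^sub>R K" and K': "K' = F11 *\<^sub>R K - (2 * F12) *\<^sub>R H"
    by (simp_all add: H'_def K'_def fourth_def d)
  have e: "H \<bullet> pole a p H = 0" "K \<bullet> pole a q K = 0" "H \<bullet> pole a p K = E12" "K \<bullet> pole a q H = F12"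
    using H K dual_tangent_pole_orth inner_pole_commute d by metis+
  have mm: "H \<bullet> pole a m H = y * F11" "K \<bullet> pole a m K = x * E22"
    "H \<bullet> pole a m K = x * E12 + y * F12" "K \<bullet> pole a m H = x * E12 + y * F12"
    by (simp_all add: xy e d[symmetric])
  have t: "dual_tangent a p H'" "dual_tangent a q K'"
    using dual_tangent_fourth H K nz unfolding H'_def K'_def by blast+
  have pm: "pole a m H' = E22 *\<^sub>R pole a m H - (2 * E12) *\<^sub>R pole a m K"
    "pole a m K' = F11 *\<^sub>R pole a m K - (2 * F12) *\<^sub>R pole a m H"
    by (simp_all add: H' K' pole_linear)
  have HH: "H' \<bullet> pole a m H' = y * E22 * D" and KK: "K' \<bullet> pole a m K' = x * F11 * D"
    and HK: "H' \<bullet> pole a m K' = - D * (x * E12 + y * F12)"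
    unfolding pm by (simp_all add: H' K' inner_diff_left inner_diff_right mm D_def algebra_simps)
  have n: "y * F11 \<noteq> 0" "x * E22 \<noteq> 0" "y * E22 * D \<noteq> 0" "x * F11 * D \<noteq> 0"
    using dual_tangent_other_member[OF H, of m] dual_tangent_other_member[OF K, of m]
      dual_tangent_other_member[OF t(1), of m] dual_tangent_other_member[OF t(2), of m] m
    unfolding mm HH KK by auto
  define u where "u = H \<bullet> v"
  define r where "r = K \<bullet> v"
  have i: "H' \<bullet> v = E22 * u - 2 * E12 * r" "K' \<bullet> v = F11 * r - 2 * F12 * u"
    by (simp_all add: H' K' inner_diff_left u_def r_def)
  have L: "form_reflect a m K (form_reflect a m H v) =
     v - (2 * u / (y * F11)) *\<^sub>R pole a m H
       - (2 * (r - 2 * u * (x * E12 + y * F12) / (y * F11)) / (x * E22)) *\<^sub>R pole a m K"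
    by (simp add: form_reflect_def mm inner_diff_right u_def r_def)
  have "form_reflect a m H' (form_reflect a m K' v) =
     v - (2 * (K' \<bullet> v) / (x * F11 * D)) *\<^sub>R pole a m K'
       - (2 * (H' \<bullet> v - 2 * (K' \<bullet> v) / (x * F11 * D) * (- D * (x * E12 + y * F12))) / (y * E22 * D)) *\<^sub>R pole a m H'"
    unfolding form_reflect_def HH KK inner_diff_right inner_scaleR_right HK ..
  also have "2 * (K' \<bullet> v) / (x * F11 * D) * (- D * (x * E12 + y * F12)) =
      - (2 * (K' \<bullet> v) * (x * E12 + y * F12) / (x * F11))"
    using n by (simp add: divide_simps)
  also have "v - (2 * (K' \<bullet> v) / (x * F11 * D)) *\<^sub>R pole a m K'
       - (2 * (H' \<bullet> v - - (2 * (K' \<bullet> v) * (x * E12 + y * F12) / (x * F11))) / (y * E22 * D)) *\<^sub>R pole a m H' =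
     form_reflect a m K (form_reflect a m H v)"
    unfolding L pm minus_minus diff_minus_eq_add
    using n by (intro plane_reflections[symmetric]) (auto simp: D_def i)
  finally show ?thesis unfolding H'_def K'_def ..
qed

lemma reflect_eq_form_reflect: "fst N \<noteq> 0 \<Longrightarrow> reflect N = form_reflect a AtInfinity N"
  by (simp add: reflect_def form_reflect_def fun_eq_iff centre_def inner_pole_AtInfinity)
    (simp add: pole_def)

lemma reflect_infinity: "fst H = 0 \<Longrightarrow> snd H \<noteq> 0 \<Longrightarrow> reflect H v = (fst v, - snd v)"
  by (simp add: reflect_def centre_def prod_eq_iff inner_prod_def)

text \<open>Conjugation with the symmetry in the origin, which changes the sign of the last
  coordinate, takes the reflection in \<open>M\<close> to the reflection in the image of that
  hyperplane.\<close>

lemma reflect_flip: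
  assumes "fst N = c *\<^sub>R fst M" "snd N = - c * snd M" "c \<noteq> 0" "fst M \<noteq> 0"
  shows "reflect N v = (fst (reflect M (fst v, - snd v)), - snd (reflect M (fst v, - snd v)))"
  using assms by (simp add: reflect_def centre_def prod_eq_iff inner_prod_def field_simps)

text \<open>The Euclidean form vanishes on the hyperplane at infinity, so
  \<open>form_reflect\<close> does not cover it. Here \<open>H\<close> recurs as its own opposite,
  and the mirror opposite to \<open>K\<close> is its image under the symmetry in the origin.\<close>

lemma reflect_fourth_infinity:
  assumes H: "dual_tangent a p H" and K: "dual_tangent a q K"
    and nz: "fourth a p K H \<noteq> 0" "fourth a q H K \<noteq> 0" and pq: "p = AtInfinity" "q \<noteq> AtInfinity"
  shows "reflect K (reflect H v) = reflect (fourth a p K H) (reflect (fourth a q H K) v)"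
proof -
  obtain \<nu> where q: "q = Conf \<nu>" using pq by (cases q) auto
  have H0: "fst H = 0" "snd H \<noteq> 0" using H pq by (auto simp: dual_tangent_AtInfinity)
  have K0: "fst K \<noteq> 0" using K q dual_tangent_Conf_fst by blast
  have "fourth a p K H = (fst K \<bullet> fst K) *\<^sub>R H"
    by (simp add: fourth_def pq inner_pole_AtInfinity H0)
  then have h: "reflect (fourth a p K H) = reflect H" using K0 by (simp add: reflect_scale_normal)
  have "fst (fourth a q H K) = (- (snd H)\<^sup>2) *\<^sub>R fst K" "snd (fourth a q H K) = - (- (snd H)\<^sup>2) * snd K"
    by (simp_all add: fourth_def q pole_def inner_prod_def H0 power2_eq_square)
  then have k: "reflect (fourth a q H K) v = (fst (reflect K (fst v, - snd v)), - snd (reflect K (fst v, - snd v)))"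
    using H0 K0 by (intro reflect_flip[where c = "- (snd H)\<^sup>2"]) auto
  show ?thesis unfolding h k by (simp add: reflect_infinity H0)
qed

lemma reflect_fourth:
  assumes H: "dual_tangent a p H" and K: "dual_tangent a q K"
    and nz: "fourth a p K H \<noteq> 0" "fourth a q H K \<noteq> 0"
  shows "reflect K (reflect H v) = reflect (fourth a p K H) (reflect (fourth a q H K) v)"
proof -
  consider "p = q" | "p = AtInfinity" "q \<noteq> AtInfinity" | "q = AtInfinity" "p \<noteq> AtInfinity"
    | "p \<noteq> q" "p \<noteq> AtInfinity" "q \<noteq> AtInfinity" by blast
  then show ?thesis
  proof cases
    case 1
    \<comment> \<open>For one and the same form the two isotropic vectors of the pencil are
      \<open>H\<close> and \<open>K\<close> themselves, so both sides are the same product.\<close>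
    have "fourth a p K H = (- 2 * (K \<bullet> pole a p H)) *\<^sub>R K" "fourth a q H K = (- 2 * (H \<bullet> pole a q K)) *\<^sub>R H"
      using dual_tangent_pole_orth[OF H] dual_tangent_pole_orth[OF K] 1 by (simp_all add: fourth_def)
    moreover have "- 2 * (K \<bullet> pole a p H) \<noteq> 0" "- 2 * (H \<bullet> pole a q K) \<noteq> 0"
      using nz calculation by auto
    ultimately show ?thesis using reflect_scale_normal by metis
  next
    case 2
    then show ?thesis using reflect_fourth_infinity[OF H K nz] by blast
  next
    case 3
    \<comment> \<open>The preceding case with \<open>H\<close> and \<open>K\<close> exchanged;
      inverting both products gives the claim.\<close>
    then have "reflect H (reflect K w) = reflect (fourth a q H K) (reflect (fourth a p K H) w)" for w
      using reflect_fourth_infinity[OF K H nz(2,1)] by blast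
    from this[of "reflect (fourth a p K H) (reflect (fourth a q H K) v)"] show ?thesis
      using reflect_reflect nz dual_tangent_nonzero[OF H] dual_tangent_nonzero[OF K] by metis
  next
    case 4
    have "dual_tangent a p (fourth a p K H)" "dual_tangent a q (fourth a q H K)"
      using dual_tangent_fourth H K nz by blast+
    then have "fst H \<noteq> 0" "fst K \<noteq> 0" "fst (fourth a p K H) \<noteq> 0" "fst (fourth a q H K) \<noteq> 0"
      using dual_tangent_Conf_fst 4 H K by (metis member.exhaust)+
    then show ?thesis
      using form_reflect_fourth[OF H K 4(1) nz, of AtInfinity v] 4
      by (simp add: reflect_eq_form_reflect[of _ a])
  qed
qed

lemma pole_fourth_eq_form_reflect:
  assumes "N \<bullet> pole a m N \<noteq> 0"
  shows "pole a m (fourth a m N X) = (N \<bullet> pole a m N) *\<^sub>R form_reflect a m N (pole a m X)"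
  using assms by (simp add: fourth_def form_reflect_def pole_linear scaleR_diff_right)

lemma form_reflect_scale: "form_reflect a m N (c *\<^sub>R v) = c *\<^sub>R form_reflect a m N v"
  by (simp add: form_reflect_def scaleR_diff_right)

text \<open>A third hyperplane \<open>M\<close> carried along the two sides of a configuration. On
  poles this is equality of products of reflections; as \<open>m\<close> is nondegenerate, the
  hyperplanes can be recovered from their poles. The scalar consists of the factors by which
  \<open>fourth\<close> differs from a reflection.\<close>

lemma fourth_fourth:
  assumes H: "dual_tangent a p H" and K: "dual_tangent a q K" and pq: "p \<noteq> q"
    and nz: "fourth a p K H \<noteq> 0" "fourth a q H K \<noteq> 0"
    and m: "m \<noteq> p" "m \<noteq> q" "\<not> degenerate a m"
  shows "\<exists>c. c \<noteq> 0 \<and> fourth a m H (fourth a m K M) =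
    c *\<^sub>R fourth a m (fourth a q H K) (fourth a m (fourth a p K H) M)"
proof -
  define H' where "H' = fourth a p K H"
  define K' where "K' = fourth a q H K"
  have "dual_tangent a p H'" "dual_tangent a q K'"
    using dual_tangent_fourth H K nz unfolding H'_def K'_def by blast+
  then have n: "H \<bullet> pole a m H \<noteq> 0" "K \<bullet> pole a m K \<noteq> 0" "H' \<bullet> pole a m H' \<noteq> 0" "K' \<bullet> pole a m K' \<noteq> 0"
    using dual_tangent_other_member H K m(1,2) by metis+
  have 1: "pole a m (fourth a m X (fourth a m Y M)) =
      ((X \<bullet> pole a m X) * (Y \<bullet> pole a m Y)) *\<^sub>R form_reflect a m X (form_reflect a m Y (pole a m M))"
    if "X \<bullet> pole a m X \<noteq> 0" "Y \<bullet> pole a m Y \<noteq> 0" for X Y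
    using that by (simp add: pole_fourth_eq_form_reflect form_reflect_scale)
  define c where "c = ((H \<bullet> pole a m H) * (K \<bullet> pole a m K)) / ((K' \<bullet> pole a m K') * (H' \<bullet> pole a m H'))"
  have e: "form_reflect a m H (form_reflect a m K v) = form_reflect a m K' (form_reflect a m H' v)" for v
    using form_reflect_fourth[OF K H _ nz(2,1), of m v] pq m unfolding H'_def K'_def by simp
  have "pole a m (fourth a m H (fourth a m K M)) = c *\<^sub>R pole a m (fourth a m K' (fourth a m H' M))"
    using n by (simp add: 1 e c_def)
  then have "pole a m (fourth a m H (fourth a m K M) - c *\<^sub>R fourth a m K' (fourth a m H' M)) = 0"
    by (simp add: pole_linear)
  then have "fourth a m H (fourth a m K M) = c *\<^sub>R fourth a m K' (fourth a m H' M)"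
    using pole_eq_0_imp[OF m(3)] by fastforce
  moreover have "c \<noteq> 0" using n by (simp add: c_def)
  ultimately show ?thesis unfolding H'_def K'_def by blast
qed

section \<open>Double reflection configurations\<close>

text \<open>Attached to the hyperplane as a set, since the points of the curve are sets. The choice
  of the normal is harmless: rescaling it does not change the reflection.\<close>

definition mirror :: "('n::finite) hyperpl \<Rightarrow> 'n hvec \<Rightarrow> 'n hvec" where
  "mirror H = reflect (SOME N. N \<noteq> 0 \<and> hyp N = H)"

definition fiber :: "real^'n::finite \<Rightarrow> member \<Rightarrow> 'n hvec set \<Rightarrow> 'n hyperpl set" where
  "fiber a q L = {H. \<exists>N. H = hyp N \<and> reflectable a q N L}"

text \<open>\<open>DRC\<close> with the intermediate lines expressed by the mirrors and the points
  of reflection absorbed into \<open>fiber\<close>.\<close>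

definition double_reflection ::
    "real^'n::finite \<Rightarrow> 'n hvec set \<Rightarrow> 'n hyperpl \<Rightarrow> 'n hyperpl \<Rightarrow> 'n hyperpl \<Rightarrow> 'n hyperpl \<Rightarrow> bool" where
  "double_reflection a L H K K' H' \<longleftrightarrow> (\<exists>p q.
     H \<in> fiber a p L \<and> K \<in> fiber a q (mirror H ` L) \<and>
     K' \<in> fiber a q L \<and> H' \<in> fiber a p (mirror K' ` L) \<and>
     mirror H' ` mirror K' ` L = mirror K ` mirror H ` L \<and>
     (dim (H \<inter> K \<inter> K' \<inter> H') = CARD('n) - 1 \<or> H = K \<and> K = K' \<and> K' = H' \<and> degenerate a p))"

lemma mirror_hyp:
  assumes "N \<noteq> 0"
  shows "mirror (hyp N) = reflect N"
proof -
  define M where "M = (SOME M. M \<noteq> 0 \<and> hyp M = hyp N)"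
  have "\<exists>M. M \<noteq> 0 \<and> hyp M = hyp N" using assms by blast
  then have "M \<noteq> 0 \<and> hyp M = hyp N" unfolding M_def by (rule someI_ex)
  then obtain c where "c \<noteq> 0" "N = c *\<^sub>R M"
    using hyp_eqE[of M N] assms by blast
  then have "reflect N = reflect M" by (simp add: reflect_scale_normal)
  then show ?thesis unfolding mirror_def M_def by simp
qed

lemma fiberE:
  assumes "H \<in> fiber a q L"
  obtains N where "H = hyp N" "N \<noteq> 0" "reflectable a q N L" "mirror H = reflect N"
proof -
  obtain N where N: "H = hyp N" "reflectable a q N L" using assms unfolding fiber_def by blast
  have n: "N \<noteq> 0" using reflectable_nonzero[OF N(2)] .
  show ?thesis using that[OF N(1) n N(2)] mirror_hyp[OF n] N(1) by simp
qed

lemma hyp_in_fiber: "reflectable a q N L \<Longrightarrow> hyp N \<in> fiber a q L"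
  unfolding fiber_def by blast

lemma hyp_in_fiber_iff:
  assumes "subspace L" "N \<noteq> 0"
  shows "hyp N \<in> fiber a q L \<longleftrightarrow> reflectable a q N L"
proof
  assume "hyp N \<in> fiber a q L"
  then obtain M where M: "hyp N = hyp M" "M \<noteq> 0" "reflectable a q M L" by (rule fiberE)
  obtain c where c: "c \<noteq> 0" "N = c *\<^sub>R M" using hyp_eqE[OF M(1)[symmetric] M(2) assms(2)] .
  show "reflectable a q N L" unfolding c(2) by (rule reflectable_scale[OF c(1) assms(1) M(3)])
qed (rule hyp_in_fiber)

lemma fiber_mirror: "H \<in> fiber a q L \<Longrightarrow> H \<in> fiber a q (mirror H ` L)"
  by (metis fiberE hyp_in_fiber reflectable_reflect)

lemma mirror_mirror: "H \<in> fiber a q L \<Longrightarrow> mirror H ` mirror H ` M = M"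
  by (metis fiberE reflect_image_reflect_image)

section \<open>Symmetries and existence of configurations\<close>

context confocal
begin

lemma fiber_member_unique: "H \<in> fiber a p L \<Longrightarrow> H \<in> fiber a q M \<Longrightarrow> p = q"
  by (metis fiberE reflectableD(1) dual_tangent_member_unique)

lemma regularD:
  assumes "regular a L"
  shows "subspace L" "dim L = 2"
  using assms by (simp_all add: regular_def)

lemma regular_mirror: "regular a L \<Longrightarrow> H \<in> fiber a q L \<Longrightarrow> regular a (mirror H ` L)"
  by (metis fiberE regular_reflect)

lemma fiber_degenerate: "degenerate a q \<Longrightarrow> H \<in> fiber a q L \<Longrightarrow> K \<in> fiber a q M \<Longrightarrow> H = K"
  by (metis fiberE reflectableD(1) degenerate_unique)

lemma double_reflection_sym:
  "double_reflection a L H K K' H' \<Longrightarrow> double_reflection a L K' H' H K"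
  unfolding double_reflection_def
proof (elim exE conjE, goal_cases)
  case (1 p q)
  have "K' \<inter> H' \<inter> H \<inter> K = H \<inter> K \<inter> K' \<inter> H'" by blast
  \<comment> \<open>Reading the configuration the other way exchanges the two members, while the
    degenerate alternative speaks only of the one at \<open>H\<close>.\<close>
  moreover have "p = q" if "H = K'" using 1(1,3) that fiber_member_unique by blast
  ultimately show ?case using 1 by (intro exI[of _ q] exI[of _ p]) auto
qed

text \<open>Starts the quadrilateral at its second line: one side goes back over \<open>L\<close>,
  the other over the third line. In this reading \<open>K\<close> is the completion of
  \<open>H\<close> and \<open>K'\<close>, which inverts the transfer.\<close>

lemma double_reflection_rotate:
  "double_reflection a L H K K' H' \<Longrightarrow> double_reflection a (mirror H ` L) H K' K H'"
  unfolding double_reflection_def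
proof (elim exE conjE, goal_cases)
  case (1 p q)
  have e: "mirror H ` mirror H ` L = L" using mirror_mirror 1(1) by blast
  have "H \<inter> K' \<inter> K \<inter> H' = H \<inter> K \<inter> K' \<inter> H'" by blast
  moreover have "H' \<in> fiber a p (mirror K ` mirror H ` L)"
    using fiber_mirror[OF 1(4)] 1(5) by simp
  moreover have "mirror H' ` mirror K ` mirror H ` L = mirror K' ` mirror H ` mirror H ` L"
    unfolding 1(5)[symmetric] e using mirror_mirror[OF 1(4)] .
  ultimately show ?case using 1 fiber_mirror[OF 1(1)] e by (intro exI[of _ p] exI[of _ q]) auto
qed

lemma double_reflection_fourth:
  assumes L: "regular a L" and H: "reflectable a p H L"
    and K: "reflectable a q K (reflect H ` L)" and ne: "hyp H \<noteq> hyp K"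
  shows "double_reflection a L (hyp H) (hyp K) (hyp (fourth a q H K)) (hyp (fourth a p K H))"
proof -
  define H' where "H' = fourth a p K H"
  define K' where "K' = fourth a q H K"
  note LL = regularD[OF L]
  have H0: "H \<noteq> 0" and K0: "K \<noteq> 0" using H K reflectable_nonzero by metis+
  let ?L1 = "reflect H ` L" let ?L2 = "reflect K ` ?L1"
  have L2: "subspace ?L2" "dim ?L2 = 2" "reflect K ` ?L2 = ?L1"
    using LL H0 K0 by (simp_all add: subspace_reflect dim_reflect reflect_image_reflect_image)
  have K2: "reflectable a q K ?L2" using K reflectable_reflect by metis
  have H1: "reflectable a p H (reflect K ` ?L2)" using H L2 reflectable_reflect by metis
  have K': "reflectable a q K' L" and K'0: "fourth a q H K \<noteq> 0"
    using fourth_reflectable[OF LL H K ne] fourth_nonzero[OF LL H K ne] K'_def by auto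
  \<comment> \<open>The same lemmas for the reversed path, which starts at \<open>?L2\<close> and is
    reflected in \<open>K\<close> before \<open>H\<close>.\<close>
  have H'2: "reflectable a p H' ?L2" and H'0: "fourth a p K H \<noteq> 0"
    using fourth_reflectable[OF L2(1,2) K2 H1] fourth_nonzero[OF L2(1,2) K2 H1] ne H'_def by auto
  have e: "reflect K (reflect H v) = reflect H' (reflect K' v)" for v
    using reflect_fourth[OF reflectableD(1)[OF H] reflectableD(1)[OF K] H'0 K'0] H'_def K'_def by simp
  then have E: "reflect H' ` reflect K' ` L = ?L2" by (simp add: image_image)
  then have "reflectable a p H' (reflect H' ` reflect H' ` reflect K' ` L)"
    using H'2 reflectable_reflect by metis
  then have H': "reflectable a p H' (reflect K' ` L)"
    using H'0 by (simp add: reflect_image_reflect_image H'_def)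
  have ind: "K \<noteq> c *\<^sub>R H" for c
    using K0 ne hyp_scale[of c H] by auto
  have "hyp H \<inter> hyp K \<inter> hyp K' \<inter> hyp H' = hyp H \<inter> hyp K"
    by (auto simp: hyp_def H'_def K'_def fourth_def inner_diff_left)
  then have "dim (hyp H \<inter> hyp K \<inter> hyp K' \<inter> hyp H') = CARD('n) - 1"
    using dim_hyp_Int[OF H0 ind] by simp
  moreover have "mirror (hyp H) = reflect H" "mirror (hyp K) = reflect K"
    "mirror (hyp K') = reflect K'" "mirror (hyp H') = reflect H'"
    using mirror_hyp H0 K0 H'0 K'0 H'_def K'_def by metis+
  ultimately show ?thesis unfolding H'_def[symmetric] K'_def[symmetric]
    unfolding double_reflection_def
    using hyp_in_fiber H K H' K' E by metis
qed

lemma double_reflection_degenerate: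
  assumes "degenerate a p" "H \<in> fiber a p L"
  shows "double_reflection a L H H H H"
  using assms fiber_mirror[OF assms(2)] unfolding double_reflection_def by blast

lemma dim_fiber_Int:
  assumes "H \<in> fiber a p L" "K \<in> fiber a q M" "H \<noteq> K"
  shows "dim (H \<inter> K) = CARD('n) - 1"
proof -
  obtain h k where "H = hyp h" "h \<noteq> 0" "K = hyp k" "k \<noteq> 0" using assms fiberE by metis
  moreover have "k \<noteq> c *\<^sub>R h" for c
    using calculation assms(3) hyp_scale[of c h] by auto
  ultimately show ?thesis using dim_hyp_Int[of h k] by simp
qed

text \<open>For \<open>H = K\<close> the path returns to \<open>L\<close>; reflecting twice in
  \<open>J\<close> returns there as well, and two distinct hyperplanes have the required
  intersection.\<close>

lemma double_reflection_opposite: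
  assumes "H \<in> fiber a p L" "J \<in> fiber a p L" "H \<noteq> J"
  shows "double_reflection a L H H J J"
proof -
  have "H \<inter> H \<inter> J \<inter> J = H \<inter> J" by blast
  then show ?thesis
    unfolding double_reflection_def
    using assms fiber_mirror[OF assms(1)] fiber_mirror[OF assms(2)] mirror_mirror
      dim_fiber_Int[OF assms] by metis
qed

lemma pole_surj:
  assumes "\<not> degenerate a q"
  shows "\<exists>N. pole a q N = w"
proof (cases q)
  case (Conf \<mu>)
  then have "a $ i - \<mu> \<noteq> 0" for i using assms by (auto simp: degenerate_def)
  then have "pole a q (\<chi> i. fst w $ i / (a $ i - \<mu>), - snd w) = w"
    by (simp add: pole_def Conf prod_eq_iff vec_eq_iff)
  then show ?thesis ..
qed (use assms in \<open>simp add: degenerate_def\<close>)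

text \<open>The second point of \<open>L\<close> on the quadric. A point \<open>w\<close> of
  \<open>L\<close> off \<open>hyp h\<close> has a polar hyperplane \<open>W\<close>, and the
  reflection in \<open>W\<close> for the form of \<open>p\<close> moves \<open>h\<close> to another
  isotropic vector, whose pole stays on \<open>L\<close> because the pole of \<open>W\<close> is
  \<open>w\<close>.\<close>

lemma opposite_exists:
  assumes L: "regular a L" and nd: "\<not> degenerate a p" and H: "H \<in> fiber a p L"
  shows "\<exists>J \<in> fiber a p L. J \<noteq> H"
proof -
  obtain h where h: "H = hyp h" "h \<noteq> 0" "reflectable a p h L" using H by (rule fiberE)
  note hD = reflectableD[OF h(3)]
  obtain w where w: "w \<in> L" "h \<bullet> w \<noteq> 0" using hD(3) unfolding hyp_def by blast
  obtain W where W: "pole a p W = w" using pole_surj[OF nd] by blast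
  have P: "W \<bullet> pole a p h = h \<bullet> w" using inner_pole_commute W by metis
  define j where "j = fourth a p W h"
  have j: "j = (W \<bullet> w) *\<^sub>R h - (2 * (h \<bullet> w)) *\<^sub>R W" by (simp add: j_def fourth_def W P)
  have jh: "j \<noteq> c *\<^sub>R h" for c
  proof
    assume "j = c *\<^sub>R h"
    then have "(2 * (h \<bullet> w)) *\<^sub>R W = (W \<bullet> w - c) *\<^sub>R h" using j by (simp add: algebra_simps)
    then have "W = ((W \<bullet> w - c) / (2 * (h \<bullet> w))) *\<^sub>R h" using w by (intro scaleR_eq_imp) auto
    then have "w = ((W \<bullet> w - c) / (2 * (h \<bullet> w))) *\<^sub>R pole a p h" using W pole_scale by metis
    then have "h \<bullet> w = 0"
      using dual_tangent_pole_orth[OF hD(1)] by (metis inner_scaleR_right mult_zero_right)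
    then show False using w by simp
  qed
  have ind: "hyp j \<noteq> hyp h" using hyp_subset_hyp[of h j] jh by blast
  have "j \<noteq> 0" using jh[of 0] by simp
  then have t: "dual_tangent a p j" using dual_tangent_fourth[OF hD(1)] j_def by metis
  have m: "pole a p j \<in> L"
    using regularD[OF L] hD(2) w W by (simp add: j pole_linear subspace_diff subspace_scale)
  have "\<not> L \<subseteq> hyp j"
  proof
    assume "L \<subseteq> hyp j"
    then have "tangent_to a p L" using t m unfolding tangent_to_def by blast
    then show False using tangent_to_imp_subset_hyp[OF regularD[OF L] _ hD(1,2)] hD(3) by blast
  qed
  then have "hyp j \<in> fiber a p L" using t m by (intro hyp_in_fiber) (simp add: reflectable_def)
  then show ?thesis using ind h(1) by blast
qed

text \<open>A line meets a quadric in at most two points unless it lies on it. Dually, the poles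
  span a plane, so \<open>h\<close> is a combination of \<open>x\<close> and \<open>y\<close>; its
  isotropy reads \<open>2 * s * t * (x \<bullet> pole a q y) = 0\<close>, and conjugate
  \<open>x\<close> and \<open>y\<close> would make \<open>L\<close> tangent.\<close>

lemma fiber_le_2:
  assumes L: "regular a L" and f: "H \<in> fiber a q L" "X \<in> fiber a q L" "Y \<in> fiber a q L"
    and ne: "X \<noteq> H" "Y \<noteq> H"
  shows "X = Y"
proof (rule ccontr)
  assume XY: "X \<noteq> Y"
  have nd: "\<not> degenerate a q" using fiber_degenerate f ne by blast
  obtain h where h: "H = hyp h" "h \<noteq> 0" "reflectable a q h L" using f(1) by (rule fiberE)
  obtain x where x: "X = hyp x" "x \<noteq> 0" "reflectable a q x L" using f(2) by (rule fiberE)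
  obtain y where y: "Y = hyp y" "y \<noteq> 0" "reflectable a q y L" using f(3) by (rule fiberE)
  note hD = reflectableD[OF h(3)] and xD = reflectableD[OF x(3)] and yD = reflectableD[OF y(3)]
  note LL = regularD[OF L]
  have "hyp x \<noteq> hyp y" using XY x y by simp
  then obtain s t where "pole a q h = s *\<^sub>R pole a q x + t *\<^sub>R pole a q y"
    using plane_coordinates[OF LL xD(2) yD(2) _ _ hD(2)] pole_independent[OF nd x(2) y(2)] by metis
  then have "pole a q (h - (s *\<^sub>R x + t *\<^sub>R y)) = 0" by (simp add: pole_linear)
  then have hst: "h = s *\<^sub>R x + t *\<^sub>R y" using pole_eq_0_imp[OF nd] by fastforce
  have c: "x \<bullet> pole a q y \<noteq> 0"
    using conjugate_poles_subset_hyp[OF LL nd xD(1,2) yD(1,2) \<open>hyp x \<noteq> hyp y\<close>] xD(3) by blast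
  have "h \<bullet> pole a q h = 2 * s * t * (x \<bullet> pole a q y)"
    using dual_tangent_pole_orth[OF xD(1)] dual_tangent_pole_orth[OF yD(1)] inner_pole_commute[of y a q x]
    by (simp add: hst pole_linear inner_add_left inner_add_right algebra_simps)
  then have "s = 0 \<or> t = 0" using c dual_tangent_pole_orth[OF hD(1)] by simp
  then have "hyp h = hyp y \<or> hyp h = hyp x"
  proof
    assume "s = 0"
    then have "h = t *\<^sub>R y" "t \<noteq> 0" using hst h(2) by auto
    then show ?thesis using hyp_scale[of t y] by simp
  next
    assume "t = 0"
    then have "h = s *\<^sub>R x" "s \<noteq> 0" using hst h(2) by auto
    then show ?thesis using hyp_scale[of s x] by simp
  qed
  then show False using ne h(1) x(1) y(1) by simp
qed

end

section \<open>Normal incidence and uniqueness of the completion\<close>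

context confocal
begin

lemma not_subset_degenerate:
  assumes "regular a L" "degenerate a q" "pole a q N = 0" "N \<noteq> 0"
  shows "\<not> L \<subseteq> hyp N"
proof
  assume "L \<subseteq> hyp N"
  moreover have "dual_tangent a q N" using assms by (simp add: dual_tangent_def)
  moreover have "pole a q N \<in> L" using assms regularD subspace_0 by metis
  ultimately show False using assms(1,2) unfolding regular_def tangent_to_def by blast
qed

lemma parallel_directions:
  assumes L: "regular a L" and n: "(n, 0) \<in> L" "n \<noteq> 0" and m: "(m, 0) \<in> L"
  shows "\<exists>c. m = c *\<^sub>R n"
proof (rule ccontr)
  assume ind: "\<nexists>c. m = c *\<^sub>R n"
  have "L \<subseteq> hyp (0, 1)"
  proof
    fix z assume "z \<in> L"
    then obtain s t where "z = s *\<^sub>R (n, 0::real) + t *\<^sub>R (m, 0)"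
      using plane_coordinates[OF regularD[OF L] n(1) m _ _ \<open>z \<in> L\<close>] n(2) ind by (auto simp: zero_prod_def)
    then show "z \<in> hyp (0, 1)" by (simp add: hyp_def inner_prod_def)
  qed
  then show False
    using not_subset_degenerate[OF L, of AtInfinity "(0, 1)"]
    by (simp add: degenerate_def pole_def zero_prod_def)
qed

text \<open>By \<open>an\<close> the direction \<open>n\<close> is an eigenvector of the diagonal
  matrix of \<open>a\<close>, hence a coordinate axis. A line through the origin along it lies in
  another coordinate hyperplane, against regularity.\<close>

lemma no_principal_axis:
  assumes L: "regular a L" and n: "(n, 0) \<in> L" "n \<noteq> 0"
    and o: "(0, 1) \<in> L" and an: "((\<chi> i. a $ i * n $ i), 0) \<in> L"
  shows False
proof -
  obtain s where s: "(\<chi> i. a $ i * n $ i) = s *\<^sub>R n" using parallel_directions[OF L n an] by blast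
  obtain i where i: "n $ i \<noteq> 0" using n(2) by (auto simp: vec_eq_iff)
  have "a $ j * n $ j = s * n $ j" for j using s by (simp add: vec_eq_iff)
  then have aj: "n $ j = 0 \<or> a $ j = s" for j by (metis mult_right_cancel)
  have "\<not> (UNIV :: 'n set) \<subseteq> {i}"
    using card_ge_2 card_mono[of "{i}" "UNIV :: 'n set"] by auto
  then obtain j where j: "j \<noteq> i" by blast
  have nj: "n $ j = 0" using aj[of i] aj[of j] i inj_a j by (auto simp: inj_def)
  let ?N = "(axis j 1, 0) :: 'n hvec"
  have "L \<subseteq> hyp ?N"
  proof
    fix z assume "z \<in> L"
    then obtain s t where "z = s *\<^sub>R (n, 0::real) + t *\<^sub>R (0, 1)"
      using plane_coordinates[OF regularD[OF L] n(1) o _ _ \<open>z \<in> L\<close>] n(2) by (auto simp: zero_prod_def)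
    then show "z \<in> hyp ?N" by (simp add: hyp_def inner_prod_def inner_axis' nj)
  qed
  moreover have "pole a (Conf (a $ j)) ?N = 0" by (simp add: pole_def prod_eq_iff vec_eq_iff axis_def)
  moreover have "?N \<noteq> 0" by (simp add: prod_eq_iff)
  ultimately show False using not_subset_degenerate[OF L, of "Conf (a $ j)" ?N] by (auto simp: degenerate_def)
qed

text \<open>Two such hyperplanes would make \<open>L\<close> a principal axis, which lies in a coordinate hyperplane.\<close>

lemma normal_hyperplane_unique:
  assumes L: "regular a L" and H: "dual_tangent a p H" "pole a p H \<in> L" "fst H \<noteq> 0"
    and K: "dual_tangent a q K" "pole a q K \<in> L" and par: "fst K = c *\<^sub>R fst H" "c \<noteq> 0"
    and n: "(fst H, 0) \<in> L"
  shows "hyp H = hyp K"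
proof (rule ccontr)
  assume ne: "hyp H \<noteq> hyp K"
  note LL = regularD[OF L]
  obtain \<mu> where p: "p = Conf \<mu>" using H dual_tangent_AtInfinity[of a H] by (cases p) simp_all
  obtain \<nu> where q: "q = Conf \<nu>" using K H(3) par dual_tangent_AtInfinity[of a K] by (cases q) simp_all
  define k where "k = snd K / c"
  \<comment> \<open>The normals are parallel, so this combination of three points of
    \<open>L\<close> cancels all coordinates but the last. That one is nonzero for distinct
    hyperplanes, which puts the origin on \<open>L\<close>.\<close>
  have "pole a p H - (1 / c) *\<^sub>R pole a q K + (\<mu> - \<nu>) *\<^sub>R (fst H, 0) \<in> L"
    using LL H K n by (intro subspace_add subspace_diff subspace_scale)
  also have "pole a p H - (1 / c) *\<^sub>R pole a q K + (\<mu> - \<nu>) *\<^sub>R (fst H, 0) = (k - snd H) *\<^sub>R (0, 1)"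
    using par by (simp add: p q pole_def prod_eq_iff vec_eq_iff k_def algebra_simps)
  finally have m: "(k - snd H) *\<^sub>R (0, 1) \<in> L" .
  have "k \<noteq> snd H"
  proof
    assume "k = snd H"
    then have "snd K = c * snd H" using par(2) by (simp add: k_def field_simps)
    then have "K = c *\<^sub>R H" using par by (simp add: prod_eq_iff)
    then show False using ne par hyp_scale by metis
  qed
  then have o: "(0, 1) \<in> L" using subspace_scale[OF LL(1) m, of "1 / (k - snd H)"] by simp
  have "pole a p H + \<mu> *\<^sub>R (fst H, 0) + snd H *\<^sub>R (0, 1) \<in> L"
    using LL H n o by (intro subspace_add subspace_scale)
  also have "pole a p H + \<mu> *\<^sub>R (fst H, 0) + snd H *\<^sub>R (0, 1) = ((\<chi> i. a $ i * fst H $ i), 0)"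
    by (simp add: p pole_def prod_eq_iff vec_eq_iff algebra_simps)
  finally show False using no_principal_axis[OF L n H(3) o] by simp
qed

lemma centre_mem_imp_normal:
  assumes "subspace L" "centre N \<in> L" "fst N \<noteq> 0"
  shows "(fst N, 0) \<in> L"
proof -
  have "(fst N \<bullet> fst N) *\<^sub>R centre N \<in> L" using assms subspace_scale by blast
  then show ?thesis using assms(3) by (simp add: centre_def)
qed

text \<open>The intersection of all four already has the dimension of the intersection of the two
  distinct ones, so the two agree.\<close>

lemma pencil_mem:
  fixes h k :: "'n hvec"
  assumes "h \<noteq> 0" "k \<noteq> 0" "hyp h \<noteq> hyp k"
    and "dim (hyp h \<inter> hyp k \<inter> M \<inter> N) = CARD('n) - 1" "subspace M" "subspace N"
  shows "hyp h \<inter> hyp k \<subseteq> M" "hyp h \<inter> hyp k \<subseteq> N"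
proof -
  have "k \<noteq> c *\<^sub>R h" for c using assms(2,3) hyp_scale[of c h] by auto
  then have "dim (hyp h \<inter> hyp k) = dim (hyp h \<inter> hyp k \<inter> M \<inter> N)"
    using dim_hyp_Int[OF assms(1)] assms(4) by simp
  moreover have "subspace (hyp h \<inter> hyp k)" "subspace (hyp h \<inter> hyp k \<inter> M \<inter> N)"
    using subspace_hyp assms by (intro subspace_inter; blast)+
  ultimately have "hyp h \<inter> hyp k \<inter> M \<inter> N = hyp h \<inter> hyp k"
    by (intro subspace_dim_equal) auto
  then show "hyp h \<inter> hyp k \<subseteq> M" "hyp h \<inter> hyp k \<subseteq> N" by blast+
qed

text \<open>Isotropy on the pencil is a quadratic equation in \<open>s\<close> and \<open>t\<close>.
  It has the factor \<open>s\<close>, because \<open>k\<close> is isotropic; the other factor gives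
  \<open>fourth\<close>.\<close>

lemma isotropic_in_pencil:
  assumes k: "k \<bullet> pole a q k = 0" and n: "N = s *\<^sub>R h + t *\<^sub>R k" "N \<bullet> pole a q N = 0" "N \<noteq> 0"
    and nz: "fourth a q h k \<noteq> 0"
  shows "(s = 0 \<and> t \<noteq> 0) \<or> (\<exists>e. e \<noteq> 0 \<and> N = e *\<^sub>R fourth a q h k)"
proof -
  define b where "b = h \<bullet> pole a q h"
  define c where "c = h \<bullet> pole a q k"
  have f: "fourth a q h k = b *\<^sub>R k - (2 * c) *\<^sub>R h" by (simp add: fourth_def b_def c_def)
  have "k \<bullet> pole a q h = c" using c_def inner_pole_commute by metis
  then have "s * (s * b + 2 * t * c) = 0"
    using n(2) k unfolding n(1) by (simp add: pole_linear inner_add_left inner_add_right b_def c_def algebra_simps)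
  then consider "s = 0" | "s * b + 2 * t * c = 0" by auto
  then show ?thesis
  proof cases
    case 1
    then show ?thesis using n by auto
  next
    case 2
    have "\<exists>e. N = e *\<^sub>R fourth a q h k"
    proof (cases "b = 0")
      case True
      then have "c \<noteq> 0" using nz f by auto
      then have "t = 0" using 2 True by simp
      then have "N = (- s / (2 * c)) *\<^sub>R fourth a q h k" using True \<open>c \<noteq> 0\<close> by (simp add: n(1) f)
      then show ?thesis ..
    next
      case False
      have "s = - 2 * t * c / b" using 2 False by (simp add: field_simps)
      then have "N = (t / b) *\<^sub>R fourth a q h k" using False by (simp add: n(1) f algebra_simps)
      then show ?thesis ..
    qed
    then show ?thesis using n(3) by auto
  qed
qed

text \<open>
  If \<open>K\<close> itself reflects \<open>L\<close> but is not the fourth hyperplane, then \<open>L\<close> is its own mirror image in \<open>H\<close>,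
  and the third reflection of \<open>L\<close> cannot be closed up.
\<close>

lemma no_second_completion:
  assumes L: "regular a L" and h: "reflectable a p h L" and k: "reflectable a q k L"
    and k1: "reflectable a q k (reflect h ` L)" and ne: "hyp h \<noteq> hyp k"
    and c: "h \<bullet> pole a q k \<noteq> 0"
    and h': "reflectable a p h' (reflect k ` L)"
    and inv: "reflect h' ` reflect k ` L = reflect k ` reflect h ` L"
    and pen: "h' = s *\<^sub>R h + t *\<^sub>R k"
  shows False
proof -
  define P where "P = pole a q k"
  note LL = regularD[OF L]
  note hD = reflectableD[OF h] and kD = reflectableD[OF k] and k1D = reflectableD[OF k1]
    and h'D = reflectableD[OF h']
  have z: "h \<noteq> 0" "k \<noteq> 0" "h' \<noteq> 0" using h k h' reflectable_nonzero by metis+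
  let ?L2 = "reflect k ` L"
  have L2: "regular a ?L2" using regular_reflect[OF L k] .
  note LL2 = regularD[OF L2]
  have P: "P \<in> L" "P \<noteq> 0" using kD c by (auto simp: P_def)
  have P2: "P \<in> reflect k ` L" unfolding P_def using pole_in_reflect_image[OF kD(2,1)] .
  obtain w where "w \<in> L" "P = reflect h w" using k1D(2) unfolding P_def by blast
  then have "reflect h P \<in> L" using reflect_reflect[OF z(1)] by simp
  \<comment> \<open>Both \<open>P\<close> and its mirror image lie on \<open>L\<close>; by
    \<open>c\<close> they differ by a nonzero multiple of \<open>centre h\<close>.\<close>
  then have "(1 / (2 * (h \<bullet> P))) *\<^sub>R (P - reflect h P) \<in> L"
    using P LL by (intro subspace_scale subspace_diff)
  then have ch: "centre h \<in> L" using c by (simp add: reflect_def P_def)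
  then have "reflect h ` L = L" using centre_imp_reflect_invariant LL z(1) by blast
  then have inv': "reflect h' ` ?L2 = ?L2" using inv by simp
  then have ch': "centre h' \<in> ?L2" using reflect_invariant_imp_centre[OF LL2(1) z(3) h'D(3)] by blast
  have np: "\<not> (\<exists>e. fst k = e *\<^sub>R fst h)" if "fst h \<noteq> 0" "fst k \<noteq> 0"
  proof
    assume "\<exists>e. fst k = e *\<^sub>R fst h"
    then obtain e where e: "fst k = e *\<^sub>R fst h" by blast
    then have "e \<noteq> 0" using that by auto
    then show False
      using normal_hyperplane_unique[OF L hD(1,2) that(1) kD(1,2) e] ne
        centre_mem_imp_normal[OF LL(1) ch that(1)] by blast
  qed
  \<comment> \<open>Common end of all cases: then \<open>L\<close> is also normal to
    \<open>hyp k\<close>. If \<open>h\<close> is at infinity, \<open>L\<close> is a principal axis;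
    otherwise the two normals are parallel, against \<open>np\<close>.\<close>
  have fin: False if eq: "L = ?L2"
  proof -
    have ck: "centre k \<in> L" using reflect_invariant_imp_centre[OF LL(1) z(2) kD(3)] eq by simp
    show False
    proof (cases "fst h = 0")
      case True
      then have "pole a q k \<bullet> h \<noteq> 0" using c by (simp add: inner_commute)
      then obtain \<nu> where q: "q = Conf \<nu>" using True by (cases q) (auto simp: pole_def inner_prod_def)
      have nk: "fst k \<noteq> 0" using kD(1) q dual_tangent_Conf_fst by blast
      have n: "(fst k, 0) \<in> L" using centre_mem_imp_normal[OF LL(1) ck nk] .
      have "snd h \<noteq> 0" using True z by (simp add: prod_eq_iff)
      then have o: "(0, 1) \<in> L" using subspace_scale[OF LL(1) ch, of "snd h"] True by (simp add: centre_def)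
      have "P + \<nu> *\<^sub>R (fst k, 0) + snd k *\<^sub>R (0, 1) \<in> L"
        using LL P n o by (intro subspace_add subspace_scale)
      also have "P + \<nu> *\<^sub>R (fst k, 0) + snd k *\<^sub>R (0, 1) = ((\<chi> i. a $ i * fst k $ i), 0)"
        by (simp add: P_def q pole_def prod_eq_iff vec_eq_iff algebra_simps)
      finally show False using no_principal_axis[OF L n nk o] by simp
    next
      case False
      have nk: "fst k \<noteq> 0"
      proof
        assume k0: "fst k = 0"
        then have "q = AtInfinity" using kD(1) dual_tangent_Conf_fst[of a _ k] by (cases q) simp_all
        then show False using c k0 by (simp add: inner_pole_AtInfinity)
      qed
      show False
        using parallel_directions[OF L centre_mem_imp_normal[OF LL(1) ch False] False
            centre_mem_imp_normal[OF LL(1) ck nk]] np False nk by blast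
    qed
  qed
  show False
  proof (cases p)
    case AtInfinity
    then have h0: "fst h = 0" "snd h \<noteq> 0" using hD(1) dual_tangent_AtInfinity[of a h] by simp_all
    have h'0: "fst h' = 0" "snd h' \<noteq> 0" using h'D(1) AtInfinity dual_tangent_AtInfinity[of a h'] by simp_all
    have o: "(0, 1) \<in> L" using subspace_scale[OF LL(1) ch, of "snd h"] h0 by (simp add: centre_def)
    have o2: "(0, 1) \<in> ?L2" using subspace_scale[OF LL2(1) ch', of "snd h'"] h'0 by (simp add: centre_def)
    have "q \<noteq> AtInfinity" using c h0 by (auto simp: inner_pole_AtInfinity)
    then obtain \<nu> where q: "q = Conf \<nu>" by (cases q) auto
    have fP: "fst P \<noteq> 0"
    proof
      assume "fst P = 0"
      then have "k \<bullet> P = - (snd k)\<^sup>2" by (simp add: P_def q pole_def inner_prod_def power2_eq_square)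
      then have "snd k = 0" using dual_tangent_pole_orth[OF kD(1)] P_def by simp
      then have "P = 0" using \<open>fst P = 0\<close> by (simp add: P_def q pole_def prod_eq_iff)
      then show False using P by simp
    qed
    have "P \<noteq> e *\<^sub>R (0, 1)" for e using fP by auto
    \<comment> \<open>Both lines pass through the origin, the centre of \<open>h\<close> and of
      \<open>h'\<close>, and through the pole \<open>P\<close>.\<close>
    then have "L = ?L2" using plane_eqI[OF LL LL2 o P(1) o2 P2] by (simp add: prod_eq_iff)
    then show False by (rule fin)
  next
    case p: (Conf \<mu>)
    have nh: "fst h \<noteq> 0" "fst h' \<noteq> 0" using hD(1) h'D(1) p dual_tangent_Conf_fst by blast+
    have nk: "fst k \<noteq> 0"
    proof
      assume k0: "fst k = 0"
      then have "q = AtInfinity" using kD(1) dual_tangent_Conf_fst[of a _ k] by (cases q) simp_all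
      then show False using c k0 by (simp add: inner_pole_AtInfinity)
    qed
    then obtain \<nu> where q: "q = Conf \<nu>" using kD(1) dual_tangent_AtInfinity[of a k] by (cases q) simp_all
    have nL: "(fst h, 0) \<in> L" using centre_mem_imp_normal[OF LL(1) ch nh(1)] .
    have n'L2: "(fst h', 0) \<in> ?L2" using centre_mem_imp_normal[OF LL2(1) ch' nh(2)] .
    define g22 where "g22 = fst k \<bullet> fst k"
    define g12 where "g12 = fst h \<bullet> fst k"
    define n' where "n' = fst h' - (2 * (fst k \<bullet> fst h') / g22) *\<^sub>R fst k"
    have g22: "g22 \<noteq> 0" using nk by (simp add: g22_def)
    have "reflect k (fst h', 0) = (n', 0)"
      using nk by (simp add: reflect_def centre_def n'_def g22_def inner_prod_def)
    moreover have "reflect k (fst h', 0) \<in> L"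
      using n'L2 reflect_reflect[OF z(2)] by auto
    \<comment> \<open>The normal of \<open>h'\<close> is the direction of \<open>?L2\<close>.
      Reflected back in \<open>k\<close> it becomes the direction of \<open>L\<close>, which is the
      normal of \<open>h\<close>.\<close>
    ultimately obtain l where l: "n' = l *\<^sub>R fst h" using parallel_directions[OF L nL nh(1)] by metis
    have sp: "fst h' = s *\<^sub>R fst h + t *\<^sub>R fst k" using pen by (simp add: prod_eq_iff)
    have indep: "x = 0 \<and> y = 0" if "x *\<^sub>R fst h + y *\<^sub>R fst k = 0" for x y
    proof -
      have "y = 0"
      proof (rule ccontr)
        assume "y \<noteq> 0"
        moreover have "y *\<^sub>R fst k = (- x) *\<^sub>R fst h" using that by (simp add: eq_neg_iff_add_eq_0 add.commute)
        ultimately have "fst k = (- x / y) *\<^sub>R fst h" by (intro scaleR_eq_imp)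
        then show False using np nh(1) nk by blast
      qed
      then show ?thesis using that nh(1) by simp
    qed
    have kh': "fst k \<bullet> fst h' = s * g12 + t * g22"
      by (simp add: sp inner_add_right g12_def g22_def inner_commute)
    have "(s - l) *\<^sub>R fst h + (t - 2 * (s * g12 + t * g22) / g22) *\<^sub>R fst k = n' - l *\<^sub>R fst h"
      unfolding n'_def kh' unfolding sp by (simp add: algebra_simps)
    then have "s - l = 0 \<and> t - 2 * (s * g12 + t * g22) / g22 = 0" using l by (intro indep) simp
    then have "t - 2 * (s * g12 + t * g22) / g22 = 0" by blast
    then have "t = 2 * (s * g12 + t * g22) / g22" by linarith
    then have "t * g22 = 2 * (s * g12 + t * g22)" using g22 by (metis nonzero_eq_divide_eq)
    then have st: "t * g22 = - (2 * s * g12)" by algebra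
    define E12 where "E12 = k \<bullet> pole a p h"
    have E22: "k \<bullet> pole a p k = (\<nu> - \<mu>) * g22"
      using dual_tangent_pole_orth[OF kD(1)] inner_pole_Conf[of k a \<mu> k \<nu>] by (simp add: p q g22_def)
    have F12: "h \<bullet> pole a q k = E12 + (\<mu> - \<nu>) * g12"
      using inner_pole_Conf[of h a \<nu> k \<mu>] inner_pole_commute[of k a p h] by (simp add: p q E12_def g12_def)
    \<comment> \<open>Isotropy of \<open>h'\<close> combined with \<open>st\<close> becomes
      \<open>2 * s * t * (h \<bullet> pole a q k) = 0\<close>. Hence \<open>t = 0\<close>, so
      \<open>h'\<close> is a multiple of \<open>h\<close>, and \<open>L\<close> and
      \<open>?L2\<close> share its pole and its normal direction.\<close>
    have "h' \<bullet> pole a p h' = t * (2 * s * E12 + t * (k \<bullet> pole a p k))"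
      using dual_tangent_pole_orth[OF hD(1)] inner_pole_commute[of h a p k]
      by (simp add: pen pole_linear inner_add_left inner_add_right E12_def[symmetric] algebra_simps)
    moreover have "2 * s * E12 + t * (k \<bullet> pole a p k) = 2 * s * E12 + (\<nu> - \<mu>) * (t * g22)"
      unfolding E22 by simp
    moreover have "2 * s * E12 + (\<nu> - \<mu>) * (t * g22) = 2 * s * (E12 + (\<mu> - \<nu>) * g12)"
      unfolding st by (simp add: algebra_simps)
    ultimately have "t * (2 * s * (E12 + (\<mu> - \<nu>) * g12)) = 0"
      using dual_tangent_pole_orth[OF h'D(1)] by simp
    then have ts: "t = 0 \<or> s = 0" using F12 c by auto
    have "s \<noteq> 0"
    proof
      assume "s = 0"
      then have "t = 0" using st g22 by simp
      then show False using \<open>s = 0\<close> pen z(3) by simp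
    qed
    then have "t = 0" "g12 = 0" using ts st by auto
    then have E: "E12 \<noteq> 0" using F12 c by simp
    have h's: "h' = s *\<^sub>R h" using pen \<open>t = 0\<close> by simp
    let ?Q = "pole a p h"
    have Q: "?Q \<noteq> 0" using E by (auto simp: E12_def)
    have "(1 / s) *\<^sub>R pole a p h' \<in> ?L2" using LL2 h'D(2) subspace_scale by blast
    then have Q2: "?Q \<in> ?L2" using \<open>s \<noteq> 0\<close> by (simp add: h's pole_linear)
    have "(1 / s) *\<^sub>R (fst h', 0) \<in> ?L2" using LL2 n'L2 subspace_scale by blast
    then have n2: "(fst h, 0) \<in> ?L2" using \<open>s \<noteq> 0\<close> by (simp add: h's)
    have "(fst h, 0) \<noteq> e *\<^sub>R ?Q" for e
    proof
      assume "(fst h, 0) = e *\<^sub>R ?Q"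
      then have "h \<bullet> (fst h, 0) = 0" using dual_tangent_pole_orth[OF hD(1)] by simp
      then show False using nh(1) by (simp add: inner_prod_def)
    qed
    then have "L = ?L2" using plane_eqI[OF LL LL2 hD(2) nL Q2 n2 Q] by blast
    then show False by (rule fin)
  qed
qed

end

section \<open>Transfer of hyperplanes across one reflection\<close>

definition transfer :: "real^'n::finite \<Rightarrow> 'n hvec set \<Rightarrow> 'n hyperpl \<Rightarrow> 'n hyperpl \<Rightarrow> 'n hyperpl" where
  "transfer a L H K = (THE K'. \<exists>H'. double_reflection a L H K K' H')"

context confocal
begin

text \<open>The pencil leaves \<open>fourth\<close> and \<open>k\<close> as candidates for the
  normal of \<open>K'\<close>. They are proportional if \<open>h\<close> and \<open>k\<close> are
  conjugate; otherwise \<open>no_second_completion\<close> excludes \<open>k\<close>.\<close>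

lemma double_reflection_eq_fourth:
  assumes L: "regular a L" and h: "reflectable a p h L" and k: "reflectable a q k (reflect h ` L)"
    and ne: "hyp h \<noteq> hyp k" and D: "double_reflection a L (hyp h) (hyp k) K' H'"
  shows "K' = hyp (fourth a q h k)"
proof -
  note LL = regularD[OF L]
  have z: "h \<noteq> 0" "k \<noteq> 0" using h k reflectable_nonzero by metis+
  note m = mirror_hyp[OF z(1)] mirror_hyp[OF z(2)]
  obtain p' q' where D: "hyp h \<in> fiber a p' L" "hyp k \<in> fiber a q' (reflect h ` L)"
     "K' \<in> fiber a q' L" "H' \<in> fiber a p' (mirror K' ` L)"
     "mirror H' ` mirror K' ` L = reflect k ` reflect h ` L"
     "dim (hyp h \<inter> hyp k \<inter> K' \<inter> H') = CARD('n) - 1"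
    using D ne unfolding double_reflection_def m by blast
  have "p' = p" "q' = q"
    using fiber_member_unique[OF D(1) hyp_in_fiber[OF h]] fiber_member_unique[OF D(2) hyp_in_fiber[OF k]]
    by auto
  note D = D[unfolded this]
  obtain k' where k': "K' = hyp k'" "k' \<noteq> 0" "reflectable a q k' L" "mirror K' = reflect k'"
    using D(3) by (rule fiberE)
  obtain h' where h': "H' = hyp h'" "h' \<noteq> 0" "reflectable a p h' (mirror K' ` L)" "mirror H' = reflect h'"
    using D(4) by (rule fiberE)
  have pen: "hyp h \<inter> hyp k \<subseteq> hyp k'" "hyp h \<inter> hyp k \<subseteq> hyp h'"
    using pencil_mem[OF z ne D(6)] k'(1) h'(1) subspace_hyp by blast+
  obtain s t where st: "k' = s *\<^sub>R h + t *\<^sub>R k" using hyp_Int_subset_hyp[OF pen(1)] by blast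
  have nz: "fourth a q h k \<noteq> 0" using fourth_nonzero[OF LL h k ne] .
  have "(s = 0 \<and> t \<noteq> 0) \<or> (\<exists>e. e \<noteq> 0 \<and> k' = e *\<^sub>R fourth a q h k)"
    using isotropic_in_pencil[OF dual_tangent_pole_orth[OF reflectableD(1)[OF k]] st
        dual_tangent_pole_orth[OF reflectableD(1)[OF k'(3)]] k'(2) nz] .
  then show ?thesis
  proof
    assume "\<exists>e. e \<noteq> 0 \<and> k' = e *\<^sub>R fourth a q h k"
    then show ?thesis using k'(1) hyp_scale by metis
  next
    assume "s = 0 \<and> t \<noteq> 0"
    then have t: "k' = t *\<^sub>R k" "t \<noteq> 0" using st by auto
    then have K': "K' = hyp k" "mirror K' = reflect k" using k'(1) hyp_scale m(2) by metis+
    show ?thesis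
    proof (cases "h \<bullet> pole a q k = 0")
      case True
      then have "fourth a q h k = (h \<bullet> pole a q h) *\<^sub>R k" by (simp add: fourth_def)
      then show ?thesis using K'(1) nz hyp_scale by (metis scaleR_zero_left)
    next
      case False
      obtain s' t' where "h' = s' *\<^sub>R h + t' *\<^sub>R k" using hyp_Int_subset_hyp[OF pen(2)] by blast
      moreover have "reflectable a q k L" using D(3) K'(1) hyp_in_fiber_iff[OF LL(1) z(2)] by simp
      ultimately show ?thesis
        using no_second_completion[OF L h _ k ne False] h'(3,4) D(5) K'(2) by metis
    qed
  qed
qed

text \<open>If \<open>K'\<close> were \<open>H\<close> again, the condition on the dimension would
  make \<open>H'\<close> a different hyperplane. \<open>L\<close> and its image would then share two
  poles, hence coincide, and \<open>L\<close> would be normal to two distinct tangent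
  hyperplanes.\<close>

lemma double_reflection_same:
  assumes L: "regular a L" and nd: "\<not> degenerate a p" and H: "H \<in> fiber a p L"
    and D: "double_reflection a L H H K' H'"
  shows "K' \<noteq> H"
proof
  assume eq: "K' = H"
  note LL = regularD[OF L]
  let ?L1 = "mirror H ` L"
  obtain p' where D: "H \<in> fiber a p' L" "H' \<in> fiber a p' ?L1"
     "mirror H' ` ?L1 = mirror H ` ?L1"
     "dim (H \<inter> H \<inter> H \<inter> H') = CARD('n) - 1 \<or> degenerate a p'"
    using D unfolding double_reflection_def eq by blast
  have "p' = p" using fiber_member_unique[OF D(1) H] .
  note D = D[unfolded this]
  have e: "mirror H ` ?L1 = L" using mirror_mirror[OF H] .
  obtain h where h: "H = hyp h" "h \<noteq> 0" "reflectable a p h L" "mirror H = reflect h"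
    using H by (rule fiberE)
  obtain h' where h': "H' = hyp h'" "h' \<noteq> 0" "reflectable a p h' ?L1" "mirror H' = reflect h'"
    using D(2) by (rule fiberE)
  have ne: "hyp h \<noteq> hyp h'"
  proof
    assume "hyp h = hyp h'"
    then have "dim (hyp h) = CARD('n) - 1" using D(4) nd h(1) h'(1) by simp
    moreover have "dim (hyp h) = CARD('n)" unfolding hyp_def using dim_hyperplane[OF h(2)] by simp
    ultimately show False using card_ge_2 by simp
  qed
  have L1: "regular a ?L1" using regular_mirror[OF L H] .
  note LL1 = regularD[OF L1]
  have h1: "reflectable a p h ?L1" using reflectable_reflect[OF h(3)] h(4) by simp
  have h'L: "reflectable a p h' L" using reflectable_reflect[OF h'(3)] h'(4) D(3) e by simp
  have "L = ?L1"
    using plane_eqI[OF LL LL1 reflectableD(2)[OF h(3)] reflectableD(2)[OF h'L]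
        reflectableD(2)[OF h1] reflectableD(2)[OF h'(3)]] pole_independent[OF nd h(2) h'(2) ne] by blast
  then have "reflect h ` L = L" "reflect h' ` L = L" using h(4) h'(4) D(3) e by simp_all
  then have c: "centre h \<in> L" "centre h' \<in> L"
    using refl reflect_invariant_imp_centre LL(1) h h' reflectableD(3)[OF h(3)] reflectableD(3)[OF h'L]
    by blast+
  have "p \<noteq> AtInfinity" using nd by (auto simp: degenerate_def)
  then have n: "fst h \<noteq> 0" "fst h' \<noteq> 0"
    using reflectableD(1)[OF h(3)] reflectableD(1)[OF h'(3)] dual_tangent_Conf_fst[of a _ h] dual_tangent_Conf_fst[of a _ h']
    by (cases p; simp)+
  note nL = centre_mem_imp_normal[OF LL(1) c(1) n(1)]
  obtain e where e: "fst h' = e *\<^sub>R fst h"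
    using parallel_directions[OF L nL n(1) centre_mem_imp_normal[OF LL(1) c(2) n(2)]] by blast
  then have "e \<noteq> 0" using n by auto
  then show False
    using normal_hyperplane_unique[OF L reflectableD(1,2)[OF h(3)] n(1) reflectableD(1,2)[OF h'L] e _ nL] ne
    by blast
qed

lemma double_reflection_exists:
  assumes L: "regular a L" and H: "H \<in> fiber a p L" and K: "K \<in> fiber a q (mirror H ` L)"
  shows "\<exists>K' H'. double_reflection a L H K K' H'"
proof (cases "H = K")
  case False
  obtain h where h: "H = hyp h" "h \<noteq> 0" "reflectable a p h L" "mirror H = reflect h"
    using H by (rule fiberE)
  obtain k where k: "K = hyp k" "k \<noteq> 0" "reflectable a q k (reflect h ` L)"
    using K h(4) by (metis fiberE)
  have "hyp h \<noteq> hyp k" using False h(1) k(1) by simp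
  from double_reflection_fourth[OF L h(3) k(3) this] show ?thesis using h(1) k(1) by blast
next
  case True
  show ?thesis
  proof (cases "degenerate a p")
    case False
    obtain J where "J \<in> fiber a p L" "J \<noteq> H" using opposite_exists[OF L False H] by blast
    then show ?thesis using double_reflection_opposite[OF H] True by metis
  qed (use True double_reflection_degenerate H in blast)
qed

lemma double_reflection_unique:
  assumes L: "regular a L" and D1: "double_reflection a L H K K1 H1"
    and D2: "double_reflection a L H K K2 H2"
  shows "K1 = K2"
proof -
  obtain p q where H: "H \<in> fiber a p L" and K: "K \<in> fiber a q (mirror H ` L)" and K1: "K1 \<in> fiber a q L"
    using D1 unfolding double_reflection_def by blast
  obtain q' where K': "K \<in> fiber a q' (mirror H ` L)" and K2: "K2 \<in> fiber a q' L"
    using D2 unfolding double_reflection_def by blast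
  have "q' = q" using fiber_member_unique[OF K' K] .
  note K2 = K2[unfolded this]
  show ?thesis
  proof (cases "H = K")
    case False
    obtain h where h: "H = hyp h" "h \<noteq> 0" "reflectable a p h L" "mirror H = reflect h"
      using H by (rule fiberE)
    obtain k where k: "K = hyp k" "k \<noteq> 0" "reflectable a q k (reflect h ` L)"
      using K h(4) by (metis fiberE)
    have "hyp h \<noteq> hyp k" using False h(1) k(1) by simp
    note double_reflection_eq_fourth[OF L h(3) k(3) this]
    from this[OF D1[unfolded h(1) k(1)]] this[OF D2[unfolded h(1) k(1)]] show ?thesis by simp
  next
    case True
    have "q = p" using fiber_member_unique[OF _ H] K True by blast
    show ?thesis
    proof (cases "degenerate a q")
      case False
      \<comment> \<open>With \<open>H = K\<close> uniqueness is a matter of counting: both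
        completions avoid \<open>H\<close> in a fiber of at most two elements.\<close>
      have "K1 \<noteq> H" "K2 \<noteq> H"
        using double_reflection_same[OF L _ H] False D1 D2 True \<open>q = p\<close> by metis+
      then show ?thesis using fiber_le_2[OF L _ K1 K2] H \<open>q = p\<close> by blast
    qed (use fiber_degenerate K1 K2 in blast)
  qed
qed

lemma transfer_eq:
  assumes "regular a L" "double_reflection a L H K K' H'"
  shows "transfer a L H K = K'"
  unfolding transfer_def
proof (rule the_equality)
  show "\<exists>H'. double_reflection a L H K K' H'" using assms(2) by blast
  show "J = K'" if "\<exists>H'. double_reflection a L H K J H'" for J
    using double_reflection_unique[OF assms(1) _ assms(2)] that by blast
qed

lemma transfer_double_reflection:
  assumes "regular a L" "H \<in> fiber a p L" "K \<in> fiber a q (mirror H ` L)"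
  shows "\<exists>H'. double_reflection a L H K (transfer a L H K) H'"
  using double_reflection_exists[OF assms] transfer_eq[OF assms(1)] by metis

lemma transfer_fiber:
  assumes "regular a L" "H \<in> fiber a p L" "K \<in> fiber a q (mirror H ` L)"
  shows "transfer a L H K \<in> fiber a q L"
proof -
  obtain q' where "K \<in> fiber a q' (mirror H ` L)" "transfer a L H K \<in> fiber a q' L"
    using transfer_double_reflection[OF assms] unfolding double_reflection_def by blast
  then show ?thesis using fiber_member_unique assms(3) by metis
qed

lemma transfer_transfer:
  assumes "regular a L" "H \<in> fiber a p L" "K \<in> fiber a q (mirror H ` L)"
  shows "transfer a (mirror H ` L) H (transfer a L H K) = K"
proof -
  obtain H' where "double_reflection a L H K (transfer a L H K) H'"
    using transfer_double_reflection[OF assms] by blast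
  from transfer_eq[OF regular_mirror[OF assms(1,2)] double_reflection_rotate[OF this]]
  show ?thesis .
qed

lemma transfer_transfer_mirror:
  assumes "regular a L" "H \<in> fiber a p L" "K \<in> fiber a q L"
  shows "transfer a L H (transfer a (mirror H ` L) H K) = K"
proof -
  have e: "mirror H ` mirror H ` L = L" using mirror_mirror[OF assms(2)] .
  have "K \<in> fiber a q (mirror H ` mirror H ` L)" unfolding e using assms(3) .
  from transfer_transfer[OF regular_mirror[OF assms(1,2)] fiber_mirror[OF assms(2)] this]
  show ?thesis unfolding e .
qed

lemma transfer_inj:
  assumes "regular a L" "H \<in> fiber a p L" "K \<in> fiber a q (mirror H ` L)" "M \<in> fiber a m (mirror H ` L)"
    and "transfer a L H K = transfer a L H M"
  shows "K = M"
  using transfer_transfer[OF assms(1-3)] transfer_transfer[OF assms(1,2,4)] unfolding assms(5)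
  by (rule trans[OF sym])

lemma transfer_self:
  assumes "regular a L" "\<not> degenerate a p" "H \<in> fiber a p L"
  shows "transfer a L H H \<noteq> H"
proof -
  obtain H' where "double_reflection a L H H (transfer a L H H) H'"
    using transfer_double_reflection[OF assms(1,3) fiber_mirror[OF assms(3)]] by blast
  from double_reflection_same[OF assms this] show ?thesis .
qed

lemma transfer_fourth:
  assumes "regular a L" "reflectable a p h L" "reflectable a q k (reflect h ` L)" "hyp h \<noteq> hyp k"
  shows "transfer a L (hyp h) (hyp k) = hyp (fourth a q h k)"
  using transfer_eq[OF assms(1) double_reflection_fourth[OF assms]] .

text \<open>\<open>H\<close> itself is not sent to \<open>H\<close>. If \<open>K\<close> were not
  sent there either, both would have the same image in a fiber of at most two elements, against
  injectivity.\<close>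

lemma transfer_same_member:
  assumes L: "regular a L" and H: "H \<in> fiber a p L" and K: "K \<in> fiber a p (mirror H ` L)" and ne: "K \<noteq> H"
  shows "transfer a L H K = H"
proof (rule ccontr)
  assume c: "transfer a L H K \<noteq> H"
  note L1 = regular_mirror[OF L H] and H1 = fiber_mirror[OF H]
  have nd: "\<not> degenerate a p" using fiber_degenerate H K ne by blast
  have 1: "transfer a L H H \<noteq> H" using transfer_self[OF L nd H] .
  have "transfer a L H K = transfer a L H H"
    using fiber_le_2[OF L H transfer_fiber[OF L H K] transfer_fiber[OF L H H1] c 1] .
  then show False using transfer_inj[OF L H K H1] ne by blast
qed

text \<open>
  All fibers have at most two elements here, so it is enough to know where the reflections of the
  configuration itself go.
\<close>

lemma transfer_cube_same_member:
  assumes L: "regular a L" and D: "double_reflection a L H K K' H'"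
    and nd: "\<not> degenerate a p" and H: "H \<in> fiber a p L"
    and M: "M \<in> fiber a p (mirror K ` mirror H ` L)"
  shows "transfer a L H (transfer a (mirror H ` L) K M) =
         transfer a L K' (transfer a (mirror K' ` L) H' M)"
proof -
  let ?L1 = "mirror H ` L" and ?L1' = "mirror K' ` L"
  obtain p' q where D': "H \<in> fiber a p' L" "K \<in> fiber a q ?L1"
    "K' \<in> fiber a q L" "H' \<in> fiber a p' ?L1'" "mirror H' ` ?L1' = mirror K ` ?L1"
    using D unfolding double_reflection_def by blast
  have "p' = p" using fiber_member_unique[OF D'(1) H] .
  note D' = D'[unfolded this]
  note L1 = regular_mirror[OF L H] and L1' = regular_mirror[OF L D'(3)]
  have M': "M \<in> fiber a p (mirror H' ` ?L1')" using M D'(5) by simp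
  have tK: "transfer a ?L1 K H' = H"
    using transfer_eq[OF L1 double_reflection_sym[OF double_reflection_rotate[OF D]]] .
  have tK': "transfer a L K' H' = H" using transfer_eq[OF L double_reflection_sym[OF D]] .
  have H'2: "H' \<in> fiber a p (mirror K ` ?L1)" using fiber_mirror[OF D'(4)] D'(5) by simp
  note f1 = transfer_fiber[OF L1 D'(2) M] and f1' = transfer_fiber[OF L1' D'(4) M']
  show ?thesis
  proof (cases "M = H'")
    case True
    have n: "transfer a ?L1' H' H' \<noteq> H'" using transfer_self[OF L1' nd D'(4)] .
    have "transfer a L K' (transfer a ?L1' H' H') \<noteq> H"
      using transfer_inj[OF L D'(3) _ D'(4)] f1' n tK' True by metis
    moreover have "transfer a L H H \<noteq> H" using transfer_self[OF L nd H] .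
    ultimately show ?thesis
      using fiber_le_2[OF L H transfer_fiber[OF L H fiber_mirror[OF H]] transfer_fiber[OF L D'(3) f1']] True tK
      by simp
  next
    case False
    have "transfer a ?L1 K M \<noteq> H" using transfer_inj[OF L1 D'(2) M H'2] tK False by metis
    then have "transfer a L H (transfer a ?L1 K M) = H" using transfer_same_member[OF L H f1] by blast
    moreover have "transfer a ?L1' H' M = H'" using transfer_same_member[OF L1' D'(4) M' False] .
    ultimately show ?thesis using tK' by simp
  qed
qed

text \<open>Three-dimensional consistency of the double reflection: a hyperplane at the far line
  arrives at the same place along both sides. It makes a move leave the later entries of the divisor
  unchanged.\<close>

lemma transfer_cube:
  assumes L: "regular a L" and D: "double_reflection a L H K K' H'"
    and M: "M \<in> fiber a m (mirror K ` mirror H ` L)"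
  shows "transfer a L H (transfer a (mirror H ` L) K M) =
         transfer a L K' (transfer a (mirror K' ` L) H' M)"
proof -
  let ?L1 = "mirror H ` L" and ?L1' = "mirror K' ` L"
  obtain p q where D': "H \<in> fiber a p L" "K \<in> fiber a q ?L1"
    "K' \<in> fiber a q L" "H' \<in> fiber a p ?L1'" "mirror H' ` ?L1' = mirror K ` ?L1"
    using D unfolding double_reflection_def by blast
  note L1 = regular_mirror[OF L D'(1)] and L1' = regular_mirror[OF L D'(3)]
  have M': "M \<in> fiber a m (mirror H' ` ?L1')" using M D'(5) by simp
  note f1 = transfer_fiber[OF L1 D'(2) M] and f1' = transfer_fiber[OF L1' D'(4) M']
  note f2 = transfer_fiber[OF L D'(1) f1] and f2' = transfer_fiber[OF L D'(3) f1']
  have tH': "transfer a ?L1' K' H = H'"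
    using transfer_eq[OF L1' double_reflection_rotate[OF double_reflection_sym[OF D]]] .
  \<comment> \<open>\<open>fourth_fourth\<close> requires pairwise distinct members and a
    nondegenerate \<open>m\<close>, the last case. The others are settled by the small number of
    elements in a fiber.\<close>
  consider "degenerate a m" | "\<not> degenerate a m" "m = p" | "\<not> degenerate a m" "m = q"
    | "m \<noteq> p" "m \<noteq> q" "p = q" | "\<not> degenerate a m" "m \<noteq> p" "m \<noteq> q" "p \<noteq> q" by blast
  then show ?thesis
  proof cases
    case 1
    then show ?thesis using fiber_degenerate f2 f2' by blast
  next
    case 2
    then show ?thesis using transfer_cube_same_member[OF L D _ D'(1)] M by simp
  next
    case 3
    then show ?thesis using transfer_cube_same_member[OF L double_reflection_sym[OF D] _ D'(3)] M' by simp
  next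
    case 4
    show ?thesis
    \<comment> \<open>With one member, either \<open>H = K\<close> and each side returns to
      \<open>L\<close>, so that both composites are the identity, or the configuration is trivial
      with \<open>K' = H\<close> and \<open>H' = K\<close>.\<close>
    proof (cases "H = K")
      case True
      have e: "mirror K ` ?L1 = L" using True mirror_mirror[OF D'(1)] by simp
      have "H' = K'"
      proof (cases "degenerate a p")
        case True
        then show ?thesis using fiber_degenerate D'(3,4) 4 by blast
      next
        case False
        have "K' \<noteq> H" using double_reflection_same[OF L False D'(1)] D True by blast
        moreover have "H \<in> fiber a q (mirror K' ` ?L1')" using mirror_mirror[OF D'(3)] D'(1) 4 by simp
        ultimately show ?thesis using transfer_same_member[OF L1' fiber_mirror[OF D'(3)]] tH' by metis
      qed
      moreover have "M \<in> fiber a m L" using M e by simp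
      ultimately show ?thesis
        using transfer_transfer_mirror[OF L D'(1)] transfer_transfer_mirror[OF L D'(3)] True by metis
    next
      case False
      then have nd: "\<not> degenerate a p" using fiber_degenerate D'(1,2) 4 by blast
      have KH: "K' = H" using transfer_same_member[OF L D'(1)] D'(2) 4 False transfer_eq[OF L D] by metis
      have "transfer a ?L1 H H \<noteq> H" using transfer_self[OF L1 nd fiber_mirror[OF D'(1)]] .
      then have "H' \<noteq> H" using tH' KH by simp
      then have "H' = K"
        using fiber_le_2[OF L1 fiber_mirror[OF D'(1)], of H' K] D'(2,4) KH False 4 by blast
      then show ?thesis using KH by simp
    qed
  next
    case 5
    obtain h where h: "H = hyp h" "h \<noteq> 0" "reflectable a p h L" "mirror H = reflect h"
      using D'(1) by (rule fiberE)
    obtain k where k: "K = hyp k" "k \<noteq> 0" "reflectable a q k ?L1" "mirror K = reflect k"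
      using D'(2) by (rule fiberE)
    obtain v where v: "M = hyp v" "v \<noteq> 0" "reflectable a m v (mirror K ` ?L1)" using M by (rule fiberE)
    note ht = reflectableD(1)[OF h(3)] and kt = reflectableD(1)[OF k(3)] and vt = reflectableD(1)[OF v(3)]
    have ne: "hyp h \<noteq> hyp k" using dual_tangent_member_unique[OF ht kt] 5 by blast
    define k' where "k' = fourth a q h k"
    define h' where "h' = fourth a p k h"
    have DD: "double_reflection a L H K (hyp k') (hyp h')"
      using double_reflection_fourth[OF L h(3) _ ne] k(3) h(1,4) k(1) k'_def h'_def by simp
    then have K': "K' = hyp k'" using double_reflection_unique[OF L D] by blast
    have H': "H' = hyp h'"
      using transfer_eq[OF L1' double_reflection_rotate[OF double_reflection_sym[OF DD], folded K']] tH' by simp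
    have nz: "fourth a q h k \<noteq> 0" "fourth a p k h \<noteq> 0"
    proof -
      show "fourth a q h k \<noteq> 0" using fourth_nonzero[OF regularD[OF L] h(3) _ ne] k(3) h(4) by simp
      have "reflectable a p h (reflect k ` reflect k ` ?L1)"
        using reflectable_reflect[OF h(3)] h(4) k(2) by (simp add: reflect_image_reflect_image)
      then show "fourth a p k h \<noteq> 0"
        using fourth_nonzero[of "reflect k ` ?L1" q k p h] reflectable_reflect[OF k(3)] ne
          regularD[OF L1] k(2) by (simp add: subspace_reflect dim_reflect)
    qed
    have t: "dual_tangent a q k'" "dual_tangent a p h'"
      using dual_tangent_fourth kt ht nz k'_def h'_def by metis+
    have mk': "mirror K' = reflect k'" and mh': "mirror H' = reflect h'"
      using mirror_hyp K' H' nz k'_def h'_def by metis+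
    have hL: "reflectable a p h' ?L1'" and kL: "reflectable a q k' L"
      using hyp_in_fiber_iff D'(3,4) K' H' regularD(1)[OF L] regularD(1)[OF L1'] nz k'_def h'_def by metis+
    have n: "hyp k \<noteq> hyp v" "hyp h' \<noteq> hyp v"
      using dual_tangent_member_unique[OF kt vt] dual_tangent_member_unique[OF t(2) vt] 5 by blast+
    have 1: "transfer a ?L1 K M = hyp (fourth a m k v)"
      unfolding k(1) v(1) using transfer_fourth[OF L1 k(3) _ n(1)] v(3) k(4) by simp
    have r1: "reflectable a m (fourth a m k v) ?L1"
      using fourth_reflectable[OF regularD[OF L1] k(3) _ n(1)] v(3) k(4) by simp
    have v': "reflectable a m v (reflect h' ` ?L1')" using v(3) D'(5) mh' by simp
    have 2: "transfer a ?L1' H' M = hyp (fourth a m h' v)"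
      unfolding H' v(1) using transfer_fourth[OF L1' hL v' n(2)] .
    have r2: "reflectable a m (fourth a m h' v) ?L1'"
      using fourth_reflectable[OF regularD[OF L1'] hL v' n(2)] .
    have n2: "hyp h \<noteq> hyp (fourth a m k v)" "hyp k' \<noteq> hyp (fourth a m h' v)"
      using dual_tangent_member_unique[OF ht reflectableD(1)[OF r1]]
        dual_tangent_member_unique[OF t(1) reflectableD(1)[OF r2]] 5 by blast+
    have "transfer a L H (hyp (fourth a m k v)) = hyp (fourth a m h (fourth a m k v))"
      unfolding h(1) using transfer_fourth[OF L h(3) _ n2(1)] r1 h(4) by simp
    moreover have "transfer a L K' (hyp (fourth a m h' v)) = hyp (fourth a m k' (fourth a m h' v))"
      unfolding K' using transfer_fourth[OF L kL _ n2(2)] r2 mk' by simp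
    moreover obtain c where "c \<noteq> 0" "fourth a m h (fourth a m k v) = c *\<^sub>R fourth a m k' (fourth a m h' v)"
      using fourth_fourth[OF ht kt 5(4) nz(2,1) 5(2,3,1), of v] unfolding k'_def h'_def by blast
    ultimately show ?thesis unfolding 1 2 using hyp_scale by metis
  qed
qed

end

section \<open>Sequences of mirrors\<close>

definition mirrors :: "real^'n::finite \<Rightarrow> 'n hvec set \<Rightarrow> 'n hyperpl set" where
  "mirrors a L = (\<Union>q. fiber a q L)"

primrec mirror_path :: "real^'n::finite \<Rightarrow> 'n hvec set \<Rightarrow> 'n hyperpl list \<Rightarrow> bool" where
  "mirror_path a L [] \<longleftrightarrow> True"
| "mirror_path a L (H # hs) \<longleftrightarrow> H \<in> mirrors a L \<and> mirror_path a (mirror H ` L) hs"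

primrec path_end :: "('n::finite) hvec set \<Rightarrow> 'n hyperpl list \<Rightarrow> 'n hvec set" where
  "path_end L [] = L"
| "path_end L (H # hs) = path_end (mirror H ` L) hs"

text \<open>\<open>lines_meeting\<close> on hyperplanes alone: each mirror is carried back to the
  initial line, reflection by reflection.\<close>

primrec transport :: "real^'n::finite \<Rightarrow> 'n hvec set \<Rightarrow> 'n hyperpl list \<Rightarrow> 'n hyperpl list" where
  "transport a L [] = []"
| "transport a L (H # hs) = H # map (transfer a L H) (transport a (mirror H ` L) hs)"

definition path_moves :: "real^'n::finite \<Rightarrow> 'n hvec set \<Rightarrow> ('n hyperpl list \<times> 'n hyperpl list) set" where
  "path_moves a L = {(s, t). mirror_path a L s \<and> mirror_path a L t \<and>
     (\<exists>xs ys H K K' H'. s = xs @ [H, K] @ ys \<and> t = xs @ [K', H'] @ ys \<and>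
        double_reflection a (path_end L xs) H K K' H')}"

definition adjacent_swaps :: "('a list \<times> 'a list) set" where
  "adjacent_swaps = {(as @ [x, y] @ bs, as @ [y, x] @ bs) | as x y bs. True}"

lemma adjacent_swapsI: "(as @ [x, y] @ bs, as @ [y, x] @ bs) \<in> adjacent_swaps"
  unfolding adjacent_swaps_def by blast

lemma adjacent_swaps_Cons: "(xs, ys) \<in> adjacent_swaps\<^sup>* \<Longrightarrow> (x # xs, x # ys) \<in> adjacent_swaps\<^sup>*"
proof (induction rule: rtrancl_induct)
  case (step ys zs)
  have "(x # ys, x # zs) \<in> adjacent_swaps"
    using step(2) unfolding adjacent_swaps_def by (smt (verit) append_Cons mem_Collect_eq prod.inject)
  then show ?case using step(3) by simp
qed simp

lemma adjacent_swaps_to_front: "(as @ x # bs, x # as @ bs) \<in> adjacent_swaps\<^sup>*"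
proof (induction as)
  case (Cons y as)
  have "(y # as @ x # bs, y # x # as @ bs) \<in> adjacent_swaps\<^sup>*"
    using adjacent_swaps_Cons[OF Cons] .
  moreover have "([] @ [y, x] @ as @ bs, [] @ [x, y] @ as @ bs) \<in> adjacent_swaps"
    by (rule adjacent_swapsI)
  ultimately show ?case unfolding append.simps by (rule rtrancl_into_rtrancl)
qed simp

lemma mset_eq_imp_adjacent_swaps:
  "mset xs = mset ys \<Longrightarrow> (xs, ys) \<in> adjacent_swaps\<^sup>*"
proof (induction ys arbitrary: xs)
  case (Cons y ys)
  then have "y \<in> set xs" by (metis list.set_intros(1) mset_eq_setD)
  then obtain as bs where xs: "xs = as @ y # bs" by (meson split_list)
  then have "mset (as @ bs) = mset ys" using Cons.prems by simp
  from rtrancl_trans[OF adjacent_swaps_to_front adjacent_swaps_Cons[OF Cons.IH[OF this]]]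
  show ?case unfolding xs .
qed simp

section \<open>Transport along paths and its behaviour under moves\<close>

context confocal
begin

lemma mirrorsE:
  assumes "H \<in> mirrors a L"
  obtains q where "H \<in> fiber a q L"
  using assms unfolding mirrors_def by blast

lemma fiber_subset_mirrors: "H \<in> fiber a q L \<Longrightarrow> H \<in> mirrors a L"
  unfolding mirrors_def by blast

lemma regular_mirrors: "regular a L \<Longrightarrow> H \<in> mirrors a L \<Longrightarrow> regular a (mirror H ` L)"
  using regular_mirror mirrorsE by metis

lemma transfer_mirrors:
  "regular a L \<Longrightarrow> H \<in> mirrors a L \<Longrightarrow> K \<in> mirrors a (mirror H ` L) \<Longrightarrow> transfer a L H K \<in> mirrors a L"
  using transfer_fiber mirrorsE fiber_subset_mirrors by metis

lemma inj_on_transfer: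
  assumes "regular a L" "H \<in> mirrors a L"
  shows "inj_on (transfer a L H) (mirrors a (mirror H ` L))"
proof (rule inj_onI)
  fix K M assume "K \<in> mirrors a (mirror H ` L)" "M \<in> mirrors a (mirror H ` L)"
    and e: "transfer a L H K = transfer a L H M"
  then obtain q m where K: "K \<in> fiber a q (mirror H ` L)" and M: "M \<in> fiber a m (mirror H ` L)"
    using mirrorsE by metis
  obtain p where "H \<in> fiber a p L" using assms(2) by (rule mirrorsE)
  from transfer_inj[OF assms(1) this K M e] show "K = M" .
qed

lemma set_transport:
  "regular a L \<Longrightarrow> mirror_path a L hs \<Longrightarrow> set (transport a L hs) \<subseteq> mirrors a L"
proof (induction hs arbitrary: L)
  case (Cons H hs)
  then have H: "H \<in> mirrors a L" "mirror_path a (mirror H ` L) hs" by auto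
  note IH = Cons.IH[OF regular_mirrors[OF Cons.prems(1) H(1)] H(2)]
  have "transfer a L H K \<in> mirrors a L" if "K \<in> set (transport a (mirror H ` L) hs)" for K
    using transfer_mirrors[OF Cons.prems(1) H(1)] IH that by blast
  then show ?case using H(1) by (simp add: image_subset_iff)
qed simp

lemma length_transport: "length (transport a L hs) = length hs"
  by (induction hs arbitrary: L) auto

lemma transport_inj:
  "regular a L \<Longrightarrow> mirror_path a L s \<Longrightarrow> mirror_path a L t \<Longrightarrow> transport a L s = transport a L t \<Longrightarrow> s = t"
proof (induction s arbitrary: L t)
  case Nil
  then have "length t = 0" using length_transport[of L t] by simp
  then show ?case by simp
next
  case (Cons H s)
  obtain t' where t: "t = H # t'" using Cons.prems(4) by (cases t) auto
  have H: "H \<in> mirrors a L" "mirror_path a (mirror H ` L) s" "mirror_path a (mirror H ` L) t'"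
    using Cons.prems t by auto
  note L1 = regular_mirrors[OF Cons.prems(1) H(1)]
  have e: "map (transfer a L H) (transport a (mirror H ` L) s) = map (transfer a L H) (transport a (mirror H ` L) t')"
    using Cons.prems(4) t by simp
  have "inj_on (transfer a L H) (set (transport a (mirror H ` L) s) \<union> set (transport a (mirror H ` L) t'))"
    using inj_on_subset[OF inj_on_transfer[OF Cons.prems(1) H(1)]] set_transport[OF L1] H(2,3) by blast
  from map_inj_on[OF e this]
  show ?case using Cons.IH[OF L1 H(2,3)] t by simp
qed

text \<open>The map \<open>\<B>\<close>: the head is already the first mirror, and the remaining
  entries are pushed forward to the reflected line by the inverse transfer. This alters the tail,
  hence the induction on the length.\<close>

lemma transport_surj:
  "regular a L \<Longrightarrow> set xs \<subseteq> mirrors a L \<Longrightarrow> \<exists>hs. mirror_path a L hs \<and> transport a L hs = xs"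
proof (induction "length xs" arbitrary: L xs)
  case 0
  then show ?case by (intro exI[of _ "[]"]) simp
next
  case (Suc n)
  then obtain H ys where xs: "xs = H # ys" by (cases xs) auto
  then have H: "H \<in> mirrors a L" and ys: "set ys \<subseteq> mirrors a L" using Suc.prems(2) by auto
  obtain p where p: "H \<in> fiber a p L" using H by (rule mirrorsE)
  note L1 = regular_mirrors[OF Suc.prems(1) H]
  let ?f = "transfer a (mirror H ` L) H"
  have e: "mirror H ` mirror H ` L = L" using mirror_mirror[OF p] .
  have "?f K \<in> mirrors a (mirror H ` L)" if "K \<in> mirrors a L" for K
    using transfer_mirrors[OF L1 fiber_subset_mirrors[OF fiber_mirror[OF p]]] that unfolding e by blast
  then have "set (map ?f ys) \<subseteq> mirrors a (mirror H ` L)" using ys by auto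
  then obtain hs where hs: "mirror_path a (mirror H ` L) hs" "transport a (mirror H ` L) hs = map ?f ys"
    using Suc.hyps(1)[OF _ L1, of "map ?f ys"] Suc.hyps(2) xs by auto
  have "transfer a L H (?f K) = K" if "K \<in> set ys" for K
    using transfer_transfer_mirror[OF Suc.prems(1) p] mirrorsE ys that by (metis subsetD)
  then have "map (transfer a L H) (map ?f ys) = ys" by (simp add: map_idI)
  then show ?case using hs H xs by (intro exI[of _ "H # hs"]) simp
qed

text \<open>At the place of the move, \<open>H, K\<close> is carried to \<open>H, K'\<close>, and
  \<open>K', H'\<close> to \<open>K', H\<close>; later entries agree by
  \<open>transfer_cube\<close>. The length of \<open>as\<close> records the position, which the
  converse needs.\<close>

lemma transport_move:
  assumes "regular a L" "mirror_path a L (xs @ [H, K] @ ys)" "double_reflection a (path_end L xs) H K K' H'"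
  shows "mirror_path a L (xs @ [K', H'] @ ys) \<and>
    (\<exists>as x y bs. length as = length xs \<and> transport a L (xs @ [H, K] @ ys) = as @ [x, y] @ bs \<and>
       transport a L (xs @ [K', H'] @ ys) = as @ [y, x] @ bs)"
  using assms
proof (induction xs arbitrary: L)
  case Nil
  note L = Nil.prems(1)
  have D: "double_reflection a L H K K' H'" using Nil.prems(3) by simp
  let ?L2 = "mirror K ` mirror H ` L"
  have p: "H \<in> mirrors a L" "K \<in> mirrors a (mirror H ` L)" "mirror_path a ?L2 ys"
    using Nil.prems(2) by auto
  have K': "K' \<in> mirrors a L" "H' \<in> mirrors a (mirror K' ` L)" "mirror H' ` mirror K' ` L = ?L2"
    using D unfolding double_reflection_def mirrors_def by blast+
  have t: "transfer a L H K = K'" "transfer a L K' H' = H"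
    using transfer_eq[OF L D] transfer_eq[OF L double_reflection_sym[OF D]] by auto
  note L2 = regular_mirrors[OF regular_mirrors[OF L p(1)] p(2)]
  have c: "transfer a L H (transfer a (mirror H ` L) K M) = transfer a L K' (transfer a (mirror K' ` L) H' M)"
    if "M \<in> set (transport a ?L2 ys)" for M
  proof -
    have "M \<in> mirrors a ?L2" using set_transport[OF L2 p(3)] that by blast
    then obtain m where "M \<in> fiber a m ?L2" by (rule mirrorsE)
    from transfer_cube[OF L D this] show ?thesis .
  qed
  define bs where "bs = map (transfer a L H) (map (transfer a (mirror H ` L) K) (transport a ?L2 ys))"
  have bs: "bs = map (transfer a L K') (map (transfer a (mirror K' ` L) H') (transport a ?L2 ys))"
    unfolding bs_def map_map by (rule map_cong) (auto simp: c)
  have "transport a L ([] @ [H, K] @ ys) = [] @ [H, K'] @ bs" by (simp add: bs_def t)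
  moreover have "transport a L ([] @ [K', H'] @ ys) = [] @ [K', H] @ bs"
    unfolding bs by (simp only: append.simps transport.simps K'(3) list.map t)
  moreover have "mirror_path a L ([] @ [K', H'] @ ys)"
    by (simp only: append.simps mirror_path.simps K' p(3) simp_thms)
  ultimately show ?case by (metis length_0_conv)
next
  case (Cons J xs)
  have J: "J \<in> mirrors a L" "mirror_path a (mirror J ` L) (xs @ [H, K] @ ys)"
    using Cons.prems(2) by auto
  have "double_reflection a (path_end (mirror J ` L) xs) H K K' H'" using Cons.prems(3) by simp
  from Cons.IH[OF regular_mirrors[OF Cons.prems(1) J(1)] J(2) this]
  obtain as x y bs where IH: "mirror_path a (mirror J ` L) (xs @ [K', H'] @ ys)" "length as = length xs"
    "transport a (mirror J ` L) (xs @ [H, K] @ ys) = as @ [x, y] @ bs"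
    "transport a (mirror J ` L) (xs @ [K', H'] @ ys) = as @ [y, x] @ bs" by blast
  let ?f = "transfer a L J"
  have "transport a L ((J # xs) @ [H, K] @ ys) = (J # map ?f as) @ [?f x, ?f y] @ map ?f bs"
    using IH(3) by simp
  moreover have "transport a L ((J # xs) @ [K', H'] @ ys) = (J # map ?f as) @ [?f y, ?f x] @ map ?f bs"
    using IH(4) by simp
  moreover have "mirror_path a L ((J # xs) @ [K', H'] @ ys)" using J(1) IH(1) by simp
  moreover have "length (J # map ?f as) = length (J # xs)" using IH(2) by simp
  ultimately show ?case by metis
qed

lemma regular_path_end: "regular a L \<Longrightarrow> mirror_path a L (xs @ ys) \<Longrightarrow> regular a (path_end L xs) \<and> mirror_path a (path_end L xs) ys"
proof (induction xs arbitrary: L)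
  case (Cons H xs)
  then have H: "H \<in> mirrors a L" "mirror_path a (mirror H ` L) (xs @ ys)" by auto
  from Cons.IH[OF regular_mirrors[OF Cons.prems(1) H(1)] H(2)] show ?case by simp
qed simp

lemma path_moves_mset:
  assumes "regular a L" "(s, t) \<in> (path_moves a L)\<^sup>*"
  shows "mset (transport a L s) = mset (transport a L t)"
  using assms(2)
proof (induction rule: rtrancl_induct)
  case (step t u)
  then obtain xs ys H K K' H' where m: "mirror_path a L t" "t = xs @ [H, K] @ ys" "u = xs @ [K', H'] @ ys"
     "double_reflection a (path_end L xs) H K K' H'"
    unfolding path_moves_def by blast
  obtain as x y bs where "transport a L t = as @ [x, y] @ bs" "transport a L u = as @ [y, x] @ bs"
    using transport_move[OF assms(1) _ m(4), of ys] m(1-3) by blast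
  then show ?case using step.IH by simp
qed simp

lemma path_move_exists:
  assumes "regular a L" "mirror_path a L s" "transport a L s = as @ [x, y] @ bs"
  shows "\<exists>t. (s, t) \<in> path_moves a L \<and> transport a L t = as @ [y, x] @ bs"
proof -
  have l: "length s = length as + Suc (Suc (length bs))"
    using length_transport[of L s] assms(3) by simp
  define xs where "xs = take (length as) s"
  have len: "length xs = length as" using l by (simp add: xs_def)
  obtain H ys' where d: "drop (length as) s = H # ys'" using l by (cases "drop (length as) s") auto
  moreover have "length (drop (length as) s) = Suc (Suc (length bs))" using l by simp
  ultimately obtain K ys where "ys' = K # ys" by (cases ys') auto
  then have s: "s = xs @ [H, K] @ ys" using d append_take_drop_id[of "length as" s] by (simp add: xs_def)
  have R: "regular a (path_end L xs)" "mirror_path a (path_end L xs) ([H, K] @ ys)"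
    using regular_path_end[OF assms(1)] assms(2) s by blast+
  then have HK: "H \<in> mirrors a (path_end L xs)" "K \<in> mirrors a (mirror H ` path_end L xs)" by auto
  obtain p where p: "H \<in> fiber a p (path_end L xs)" using HK(1) by (rule mirrorsE)
  obtain q where q: "K \<in> fiber a q (mirror H ` path_end L xs)" using HK(2) by (rule mirrorsE)
  obtain K' H' where D: "double_reflection a (path_end L xs) H K K' H'"
    using double_reflection_exists[OF R(1) p q] by blast
  obtain as' x' y' bs' where m: "mirror_path a L (xs @ [K', H'] @ ys)" "length as' = length xs"
    "transport a L s = as' @ [x', y'] @ bs'" "transport a L (xs @ [K', H'] @ ys) = as' @ [y', x'] @ bs'"
    using transport_move[OF assms(1) assms(2)[unfolded s] D, folded s] by blast
  have "as' @ [x', y'] @ bs' = as @ [x, y] @ bs" using m(3) assms(3) by (rule trans[OF sym])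
  then have "as' = as \<and> [x', y'] @ bs' = [x, y] @ bs"
    using append_eq_append_conv[of as' as] m(2) len by metis
  then have "as' = as" "x' = x" "y' = y" "bs' = bs" by simp_all
  moreover have "(s, xs @ [K', H'] @ ys) \<in> path_moves a L"
    unfolding path_moves_def using assms(2) m(1) s D by blast
  ultimately show ?thesis using m(4) by metis
qed

text \<open>Each transposition of neighbours in the divisor lifts to a move of the path. The lifted
  path ends with the transport of \<open>t\<close>, and injectivity identifies it with
  \<open>t\<close>.\<close>

lemma mset_eq_imp_path_moves:
  assumes L: "regular a L" and s: "mirror_path a L s" and t: "mirror_path a L t"
    and e: "mset (transport a L s) = mset (transport a L t)"
  shows "(s, t) \<in> (path_moves a L)\<^sup>*"
proof -
  have "(transport a L s, transport a L t) \<in> adjacent_swaps\<^sup>*"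
    using mset_eq_imp_adjacent_swaps[OF e] .
  then have "\<exists>u. (s, u) \<in> (path_moves a L)\<^sup>* \<and> mirror_path a L u \<and> transport a L u = transport a L t"
  proof (induction rule: rtrancl_induct)
    case base
    then show ?case using s by blast
  next
    case (step v w)
    then obtain u where u: "(s, u) \<in> (path_moves a L)\<^sup>*" "mirror_path a L u" "transport a L u = v" by blast
    obtain as x y bs where v: "v = as @ [x, y] @ bs" and w: "w = as @ [y, x] @ bs"
      using step(2) unfolding adjacent_swaps_def by blast
    obtain u' where u': "(u, u') \<in> path_moves a L" "transport a L u' = w"
      using path_move_exists[OF L u(2)] u(3) v w by blast
    then have "mirror_path a L u'" unfolding path_moves_def by blast
    moreover have "(s, u') \<in> (path_moves a L)\<^sup>*" using u(1) u'(1) by (rule rtrancl_into_rtrancl)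
    ultimately show ?case using u'(2) by blast
  qed
  then show ?thesis using transport_inj[OF L] t by metis
qed

end

section \<open>Lines and the reflection law\<close>

lemma proj_span_line_through: "proj_span (line_through p u) = span {(p, 1), (u, 0)}"
proof -
  have e: "(\<lambda>x. (x, 1::real)) ` line_through p u = range (\<lambda>t. (p, 1) + t *\<^sub>R (u, 0))"
    by (simp add: line_through_def image_image)
  have a: "(p, 1) \<in> span (range (\<lambda>t. (p, 1) + t *\<^sub>R (u, 0)))"
    by (rule span_base) (auto intro: image_eqI[where x = 0])
  have "(p, 1) + 1 *\<^sub>R (u, 0) \<in> span (range (\<lambda>t. (p, 1) + t *\<^sub>R (u, 0)))"
    by (rule span_base) blast
  from span_diff[OF this a] have b: "(u, 0) \<in> span (range (\<lambda>t. (p, 1) + t *\<^sub>R (u, 0)))" by simp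
  have "(p, 1) + t *\<^sub>R (u, 0) \<in> span {(p, 1), (u, 0)}" for t :: real
    by (intro span_add span_scale span_base) auto
  then show ?thesis unfolding proj_span_def e
    using a b by (intro subset_antisym span_minimal subspace_span) auto
qed

lemma line_through_plane:
  assumes "u \<noteq> 0"
  shows "dim (span {(p, 1::real), (u, 0)}) = 2"
proof -
  have "(u, 0) \<noteq> (0 :: 'a \<times> real)" using assms by (simp add: zero_prod_def)
  moreover have "(p, 1::real) \<noteq> c *\<^sub>R (u, 0)" for c by simp
  ultimately have "independent {(u, 0), (p, 1::real)}" "(u, 0) \<noteq> (p, 1::real)"
    using independent_pair[of "(u, 0)" "(p, 1::real)"] by blast+
  then show ?thesis by (simp add: dim_eq_card_independent insert_commute)
qed

lemma is_lineE:
  assumes "is_line l"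
  obtains p u where "u \<noteq> 0" "l = line_through p u" "proj_span l = span {(p, 1), (u, 0)}"
  using assms proj_span_line_through unfolding is_line_def by blast

lemma is_line_plane:
  assumes "is_line l"
  shows "subspace (proj_span l)" "dim (proj_span l) = 2"
  using assms by (metis is_lineE subspace_span, metis is_lineE line_through_plane)

lemma line_at_infinity:
  assumes "is_line l" "(x, 0) \<in> proj_span l" "x \<noteq> 0"
    and "(y, 0) \<in> proj_span l"
  shows "\<exists>c. y = c *\<^sub>R x"
proof -
  obtain p u where l: "proj_span l = span {(p, 1), (u, 0)}" using assms(1) by (rule is_lineE)
  have "\<exists>t. z = t *\<^sub>R u" if "(z, 0) \<in> proj_span l" for z
    using that unfolding l by (elim span_pairE) auto
  then obtain s t where "x = s *\<^sub>R u" "y = t *\<^sub>R u" using assms by metis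
  then have "y = (t / s) *\<^sub>R x" using assms(3) by auto
  then show ?thesis ..
qed

lemma mem_line_iff:
  assumes "is_line l"
  shows "x \<in> l \<longleftrightarrow> (x, 1) \<in> proj_span l"
proof
  show "(x, 1) \<in> proj_span l" if "x \<in> l" unfolding proj_span_def using that by (intro span_base) blast
  assume x: "(x, 1) \<in> proj_span l"
  obtain p u where l: "l = line_through p u" "proj_span l = span {(p, 1), (u, 0)}"
    using assms by (rule is_lineE)
  obtain s t where "(x, 1) = s *\<^sub>R (p, 1::real) + t *\<^sub>R (u, 0)"
    using x unfolding l(2) by (rule span_pairE)
  then show "x \<in> l" by (auto simp: l(1) line_through_def)
qed

lemma line_eqI: "is_line l \<Longrightarrow> is_line m \<Longrightarrow> proj_span l = proj_span m \<Longrightarrow> l = m"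
  using mem_line_iff by blast

lemma line_through_point:
  assumes "is_line l" "(p, 1) \<in> proj_span l"
  obtains u where "norm u = 1" "l = line_through p u" "(u, 0) \<in> proj_span l"
proof -
  obtain p' u where l: "u \<noteq> 0" "l = line_through p' u" "proj_span l = span {(p', 1), (u, 0)}"
    using assms(1) by (rule is_lineE)
  have u: "(u /\<^sub>R norm u, 0) \<in> proj_span l"
    using span_scale[of "(u, 0)" "{(p', 1), (u, 0)}" "inverse (norm u)"] l(3) by (simp add: span_base)
  have "(p, 1) \<in> span {(p', 1::real), (u, 0)}" using assms(2) l(3) by simp
  then obtain s t where "(p, 1) = s *\<^sub>R (p', 1::real) + t *\<^sub>R (u, 0)" by (rule span_pairE)
  then have p: "p = p' + t *\<^sub>R u" by simp
  have "line_through p (u /\<^sub>R norm u) = l"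
  proof (rule set_eqI)
    fix x
    have "x \<in> line_through p (u /\<^sub>R norm u) \<longleftrightarrow> (\<exists>r. x = p' + (t + r / norm u) *\<^sub>R u)"
      by (auto simp: line_through_def p algebra_simps divide_inverse)
    also have "\<dots> \<longleftrightarrow> (\<exists>r. x = p' + r *\<^sub>R u)"
    proof
      assume "\<exists>r. x = p' + r *\<^sub>R u"
      then obtain r where "x = p' + (t + ((r - t) * norm u) / norm u) *\<^sub>R u" using l(1) by auto
      then show "\<exists>r. x = p' + (t + r / norm u) *\<^sub>R u" by blast
    qed blast
    also have "\<dots> \<longleftrightarrow> x \<in> l" by (auto simp: l(2) line_through_def)
    finally show "x \<in> line_through p (u /\<^sub>R norm u) \<longleftrightarrow> x \<in> l" .
  qed
  moreover have "norm (u /\<^sub>R norm u) = 1" using l(1) by simp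
  ultimately show ?thesis using that u by metis
qed

lemma hyp_infinity: "hyp (0, 1) = (hyper_inf :: ('n::finite) hyperpl)"
  by (auto simp: hyp_def hyper_inf_def inner_prod_def)

lemma line_not_at_infinity:
  assumes "is_line l"
  shows "\<not> proj_span l \<subseteq> hyper_inf"
proof -
  obtain p u where "proj_span l = span {(p, 1), (u, 0)}" using assms by (rule is_lineE)
  then have "(p, 1) \<in> proj_span l" by (simp add: span_base)
  then show ?thesis by (auto simp: hyper_inf_def)
qed

text \<open>Inverse to \<open>proj_span\<close> on planes not contained in the hyperplane at
  infinity.\<close>

definition line_of :: "('n::finite) hvec set \<Rightarrow> 'n line" where
  "line_of L = {x. (x, 1) \<in> L}"

lemma line_of_plane:
  assumes L: "subspace L" "dim L = 2" "\<not> L \<subseteq> hyper_inf"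
  shows "is_line (line_of L)" "proj_span (line_of L) = L"
proof -
  obtain w where w: "w \<in> L" "snd w \<noteq> 0" using L(3) by (auto simp: hyper_inf_def)
  define p where "p = fst w /\<^sub>R snd w"
  have "inverse (snd w) *\<^sub>R w \<in> L" using L w subspace_scale by blast
  moreover have "inverse (snd w) *\<^sub>R w = (p, 1)" using w by (simp add: p_def prod_eq_iff)
  ultimately have p: "(p, 1) \<in> L" by simp
  have "\<not> L \<subseteq> span {(p, 1)}"
    using dim_subset[of L "span {(p, 1)}"] L(2) by (auto simp: zero_prod_def)
  then obtain v where v: "v \<in> L" "v \<notin> span {(p, 1)}" by blast
  define u where "u = fst v - snd v *\<^sub>R p"
  have "v - snd v *\<^sub>R (p, 1) \<in> L" using L v p by (intro subspace_diff subspace_scale)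
  moreover have "v - snd v *\<^sub>R (p, 1) = (u, 0)" by (simp add: u_def prod_eq_iff)
  ultimately have u: "(u, 0) \<in> L" by simp
  have u0: "u \<noteq> 0"
  proof
    assume "u = 0"
    then have "v = snd v *\<^sub>R (p, 1)" by (simp add: u_def prod_eq_iff)
    then show False using v(2) span_singleton by blast
  qed
  have "span {(p, 1), (u, 0)} \<subseteq> L" using p u L(1) by (intro span_minimal) auto
  then have S: "span {(p, 1), (u, 0)} = L"
    using line_through_plane[OF u0, of p] L by (intro subspace_dim_equal) auto
  have l: "is_line (line_through p u)" using u0 unfolding is_line_def by blast
  have "line_of L = line_through p u"
    using mem_line_iff[OF l] proj_span_line_through[of p u] S by (auto simp: line_of_def)
  then show "is_line (line_of L)" "proj_span (line_of L) = L"
    using l proj_span_line_through[of p u] S by simp_all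
qed

lemma line_of_proj_span: "is_line l \<Longrightarrow> line_of (proj_span l) = l"
  using mem_line_iff unfolding line_of_def by blast

text \<open>The factor \<open>c\<close> allows for the hyperplane at infinity, whose reflection
  takes \<open>(x, 1)\<close> to \<open>(x, - 1)\<close>, a representative of the point
  \<open>- x\<close> with factor \<open>- 1\<close>.\<close>

lemma proj_span_image:
  assumes "\<And>x. reflect N (x, 1) = c *\<^sub>R (f x, 1)" "c \<noteq> 0"
  shows "proj_span (f ` l) = reflect N ` proj_span l"
proof -
  have "reflect N ` proj_span l = span (reflect N ` (\<lambda>x. (x, 1)) ` l)"
    unfolding proj_span_def by (rule span_linear_image[OF linear_reflect, symmetric])
  also have "reflect N ` (\<lambda>x. (x, 1)) ` l = (\<lambda>x. c *\<^sub>R (f x, 1)) ` l"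
    using assms(1) by (simp add: image_image)
  also have "span ((\<lambda>x. c *\<^sub>R (f x, 1)) ` l) = span ((\<lambda>x. (f x, 1)) ` l)"
  proof (intro subset_antisym span_minimal subspace_span image_subsetI)
    show "c *\<^sub>R (f x, 1) \<in> span ((\<lambda>x. (f x, 1)) ` l)" if "x \<in> l" for x
      using that by (intro span_scale span_base) blast
    show "(f x, 1) \<in> span ((\<lambda>x. c *\<^sub>R (f x, 1)) ` l)" if "x \<in> l" for x
    proof -
      have "(1 / c) *\<^sub>R (c *\<^sub>R (f x, 1)) \<in> span ((\<lambda>x. c *\<^sub>R (f x, 1)) ` l)"
        using that by (intro span_scale span_base) blast
      then show ?thesis using assms(2) by simp
    qed
  qed
  finally show ?thesis by (simp add: proj_span_def image_image)
qed

lemma coplanar_directions: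
  fixes p u v n :: "'a::euclidean_space"
  assumes "coplanar S" "p \<in> S" "p + u \<in> S" "p + v \<in> S" "p + n \<in> S" "n \<noteq> 0" "\<And>c. u \<noteq> c *\<^sub>R n"
  shows "v \<in> span {n, u}"
proof (rule ccontr)
  assume v: "v \<notin> span {n, u}"
  obtain x y z where S: "S \<subseteq> affine hull {x, y, z}" using assms(1) unfolding coplanar_def by blast
  have d: "w - x \<in> span {y - x, z - x}" if "w \<in> S" for w
  proof -
    have "w \<in> affine hull {x, y, z}" using S that by blast
    then obtain r s t where "w = r *\<^sub>R x + s *\<^sub>R y + t *\<^sub>R z" "r + s + t = 1"
      unfolding affine_hull_3 by blast
    moreover then have "r = 1 - s - t" by simp
    ultimately have "w - x = s *\<^sub>R (y - x) + t *\<^sub>R (z - x)" by (simp add: algebra_simps)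
    moreover have "s *\<^sub>R (y - x) + t *\<^sub>R (z - x) \<in> span {y - x, z - x}"
      by (intro span_add span_scale span_base) auto
    ultimately show ?thesis by simp
  qed
  have e: "w \<in> span {y - x, z - x}" if "p + w \<in> S" for w
    using span_diff[OF d[OF that] d[OF assms(2)]] by simp
  have "v \<notin> {n, u}" using v span_base by blast
  then have "independent {v, n, u}"
    using independent_pair(1)[OF assms(6,7)] v independent_insert[of v "{n, u}"] by metis
  moreover have "{v, n, u} \<subseteq> span {y - x, z - x}" using e assms(3-5) by blast
  ultimately have "card {v, n, u} \<le> card {y - x, z - x}"
    using independent_span_bound[of "{y - x, z - x}" "{v, n, u}"] by simp
  moreover have "card {v, n, u} = 3"
    using independent_pair(2)[OF assms(6,7)] \<open>v \<notin> {n, u}\<close> by simp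
  moreover have "card {y - x, z - x} \<le> 2" by (simp add: card_insert_if)
  ultimately show False by simp
qed

text \<open>Unit length and equal angles give two quadratic equations for the coefficients of
  \<open>v\<close>; their difference is \<open>(\<beta>\<^sup>2 - 1) * (1 - t\<^sup>2) = 0\<close>,
  and \<open>t\<^sup>2 \<noteq> 1\<close> since \<open>u\<close> is not a multiple of
  \<open>n\<close>. The solutions \<open>u\<close> and \<open>- u\<close> belong to the unreflected
  line.\<close>

lemma reflected_unit_vector:
  fixes n u v :: "'a::euclidean_space"
  assumes "norm n = 1" "norm u = 1" "norm v = 1" "\<bar>u \<bullet> n\<bar> = \<bar>v \<bullet> n\<bar>" "v \<in> span {n, u}"
    and ind: "\<And>c. u \<noteq> c *\<^sub>R n"
  shows "v = u \<or> v = - u \<or> v = u - (2 * (n \<bullet> u)) *\<^sub>R n \<or> v = - (u - (2 * (n \<bullet> u)) *\<^sub>R n)"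
proof -
  obtain \<alpha> \<beta> where v: "v = \<alpha> *\<^sub>R n + \<beta> *\<^sub>R u" using assms(5) by (rule span_pairE)
  define t where "t = n \<bullet> u"
  have nn: "n \<bullet> n = 1" "u \<bullet> u = 1" "v \<bullet> v = 1" using assms(1-3) by (simp_all add: norm_eq_1)
  have t: "n \<bullet> u = t" "u \<bullet> n = t" by (simp_all add: t_def inner_commute)
  have "(v \<bullet> n)\<^sup>2 = (u \<bullet> n)\<^sup>2" using assms(4) by (metis power2_abs)
  then have a: "(\<alpha> + \<beta> * t)\<^sup>2 = t\<^sup>2" by (simp add: v inner_add_left nn t)
  have b: "\<alpha>\<^sup>2 + 2 * \<alpha> * \<beta> * t + \<beta>\<^sup>2 = 1"
    using nn(3) by (simp add: v inner_add_left inner_add_right nn t power2_eq_square algebra_simps)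
  have "t\<^sup>2 \<noteq> 1"
  proof
    assume "t\<^sup>2 = 1"
    then have "(u - t *\<^sub>R n) \<bullet> (u - t *\<^sub>R n) = 0"
      by (simp add: inner_diff_left inner_diff_right nn t power2_eq_square)
    then show False using ind[of t] by simp
  qed
  moreover have "(\<beta>\<^sup>2 - 1) * (1 - t\<^sup>2) = 0" using a b by algebra
  ultimately have "\<beta> = 1 \<or> \<beta> = - 1" by (auto simp: power2_eq_1_iff)
  then show ?thesis
  proof
    assume "\<beta> = 1"
    then have "\<alpha> * (\<alpha> + 2 * t) = 0" using b by (simp add: power2_eq_square algebra_simps)
    then have "\<alpha> = 0 \<or> \<alpha> = - 2 * t" by auto
    then show ?thesis using v \<open>\<beta> = 1\<close> by (auto simp: t_def)
  next
    assume "\<beta> = - 1"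
    then have "\<alpha> * (\<alpha> - 2 * t) = 0" using b by (simp add: power2_eq_square algebra_simps)
    then have "\<alpha> = 0 \<or> \<alpha> = 2 * t" by auto
    then show ?thesis using v \<open>\<beta> = - 1\<close> by (auto simp: t_def)
  qed
qed

lemma line_through_minus: "line_through p (- u) = line_through p u"
proof -
  have "p + t *\<^sub>R (- u) = p + (- t) *\<^sub>R u" for t by simp
  moreover have "p + t *\<^sub>R u = p + (- t) *\<^sub>R (- u)" for t by simp
  ultimately show ?thesis unfolding line_through_def by blast
qed

lemma mem_line_through: "p \<in> line_through p u" "p + u \<in> line_through p u"
proof -
  have "p + 0 *\<^sub>R u \<in> line_through p u" "p + 1 *\<^sub>R u \<in> line_through p u"
    unfolding line_through_def by blast+
  then show "p \<in> line_through p u" "p + u \<in> line_through p u" by simp_all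
qed

section \<open>The reflection law as a linear reflection\<close>

lemma unit_normal:
  fixes N :: "('n::finite) hvec"
  assumes "fst N \<noteq> 0"
  obtains n c k where "norm n = 1" "N = k *\<^sub>R (n, - c)" "k \<noteq> 0"
proof
  show "norm (fst N /\<^sub>R norm (fst N)) = 1" using assms by simp
  show "N = norm (fst N) *\<^sub>R (fst N /\<^sub>R norm (fst N), - (- (snd N / norm (fst N))))"
    using assms by (simp add: prod_eq_iff)
  show "norm (fst N) \<noteq> 0" using assms by simp
qed

lemma reflect_unit:
  assumes "norm n = 1"
  shows "reflect (n, - c) (x, w) = (x - (2 * (n \<bullet> x - c * w)) *\<^sub>R n, w)"
proof -
  have "n \<noteq> 0" "n \<bullet> n = 1" using assms by (auto simp: norm_eq_1)
  then show ?thesis by (simp add: reflect_def centre_def inner_prod_def)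
qed

lemma span_pair_uminus: "span {x, - y} = span {x, y :: 'a::real_vector}"
proof -
  have "- y \<in> span {x, y}" "y \<in> span {x, - y}"
    by (metis span_neg span_base insertCI, metis span_neg span_base insertCI minus_minus)
  then show ?thesis by (intro subset_antisym span_minimal subspace_span) (auto simp: span_base)
qed

abbreviation reflected_line :: "('n::finite) hvec \<Rightarrow> 'n line \<Rightarrow> 'n line \<Rightarrow> bool" where
  "reflected_line N l m \<equiv> is_line m \<and> proj_span m = reflect N ` proj_span l \<and> \<not> proj_span l \<subseteq> hyp N"

lemma reflection_law_finite_iff:
  assumes l: "is_line l" "(p, 1) \<in> proj_span l" and N: "N \<noteq> 0" "N \<bullet> (p, 1) = 0"
  shows "reflection_law_finite (hyp N) p l m \<longleftrightarrow>
     reflected_line N l m"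
proof -
  have "fst N \<noteq> 0" using N by (auto simp: inner_prod_def prod_eq_iff)
  then obtain n c k where n: "norm n = 1" and Nk: "N = k *\<^sub>R (n, - c)" "k \<noteq> 0" by (rule unit_normal)
  have H: "hyp N = hyp (n, - c)" "reflect N = reflect (n, - c)"
    unfolding Nk(1) using hyp_scale reflect_scale_normal Nk(2) by metis+
  have np: "n \<bullet> p = c" using N(2) Nk by (simp add: inner_prod_def)
  have n0: "n \<noteq> 0" "n \<bullet> n = 1" using n by (auto simp: norm_eq_1)
  have plane: "reflect (n, - c) ` span {(p, 1), (u, 0)} = span {(p, 1), (u - (2 * (n \<bullet> u)) *\<^sub>R n, 0)}" for u
    unfolding span_linear_image[OF linear_reflect, symmetric] by (simp add: reflect_unit[OF n] np)
  have trans: "span {(p, 1), (u, 0)} \<subseteq> hyp (n, - c) \<longleftrightarrow> n \<bullet> u = 0" for u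
  proof
    assume "span {(p, 1), (u, 0)} \<subseteq> hyp (n, - c)"
    moreover have "(u, 0) \<in> span {(p, 1), (u, 0)}" by (simp add: span_base)
    ultimately have "(u, 0) \<in> hyp (n, - c)" by blast
    then show "n \<bullet> u = 0" by (simp add: hyp_def inner_prod_def)
  next
    assume "n \<bullet> u = 0"
    then have "{(p, 1), (u, 0)} \<subseteq> hyp (n, - c)" using np by (simp add: hyp_def inner_prod_def)
    then show "span {(p, 1), (u, 0)} \<subseteq> hyp (n, - c)" by (rule span_minimal[OF _ subspace_hyp])
  qed
  show ?thesis
  proof
    assume "reflection_law_finite (hyp N) p l m"
    then obtain n' c' u v where r: "norm n' = 1" "norm u = 1" "norm v = 1" "hyp N = hyp (n', - c')" "n' \<bullet> p = c'"
      "l = line_through p u" "m = line_through p v" "coplanar (l \<union> m \<union> line_through p n')"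
      "\<bar>u \<bullet> n'\<bar> = \<bar>v \<bullet> n'\<bar>" "l = m \<longrightarrow> l = line_through p n'"
      unfolding reflection_law_finite_def hyp_def by blast
    have nz: "(n, - c) \<noteq> 0" "(n', - c') \<noteq> 0" using n r(1) by (auto simp: zero_prod_def)
    have "hyp (n, - c) = hyp (n', - c')" using H r(4) by simp
    then obtain e where e: "e \<noteq> 0" "(n', - c') = e *\<^sub>R (n, - c)" using hyp_eqE nz by metis
    then have n'e: "n' = e *\<^sub>R n" by simp
    have e1: "\<bar>e\<bar> = 1" using n r(1) n'e by simp
    have un: "u \<noteq> 0" "v \<noteq> 0" using r(2,3) by auto
    have L: "proj_span l = span {(p, 1), (u, 0)}" unfolding r(6) by (rule proj_span_line_through)
    have M: "proj_span m = span {(p, 1), (v, 0)}" unfolding r(7) by (rule proj_span_line_through)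
    have ln: "line_through p n' = line_through p n"
    proof -
      have "e = 1 \<or> e = - 1" using e1 by arith
      then show ?thesis using line_through_minus[of p n] n'e by (elim disjE) simp_all
    qed
    have mem: "p \<in> l" "p + u \<in> l" "p + v \<in> m" "p + n \<in> line_through p n"
      unfolding r(6,7) by (rule mem_line_through)+
    \<comment> \<open>At normal incidence coplanarity says nothing about \<open>v\<close>, and the
      angle alone forces \<open>v = u\<close> or \<open>v = - u\<close>. Otherwise the clause on
      \<open>l = m\<close> removes the two unreflected solutions.\<close>
    have key: "n \<bullet> u \<noteq> 0 \<and> (v = u - (2 * (n \<bullet> u)) *\<^sub>R n \<or> v = - (u - (2 * (n \<bullet> u)) *\<^sub>R n))"
    proof (cases "\<exists>k. u = k *\<^sub>R n")
      case True
      then obtain k where k: "u = k *\<^sub>R n" by blast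
      then have "\<bar>k\<bar> = 1" using r(2) n by simp
      then have kk: "k * k = 1" by (metis abs_mult_self_eq mult_1)
      have "\<bar>v \<bullet> n\<bar> = 1" using r(9) k \<open>\<bar>k\<bar> = 1\<close> e1 by (simp add: n'e n0 abs_mult)
      then have vn: "(v \<bullet> n) * (v \<bullet> n) = 1" by (metis abs_mult_self_eq mult_1)
      then have "(v - (v \<bullet> n) *\<^sub>R n) \<bullet> (v - (v \<bullet> n) *\<^sub>R n) = 0"
        using r(3) by (simp add: inner_diff_left inner_diff_right n0 inner_commute norm_eq_1)
      then have "v = (v \<bullet> n) *\<^sub>R n" by simp
      moreover have "v \<bullet> n = k \<or> v \<bullet> n = - k" using vn kk by algebra
      ultimately have "v = u \<or> v = - u" using k by (metis scaleR_minus_left)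
      moreover have "u - (2 * (n \<bullet> u)) *\<^sub>R n = - u"
      proof -
        have "u - (2 * (n \<bullet> u)) *\<^sub>R n = (k - 2 * k) *\<^sub>R n"
          unfolding k scaleR_left_diff_distrib by (simp add: n0)
        then show ?thesis by (simp add: k)
      qed
      moreover have "n \<bullet> u \<noteq> 0" using k n0 kk by auto
      ultimately show ?thesis by auto
    next
      case False
      have "v \<in> span {n, u}"
        using coplanar_directions[of "l \<union> m \<union> line_through p n'" p u v n] r(8) ln mem n0(1) False by auto
      then have D: "v = u \<or> v = - u \<or> v = u - (2 * (n \<bullet> u)) *\<^sub>R n \<or> v = - (u - (2 * (n \<bullet> u)) *\<^sub>R n)"
        using False r(2,3,9) n e1 by (intro reflected_unit_vector) (auto simp: n'e abs_mult)
      have "l \<noteq> m"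
      proof
        assume "l = m"
        then have "l = line_through p n" using r(10) ln by simp
        then have "p + u \<in> line_through p n" using mem(2) by simp
        then show False using False unfolding line_through_def by auto
      qed
      then have "v \<noteq> u" "v \<noteq> - u" using r(6,7) line_through_minus by metis+
      then have "v = u - (2 * (n \<bullet> u)) *\<^sub>R n \<or> v = - (u - (2 * (n \<bullet> u)) *\<^sub>R n)" using D by blast
      moreover then have "n \<bullet> u \<noteq> 0" using \<open>v \<noteq> u\<close> \<open>v \<noteq> - u\<close> by auto
      ultimately show ?thesis by blast
    qed
    have "span {(p, 1), (v, 0)} = span {(p, 1), (u - (2 * (n \<bullet> u)) *\<^sub>R n, 0)}"
      using key span_pair_uminus[of "(p, 1)" "(u - (2 * (n \<bullet> u)) *\<^sub>R n, 0)"] by auto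
    then have "proj_span m = reflect N ` proj_span l" unfolding L M H plane .
    moreover have "is_line m" using r(7) un unfolding is_line_def by blast
    moreover have "\<not> proj_span l \<subseteq> hyp N" unfolding L H trans using key by blast
    ultimately show "reflected_line N l m" by blast
  next
    assume R: "reflected_line N l m"
    obtain u where u: "norm u = 1" "l = line_through p u" using line_through_point[OF l] by metis
    have L: "proj_span l = span {(p, 1), (u, 0)}" unfolding u(2) by (rule proj_span_line_through)
    have nu: "n \<bullet> u \<noteq> 0" using R unfolding L H trans by blast
    define v where "v = u - (2 * (n \<bullet> u)) *\<^sub>R n"
    have uu: "u \<bullet> u = 1" using u(1) by (simp add: norm_eq_1)
    then have "v \<bullet> v = 1" by (simp add: v_def inner_diff_left inner_diff_right n0 inner_commute)
    then have v1: "norm v = 1" by (simp add: norm_eq_1)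
    then have "v \<noteq> 0" by auto
    then have lv: "is_line (line_through p v)" unfolding is_line_def by blast
    have m: "m = line_through p v"
      using R lv by (intro line_eqI) (simp_all add: proj_span_line_through L H plane v_def)
    have cop: "coplanar (l \<union> m \<union> line_through p n)"
    proof -
      have "p + t *\<^sub>R u \<in> affine hull {p, p + n, p + u}" for t
        unfolding affine_hull_3
        by (rule CollectI, rule exI[of _ "1 - t"], rule exI[of _ 0], rule exI[of _ t]) (simp add: algebra_simps)
      moreover have "p + t *\<^sub>R n \<in> affine hull {p, p + n, p + u}" for t
        unfolding affine_hull_3
        by (rule CollectI, rule exI[of _ "1 - t"], rule exI[of _ t], rule exI[of _ 0]) (simp add: algebra_simps)
      moreover have "p + t *\<^sub>R v \<in> affine hull {p, p + n, p + u}" for t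
        unfolding affine_hull_3 v_def
        by (rule CollectI, rule exI[of _ "1 - t + 2 * t * (n \<bullet> u)"], rule exI[of _ "- 2 * t * (n \<bullet> u)"], rule exI[of _ t])
          (simp add: algebra_simps)
      ultimately show ?thesis unfolding coplanar_def u(2) m line_through_def by blast
    qed
    have "l = line_through p n" if "l = m"
    proof -
      have "reflect N ` proj_span l = proj_span l" using R that by simp
      then have "centre N \<in> proj_span l"
        using reflect_invariant_imp_centre[OF is_line_plane(1)[OF l(1)] N(1)] R by blast
      then have "(fst N, 0) \<in> proj_span l"
        using \<open>fst N \<noteq> 0\<close> subspace_scale[OF is_line_plane(1)[OF l(1)], of "centre N" "fst N \<bullet> fst N"]
        by (simp add: centre_def)
      then have "(1 / k) *\<^sub>R (fst N, 0) \<in> proj_span l"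
        using subspace_scale[OF is_line_plane(1)[OF l(1)]] by blast
      then have nl: "(n, 0) \<in> proj_span l" using Nk by simp
      have ul: "(u, 0) \<in> proj_span l" unfolding L by (simp add: span_base)
      have "proj_span l = proj_span (line_through p n)"
      proof (rule plane_eqI[OF is_line_plane[OF l(1)] _ _ nl l(2)])
        show "subspace (proj_span (line_through p n))" "dim (proj_span (line_through p n)) = 2"
          "(n, 0) \<in> proj_span (line_through p n)" "(p, 1) \<in> proj_span (line_through p n)"
          using line_through_plane[OF n0(1), of p] by (simp_all add: proj_span_line_through span_base)
      qed (use n0 in \<open>simp_all add: zero_prod_def\<close>)
      moreover have "is_line (line_through p n)" using n0 unfolding is_line_def by blast
      ultimately show ?thesis using line_eqI[OF l(1)] by blast
    qed
    moreover have "\<bar>u \<bullet> n\<bar> = \<bar>v \<bullet> n\<bar>" by (simp add: v_def inner_diff_left n0 inner_commute[of n u])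
    ultimately show "reflection_law_finite (hyp N) p l m"
      unfolding reflection_law_finite_def H(1)
      using n u v1 np m cop by (intro exI[of _ n] exI[of _ c] exI[of _ u] exI[of _ v]) (auto simp: hyp_def)
  qed
qed

lemma reflection_law_inf_iff:
  assumes l: "is_line l" "(x, 0) \<in> proj_span l" "x \<noteq> 0" and N: "N \<noteq> 0" "N \<bullet> (x, 0) = 0"
  shows "reflection_law_inf (hyp N) l m \<longleftrightarrow>
     reflected_line N l m"
proof -
  have image: "reflection_image = m \<longleftrightarrow> is_line m \<and> proj_span m = reflect N ` proj_span l"
    if f: "proj_span reflection_image = reflect N ` proj_span l" "is_line reflection_image"
    for reflection_image
    using f line_eqI by metis
  have is_line_image: "is_line (f ` l)" if "f = (\<lambda>x. g x + b)" "linear g" "inj g" for f g b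
  proof -
    obtain p u where pu: "u \<noteq> 0" "l = line_through p u" using l(1) unfolding is_line_def by blast
    have "f ` l = line_through (f p) (g u)"
      unfolding pu(2) line_through_def image_image that(1)
      by (simp add: linear_add[OF that(2)] linear_scale[OF that(2)] algebra_simps)
    moreover have "g u \<noteq> 0" using pu(1) that by (metis injD linear_0)
    ultimately show ?thesis unfolding is_line_def by blast
  qed
  show ?thesis
  proof (cases "fst N = 0")
    case True
    then have s: "snd N \<noteq> 0" using N by (simp add: prod_eq_iff)
    have "N = snd N *\<^sub>R (0, 1)" using True by (simp add: prod_eq_iff)
    then have H: "hyp N = hyper_inf" using hyp_infinity hyp_scale s by metis
    have "proj_span (uminus ` l) = reflect N ` proj_span l"
      by (rule proj_span_image[where c = "- 1"]) (simp_all add: reflect_infinity True s)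
    moreover have "is_line (uminus ` l)"
      by (rule is_line_image[where g1 = uminus and b1 = 0])
        (simp_all add: linear_uminus fun_eq_iff)
    ultimately show ?thesis
      using image[of "uminus ` l"] line_not_at_infinity[OF l(1)] unfolding reflection_law_inf_def H by auto
  next
    case False
    then obtain n c k where n: "norm n = 1" and Nk: "N = k *\<^sub>R (n, - c)" "k \<noteq> 0" by (rule unit_normal)
    have H: "hyp N = hyp (n, - c)" "reflect N = reflect (n, - c)"
      unfolding Nk(1) using hyp_scale reflect_scale_normal Nk(2) by metis+
    have Hne: "hyp N \<noteq> hyper_inf"
    proof
      assume "hyp N = hyper_inf"
      then have "hyp (0, 1) = hyp N" using hyp_infinity by simp
      then obtain e where "N = e *\<^sub>R (0, 1)" using hyp_subset_hyp by blast
      then show False using False by simp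
    qed
    have image': "(\<lambda>x. x - (2 * (n \<bullet> x - c)) *\<^sub>R n) ` l = m \<longleftrightarrow>
        is_line m \<and> proj_span m = reflect (n, - c) ` proj_span l" if n: "norm n = 1" and N': "reflect N = reflect (n, - c)" for n c
    proof (rule image[unfolded N'])
      show "proj_span ((\<lambda>x. x - (2 * (n \<bullet> x - c)) *\<^sub>R n) ` l) = reflect (n, - c) ` proj_span l"
        by (rule proj_span_image[where c = 1]) (simp_all add: reflect_unit[OF n])
      have nn: "n \<bullet> n = 1" using n by (simp add: norm_eq_1)
      show "is_line ((\<lambda>x. x - (2 * (n \<bullet> x - c)) *\<^sub>R n) ` l)"
      proof (rule is_line_image)
        show "(\<lambda>x. x - (2 * (n \<bullet> x - c)) *\<^sub>R n) = (\<lambda>x. (x - (2 * (n \<bullet> x)) *\<^sub>R n) + (2 * c) *\<^sub>R n)"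
          by (simp add: fun_eq_iff algebra_simps)
        show "linear (\<lambda>x. x - (2 * (n \<bullet> x)) *\<^sub>R n)"
          by (intro linearI) (simp_all add: algebra_simps inner_add_right)
        show "inj (\<lambda>x. x - (2 * (n \<bullet> x)) *\<^sub>R n)"
          by (rule inj_on_inverseI[where g = "\<lambda>x. x - (2 * (n \<bullet> x)) *\<^sub>R n"])
            (simp add: inner_diff_right nn algebra_simps)
      qed
    qed
    \<comment> \<open>Normal incidence is impossible at infinity: the direction \<open>x\<close> of
      the line would be both parallel and orthogonal to the normal of \<open>N\<close>.\<close>
    have self: "l \<noteq> m" if "proj_span m = reflect N ` proj_span l" "\<not> proj_span l \<subseteq> hyp N"
    proof
      assume "l = m"
      then have "centre N \<in> proj_span l"
        using reflect_invariant_imp_centre[OF is_line_plane(1)[OF l(1)] N(1)] that by metis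
      then have c: "(fst N, 0) \<in> proj_span l"
        using False subspace_scale[OF is_line_plane(1)[OF l(1)], of "centre N" "fst N \<bullet> fst N"]
        by (simp add: centre_def)
      obtain e where "fst N = e *\<^sub>R x" using line_at_infinity[OF l c] by blast
      moreover have "fst N \<bullet> x = 0" using N(2) by (simp add: inner_prod_def)
      ultimately have "fst N \<bullet> fst N = 0" by simp
      then show False using False by simp
    qed
    have self': "\<not> proj_span l \<subseteq> hyp N" if "l \<noteq> m" "is_line m" "proj_span m = reflect N ` proj_span l"
    proof
      assume s: "proj_span l \<subseteq> hyp N"
      have "reflect N ` proj_span l = (\<lambda>v. v) ` proj_span l"
        by (rule image_cong) (use s in \<open>auto simp: hyp_def reflect_fixed\<close>)
      then show False using that line_eqI[OF l(1)] by simp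
    qed
    have "reflection_law_inf (hyp N) l m \<longleftrightarrow> l \<noteq> m \<and> (\<exists>n c. norm n = 1 \<and> hyp N = hyp (n, - c) \<and>
        (\<lambda>x. x - (2 * (n \<bullet> x - c)) *\<^sub>R n) ` l = m)"
      unfolding reflection_law_inf_def using Hne by (auto simp: hyp_def)
    also have "\<dots> \<longleftrightarrow> l \<noteq> m \<and> is_line m \<and> proj_span m = reflect N ` proj_span l"
    proof (intro conj_cong refl iffI)
      assume "\<exists>n c. norm n = 1 \<and> hyp N = hyp (n, - c) \<and> (\<lambda>x. x - (2 * (n \<bullet> x - c)) *\<^sub>R n) ` l = m"
      then obtain n' c' where n': "norm n' = 1" "hyp N = hyp (n', - c')"
        "(\<lambda>x. x - (2 * (n' \<bullet> x - c')) *\<^sub>R n') ` l = m" by blast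
      have "(n', - c') \<noteq> 0" using n'(1) by (auto simp: zero_prod_def)
      then have r: "reflect N = reflect (n', - c')" using mirror_hyp N(1) n'(2) by metis
      show "is_line m \<and> proj_span m = reflect N ` proj_span l"
        using image'[OF n'(1) r] n'(3) unfolding r by blast
    next
      assume "is_line m \<and> proj_span m = reflect N ` proj_span l"
      then have "(\<lambda>x. x - (2 * (n \<bullet> x - c)) *\<^sub>R n) ` l = m"
        using image'[OF n H(2)] unfolding H(2) by blast
      then show "\<exists>n c. norm n = 1 \<and> hyp N = hyp (n, - c) \<and> (\<lambda>x. x - (2 * (n \<bullet> x - c)) *\<^sub>R n) ` l = m"
        using n H(1) by blast
    qed
    also have "\<dots> \<longleftrightarrow> reflected_line N l m"
      using self self' by blast
    finally show ?thesis .
  qed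
qed

section \<open>Points of tangency and the curve\<close>

lemma qform_eq_inner: "qform a \<mu> P R = (\<chi> i. fst P $ i / (a $ i - \<mu>), - snd P) \<bullet> R"
  by (simp add: qform_def inner_prod_def inner_vec_def)

lemma tangent_at_nondegenerate:
  assumes "\<not> degenerate a q"
  shows "tangent_at a q P H \<longleftrightarrow> (\<exists>N. dual_tangent a q N \<and> pole a q N = P \<and> H = hyp N)"
proof (cases q)
  case (Conf \<mu>)
  then have nz: "a $ i \<noteq> \<mu>" for i using assms by (auto simp: degenerate_def)
  let ?N = "(\<chi> i. fst P $ i / (a $ i - \<mu>), - snd P)"
  have pole: "pole a q ?N = P" using nz by (simp add: Conf pole_def prod_eq_iff vec_eq_iff)
  have "tangent_at a q P H \<longleftrightarrow> P \<noteq> 0 \<and> ?N \<bullet> P = 0 \<and> H = hyp ?N"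
    using nz by (simp add: Conf qform_eq_inner hyp_def)
  also have "\<dots> \<longleftrightarrow> (\<exists>N. dual_tangent a q N \<and> pole a q N = P \<and> H = hyp N)"
  proof
    assume "P \<noteq> 0 \<and> ?N \<bullet> P = 0 \<and> H = hyp ?N"
    moreover then have "?N \<noteq> 0" using pole pole_zero[of a q] by metis
    ultimately have "dual_tangent a q ?N \<and> pole a q ?N = P \<and> H = hyp ?N"
      using pole assms unfolding dual_tangent_def by metis
    then show "\<exists>N. dual_tangent a q N \<and> pole a q N = P \<and> H = hyp N" by blast
  next
    assume "\<exists>N. dual_tangent a q N \<and> pole a q N = P \<and> H = hyp N"
    then obtain N where N: "dual_tangent a q N" "pole a q N = P" "H = hyp N" by blast
    have "pole a q (N - ?N) = 0" using N(2) pole by (simp add: pole_diff)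
    then have "N = ?N" using pole_eq_0_imp[OF assms] by fastforce
    moreover have "P \<noteq> 0" using N(1,2) pole_eq_0_imp[OF assms] dual_tangent_nonzero by metis
    ultimately show "P \<noteq> 0 \<and> ?N \<bullet> P = 0 \<and> H = hyp ?N" using N dual_tangent_pole_orth by metis
  qed
  finally show ?thesis .
qed (use assms in \<open>simp add: degenerate_def\<close>)

context confocal
begin

lemma tangent_at_degenerate:
  assumes "degenerate a q"
  shows "tangent_at a q P H \<longleftrightarrow> P \<noteq> 0 \<and> P \<in> H \<and> (\<exists>N. dual_tangent a q N \<and> H = hyp N)"
proof -
  have "\<exists>M. dual_tangent a q M \<and> (tangent_at a q P H \<longleftrightarrow> P \<noteq> 0 \<and> P \<in> H \<and> H = hyp M)"
  proof (cases q)
    case AtInfinity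
    have "dual_tangent a AtInfinity (0, 1)" by (simp add: dual_tangent_AtInfinity)
    moreover have "tangent_at a AtInfinity P H \<longleftrightarrow> P \<noteq> 0 \<and> P \<in> H \<and> H = hyp (0, 1)"
      by (simp add: hyp_infinity)
    ultimately show ?thesis unfolding AtInfinity by blast
  next
    case (Conf \<mu>)
    then obtain i where i: "\<mu> = a $ i" using assms by (auto simp: degenerate_def)
    have "hyp (axis i 1, 0) = coord_hyper i"
      by (simp add: hyp_def coord_hyper_def inner_prod_def inner_axis')
    moreover have "dual_tangent a (Conf \<mu>) (axis i 1, 0)"
    proof -
      have "pole a (Conf \<mu>) (axis i 1, 0) = 0"
        by (simp add: pole_def i prod_eq_iff vec_eq_iff axis_def)
      then show ?thesis by (simp add: dual_tangent_def zero_prod_def)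
    qed
    moreover have "tangent_at a (Conf \<mu>) P H \<longleftrightarrow> P \<noteq> 0 \<and> P \<in> H \<and> H = coord_hyper i"
      using inj_a by (auto simp: i inj_def)
    ultimately show ?thesis unfolding Conf by metis
  qed
  then show ?thesis using degenerate_unique[OF assms] by metis
qed

text \<open>Uniform in the member: on a proper quadric \<open>P\<close> is the pole of
  \<open>N\<close>, while for a degenerate member \<open>P\<close> is any point of the hyperplane
  and the pole is \<open>0\<close>.\<close>

lemma tangent_atD:
  assumes "tangent_at a q P H" "subspace L" "P \<in> L"
  obtains N where "dual_tangent a q N" "H = hyp N" "pole a q N \<in> L" "P \<noteq> 0" "N \<bullet> P = 0"
proof (cases "degenerate a q")
  case True
  then obtain N where N: "dual_tangent a q N" "H = hyp N" "P \<noteq> 0" "P \<in> H"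
    using assms(1) tangent_at_degenerate by metis
  have "pole a q N \<in> L" using N(1) True subspace_0[OF assms(2)] by (simp add: dual_tangent_def)
  moreover have "N \<bullet> P = 0" using N(2,4) by (simp add: hyp_def)
  ultimately show ?thesis using that N by blast
next
  case False
  then obtain N where N: "dual_tangent a q N" "pole a q N = P" "H = hyp N"
    using assms(1) tangent_at_nondegenerate by metis
  have "P \<noteq> 0" using N pole_eq_0_imp[OF False] dual_tangent_nonzero by metis
  then show ?thesis using that[OF N(1,3)] N(2) assms(3) dual_tangent_pole_orth[OF N(1)] by blast
qed

lemma reflectable_tangent_at:
  assumes "subspace L" "dim L = 2" "reflectable a q N L"
  shows "\<exists>P \<in> L. P \<noteq> 0 \<and> N \<bullet> P = 0 \<and> tangent_at a q P (hyp N)"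
proof (cases "degenerate a q")
  case True
  obtain w where w: "w \<in> L" "N \<bullet> w \<noteq> 0" using reflectableD(3)[OF assms(3)] unfolding hyp_def by blast
  have "\<not> L \<subseteq> span {w}"
    using dim_subset[of L "span {w}"] assms(2) by (auto split: if_splits)
  then obtain v where v: "v \<in> L" "v \<notin> span {w}" by blast
  \<comment> \<open>The intersection of \<open>L\<close> with the hyperplane: a second vector of
    \<open>L\<close>, corrected along \<open>w\<close>.\<close>
  define P where "P = v - ((N \<bullet> v) / (N \<bullet> w)) *\<^sub>R w"
  have "P \<in> L" using assms(1) v w by (simp add: P_def subspace_diff subspace_scale)
  moreover have "P \<noteq> 0"
  proof
    assume "P = 0"
    then have "v = ((N \<bullet> v) / (N \<bullet> w)) *\<^sub>R w" by (simp add: P_def)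
    then show False using v(2) span_singleton by blast
  qed
  moreover have "N \<bullet> P = 0" using w by (simp add: P_def inner_diff_right)
  moreover have "tangent_at a q P (hyp N)"
  proof -
    have "P \<in> hyp N" using \<open>N \<bullet> P = 0\<close> by (simp add: hyp_def)
    then show ?thesis
      unfolding tangent_at_degenerate[OF True]
      using \<open>P \<noteq> 0\<close> reflectableD(1)[OF assms(3)] by (intro conjI exI[of _ N] refl)
  qed
  ultimately show ?thesis by (intro bexI[of _ P] conjI)
next
  case False
  have "tangent_at a q (pole a q N) (hyp N)"
    using tangent_at_nondegenerate[OF False] reflectableD(1)[OF assms(3)] by blast
  moreover have "pole a q N \<noteq> 0"
    using pole_eq_0_imp[OF False, of N] dual_tangent_nonzero[OF reflectableD(1)[OF assms(3)]] by blast
  ultimately show ?thesis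
    using reflectableD(2)[OF assms(3)] dual_tangent_pole_orth[OF reflectableD(1)[OF assms(3)]]
    by (intro bexI[of _ "pole a q N"] conjI)
qed

lemma reflection_law_iff:
  assumes l: "is_line l" and P: "P \<in> proj_span l" "P \<noteq> 0" and N: "N \<noteq> 0" "N \<bullet> P = 0"
  shows "(if snd P \<noteq> 0 then reflection_law_finite (hyp N) (fst P /\<^sub>R snd P) l m
           else reflection_law_inf (hyp N) l m) \<longleftrightarrow>
     reflected_line N l m"
proof (cases "snd P = 0")
  case True
  then have "(fst P, 0) = P" by (simp add: prod_eq_iff)
  moreover from this have "fst P \<noteq> 0" using P(2) by (auto simp: prod_eq_iff)
  ultimately show ?thesis using reflection_law_inf_iff[OF l, of "fst P" N m] P N True by simp
next
  case False
  have e: "inverse (snd P) *\<^sub>R P = (fst P /\<^sub>R snd P, 1)" using False by (simp add: prod_eq_iff)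
  have "(fst P /\<^sub>R snd P, 1) \<in> proj_span l"
    using subspace_scale[OF is_line_plane(1)[OF l] P(1), of "inverse (snd P)"] unfolding e .
  moreover have "N \<bullet> (fst P /\<^sub>R snd P, 1) = 0" unfolding e[symmetric] using N(2) by simp
  ultimately show ?thesis using reflection_law_finite_iff[OF l _ N(1)] False by simp
qed

text \<open>Interface to the geometry: the point of reflection is eliminated, and trajectories can
  be studied through \<open>fiber\<close> and \<open>mirror\<close> alone.\<close>

lemma reflects_iff:
  assumes l: "is_line l"
  shows "(\<exists>P. reflects a q P H l m) \<longleftrightarrow>
     H \<in> fiber a q (proj_span l) \<and> is_line m \<and> proj_span m = mirror H ` proj_span l"
proof
  assume "\<exists>P. reflects a q P H l m"
  then obtain P where P: "tangent_at a q P H" "P \<in> proj_span l"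
    "if snd P \<noteq> 0 then reflection_law_finite H (fst P /\<^sub>R snd P) l m else reflection_law_inf H l m"
    unfolding reflects_def proj_points_def by blast
  obtain N where N: "dual_tangent a q N" "H = hyp N" "pole a q N \<in> proj_span l" "P \<noteq> 0" "N \<bullet> P = 0"
    using tangent_atD[OF P(1) is_line_plane(1)[OF l] P(2)] by metis
  have N0: "N \<noteq> 0" using N(1) by (rule dual_tangent_nonzero)
  have R: "reflected_line N l m"
    using P(3) unfolding N(2) reflection_law_iff[OF l P(2) N(4) N0 N(5)] .
  then have "reflectable a q N (proj_span l)" using N unfolding reflectable_def by blast
  then show "H \<in> fiber a q (proj_span l) \<and> is_line m \<and> proj_span m = mirror H ` proj_span l"
    using R N(2) mirror_hyp[OF N0] hyp_in_fiber by metis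
next
  assume R: "H \<in> fiber a q (proj_span l) \<and> is_line m \<and> proj_span m = mirror H ` proj_span l"
  then obtain N where N: "H = hyp N" "N \<noteq> 0" "reflectable a q N (proj_span l)" "mirror H = reflect N"
    by (metis fiberE)
  obtain P where P: "P \<in> proj_span l" "P \<noteq> 0" "N \<bullet> P = 0" "tangent_at a q P (hyp N)"
    using reflectable_tangent_at[OF is_line_plane[OF l] N(3)] by blast
  have "P \<in> proj_span m" using R N(4) P(1) reflect_fixed[OF P(3)] by (metis image_eqI)
  moreover have "reflected_line N l m"
    using R N(4) reflectableD(3)[OF N(3)] by simp
  ultimately have "reflects a q P H l m"
    using reflection_law_iff[OF l P(1,2) N(2) P(3)] P unfolding reflects_def proj_points_def N(1) by simp
  then show "\<exists>P. reflects a q P H l m" by blast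
qed

text \<open>
  Chasles' theorem: the normals of tangent hyperplanes to different quadrics along a common tangent
  line are orthogonal to each other and to the line.
\<close>

lemma card_tangent_members:
  assumes l: "is_line l" and T: "finite T" "\<And>\<alpha>. \<alpha> \<in> T \<Longrightarrow> tangent_to a (Conf \<alpha>) (proj_span l)"
  shows "card T < CARD('n)"
proof -
  have "\<forall>\<alpha>\<in>T. \<exists>N. dual_tangent a (Conf \<alpha>) N \<and> pole a (Conf \<alpha>) N \<in> proj_span l \<and> proj_span l \<subseteq> hyp N"
    using T(2) unfolding tangent_to_def by blast
  then obtain N where N: "\<And>\<alpha>. \<alpha> \<in> T \<Longrightarrow> dual_tangent a (Conf \<alpha>) (N \<alpha>)"
    "\<And>\<alpha>. \<alpha> \<in> T \<Longrightarrow> pole a (Conf \<alpha>) (N \<alpha>) \<in> proj_span l" "\<And>\<alpha>. \<alpha> \<in> T \<Longrightarrow> proj_span l \<subseteq> hyp (N \<alpha>)"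
    by metis
  define n where "n \<alpha> = fst (N \<alpha>)" for \<alpha>
  have n0: "n \<alpha> \<noteq> 0" if "\<alpha> \<in> T" for \<alpha> unfolding n_def using dual_tangent_Conf_fst N(1)[OF that] by blast
  have orth: "n \<alpha> \<bullet> n \<beta> = 0" if "\<alpha> \<in> T" "\<beta> \<in> T" "\<alpha> \<noteq> \<beta>" for \<alpha> \<beta>
  proof -
    \<comment> \<open>Each pole lies on the line and hence in the other hyperplane. The difference
      of the two forms leaves a nonzero multiple of the inner product of the normals.\<close>
    have "N \<alpha> \<bullet> pole a (Conf \<beta>) (N \<beta>) = 0" "N \<beta> \<bullet> pole a (Conf \<alpha>) (N \<alpha>) = 0"
      using N(2,3) that unfolding hyp_def by blast+
    then show ?thesis
      using inner_pole_Conf[of "N \<alpha>" a \<beta> "N \<beta>" \<alpha>] inner_pole_commute[of "N \<alpha>" a "Conf \<alpha>" "N \<beta>"] that(3)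
      by (simp add: n_def)
  qed
  obtain p u where u: "u \<noteq> 0" "proj_span l = span {(p, 1), (u, 0)}" using l by (rule is_lineE)
  have nu: "n \<alpha> \<bullet> u = 0" if "\<alpha> \<in> T" for \<alpha>
  proof -
    have "(u, 0) \<in> hyp (N \<alpha>)" using N(3)[OF that] unfolding u(2) by (auto simp: span_base)
    then show ?thesis by (simp add: hyp_def inner_prod_def n_def)
  qed
  \<comment> \<open>The direction of the line is one more orthogonal vector, whence the strict
    bound.\<close>
  have "pairwise orthogonal (insert u (n ` T))"
    using orth nu by (auto simp: pairwise_def orthogonal_def inner_commute)
  moreover have "0 \<notin> insert u (n ` T)" using u(1) n0 by auto
  ultimately have "independent (insert u (n ` T))" by (rule pairwise_orthogonal_independent)
  then have "card (insert u (n ` T)) \<le> CARD('n)" using independent_bound by fastforce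
  moreover have "u \<notin> n ` T"
  proof
    assume "u \<in> n ` T"
    then obtain \<alpha> where "\<alpha> \<in> T" "u = n \<alpha>" by blast
    then have "u \<bullet> u = 0" using nu by simp
    then show False using u(1) by simp
  qed
  moreover have "inj_on n T"
  proof (rule inj_onI, rule ccontr)
    fix \<alpha> \<beta> assume "\<alpha> \<in> T" "\<beta> \<in> T" "n \<alpha> = n \<beta>" "\<alpha> \<noteq> \<beta>"
    then show False using orth n0 by (metis inner_eq_zero_iff)
  qed
  ultimately show ?thesis using T(1) by (simp add: card_image)
qed

lemma line_tangent_iff:
  assumes "is_line l" "\<alpha> \<notin> range (\<lambda>i. a $ i)"
  shows "line_tangent a \<alpha> l \<longleftrightarrow> tangent_to a (Conf \<alpha>) (proj_span l)"
proof -
  have nd: "\<not> degenerate a (Conf \<alpha>)" using assms(2) by (auto simp: degenerate_def)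
  have "pole a (Conf \<alpha>) N \<noteq> 0" if "dual_tangent a (Conf \<alpha>) N" for N
    using that pole_eq_0_imp[OF nd] dual_tangent_nonzero by metis
  then show ?thesis
    unfolding line_tangent_def tangent_to_def proj_points_def tangent_at_nondegenerate[OF nd] by blast
qed

end

section \<open>Common tangents of the caustics\<close>

locale caustics = confocal a for a :: "real^'n::finite" +
  fixes S :: "real set"
  assumes finite_S: "finite S" and card_S: "card S = CARD('n) - 1"
    and S_disjoint: "S \<inter> range (\<lambda>i. a $ i) = {}"
begin

lemma common_tangents_iff:
  "l \<in> common_tangents a S \<longleftrightarrow> is_line l \<and> (\<forall>\<alpha>\<in>S. tangent_to a (Conf \<alpha>) (proj_span l))"
  unfolding common_tangents_def using line_tangent_iff S_disjoint by blast

text \<open>The \<open>CARD('n) - 1\<close> caustics exhaust the bound of Chasles' theorem.\<close>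

lemma tangent_member_is_caustic:
  assumes l: "l \<in> common_tangents a S" and "tangent_to a (Conf \<mu>) (proj_span l)"
  shows "\<mu> \<in> S"
proof (rule ccontr)
  assume "\<mu> \<notin> S"
  then have "card (insert \<mu> S) = CARD('n)" using finite_S card_S card_ge_2 by simp
  moreover have "card (insert \<mu> S) < CARD('n)"
    using card_tangent_members[of l "insert \<mu> S"] assms common_tangents_iff finite_S by blast
  ultimately show False by simp
qed

text \<open>A line inside a coordinate hyperplane would touch the member
  \<open>Conf (a $ i)\<close>, whose parameter is not in \<open>S\<close>: one tangency too
  many.\<close>

lemma regular_common_tangent:
  assumes l: "l \<in> common_tangents a S"
  shows "regular a (proj_span l)"
proof -
  have "is_line l" using l common_tangents_iff by blast
  moreover have "\<not> tangent_to a q (proj_span l)" if q: "degenerate a q" for q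
  proof
    assume t: "tangent_to a q (proj_span l)"
    show False
    proof (cases q)
      case (Conf \<mu>)
      then have "\<mu> \<in> range (\<lambda>i. a $ i)" using q by (auto simp: degenerate_def)
      then show False using tangent_member_is_caustic[OF l] t S_disjoint unfolding Conf by blast
    next
      case AtInfinity
      obtain N where N: "dual_tangent a q N" "proj_span l \<subseteq> hyp N" using t unfolding tangent_to_def by blast
      have "dual_tangent a q (0, 1)" by (simp add: AtInfinity dual_tangent_AtInfinity)
      then have "hyp N = hyper_inf" using degenerate_unique[OF q N(1)] hyp_infinity by metis
      then show False using N(2) line_not_at_infinity[OF \<open>is_line l\<close>] by simp
    qed
  qed
  ultimately show ?thesis unfolding regular_def using is_line_plane by blast
qed

lemma common_tangents_reflect:
  assumes l: "l \<in> common_tangents a S" and H: "H \<in> mirrors a (proj_span l)"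
    and m: "is_line m" "proj_span m = mirror H ` proj_span l"
  shows "m \<in> common_tangents a S"
proof -
  obtain q where "H \<in> fiber a q (proj_span l)" using H by (rule mirrorsE)
  then obtain N where N: "reflectable a q N (proj_span l)" "mirror H = reflect N" by (rule fiberE)
  note R = regularD[OF regular_common_tangent[OF l]]
  show ?thesis using tangent_to_reflect[OF R N(1)] l m N(2) unfolding common_tangents_iff by simp
qed

text \<open>A point of the curve fails to be a mirror only if it contains the line; then the line
  touches its member, which is proper by regularity and therefore a caustic.\<close>

lemma mirrors_eq_curve:
  assumes l: "l \<in> common_tangents a S"
  shows "mirrors a (proj_span l) = cayley_curve a l - caustic_points a S l"
proof (intro set_eqI iffI)
  note reg = regular_common_tangent[OF l]
  note R = regularD[OF reg]
  fix H
  show "H \<in> cayley_curve a l - caustic_points a S l" if mirror: "H \<in> mirrors a (proj_span l)"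
  proof -
    obtain q where "H \<in> fiber a q (proj_span l)" using mirror by (rule mirrorsE)
    then obtain N where N: "H = hyp N" "reflectable a q N (proj_span l)" by (rule fiberE)
    obtain P where "P \<in> proj_points l" "tangent_at a q P H"
      using reflectable_tangent_at[OF R N(2)] unfolding N(1) proj_points_def by blast
    then show ?thesis
      using reflectableD(3)[OF N(2)] N(1) unfolding cayley_curve_def caustic_points_def by blast
  qed
  assume H: "H \<in> cayley_curve a l - caustic_points a S l"
  then obtain q P where P: "P \<in> proj_points l" "tangent_at a q P H" unfolding cayley_curve_def by blast
  then have "P \<in> proj_span l" unfolding proj_points_def by blast
  then obtain N where N: "dual_tangent a q N" "H = hyp N" "pole a q N \<in> proj_span l"
    using tangent_atD[OF P(2) R(1)] by metis
  have "\<not> proj_span l \<subseteq> H"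
  proof
    assume s: "proj_span l \<subseteq> H"
    then have t: "tangent_to a q (proj_span l)" using N unfolding tangent_to_def by blast
    then have "\<not> degenerate a q" using reg unfolding regular_def by blast
    then obtain \<mu> where "q = Conf \<mu>" by (cases q) (auto simp: degenerate_def)
    then show False using tangent_member_is_caustic[OF l] t s H P unfolding caustic_points_def by blast
  qed
  then have "reflectable a q N (proj_span l)" using N unfolding reflectable_def by blast
  then show "H \<in> mirrors a (proj_span l)" using hyp_in_fiber fiber_subset_mirrors N(2) by metis
qed

end

section \<open>Trajectories and divisors\<close>

text \<open>A trajectory is determined by its mirrors; this restores the lines.\<close>

primrec trajectory_of :: "('n::finite) hvec set \<Rightarrow> 'n hyperpl list \<Rightarrow> 'n trajectory" where
  "trajectory_of L [] = []"
| "trajectory_of L (H # hs) = (H, line_of (mirror H ` L)) # trajectory_of (mirror H ` L) hs"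

lemma trajectory_of_append:
  "trajectory_of L (xs @ ys) = trajectory_of L xs @ trajectory_of (path_end L xs) ys"
  by (induction xs arbitrary: L) auto

lemma mirror_path_appendD: "mirror_path a L (xs @ ys) \<Longrightarrow> mirror_path a L xs"
  by (induction xs arbitrary: L) auto

lemma map_fst_trajectory_of: "map fst (trajectory_of L hs) = hs"
  by (induction hs arbitrary: L) auto

context caustics
begin

lemma line_of_mirror:
  assumes l: "l \<in> common_tangents a S" and H: "H \<in> mirrors a (proj_span l)"
  shows "is_line (line_of (mirror H ` proj_span l))"
    and "proj_span (line_of (mirror H ` proj_span l)) = mirror H ` proj_span l"
    and "line_of (mirror H ` proj_span l) \<in> common_tangents a S"
proof -
  have R: "regular a (mirror H ` proj_span l)" using regular_mirrors[OF regular_common_tangent[OF l] H] .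
  have "\<not> mirror H ` proj_span l \<subseteq> hyp (0, 1)"
    by (rule not_subset_degenerate[OF R, of AtInfinity]) (simp_all add: degenerate_def pole_def zero_prod_def)
  then have "\<not> mirror H ` proj_span l \<subseteq> hyper_inf" unfolding hyp_infinity .
  from line_of_plane[OF regularD[OF R] this]
  show m: "is_line (line_of (mirror H ` proj_span l))"
    "proj_span (line_of (mirror H ` proj_span l)) = mirror H ` proj_span l" .
  show "line_of (mirror H ` proj_span l) \<in> common_tangents a S"
    using common_tangents_reflect[OF l H m] .
qed

lemma exists_reflects_iff:
  assumes l: "l \<in> common_tangents a S"
  shows "(\<exists>q P. reflects a q P H l m) \<longleftrightarrow>
    H \<in> mirrors a (proj_span l) \<and> m = line_of (mirror H ` proj_span l)"
proof -
  have il: "is_line l" using l common_tangents_iff by blast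
  show ?thesis
  proof
    assume "\<exists>q P. reflects a q P H l m"
    then obtain q where q: "\<exists>P. reflects a q P H l m" by blast
    then have m: "H \<in> fiber a q (proj_span l)" "is_line m" "proj_span m = mirror H ` proj_span l"
      unfolding reflects_iff[OF il] by blast+
    then show "H \<in> mirrors a (proj_span l) \<and> m = line_of (mirror H ` proj_span l)"
      using line_of_proj_span[OF m(2)] fiber_subset_mirrors[OF m(1)] by simp
  next
    assume R: "H \<in> mirrors a (proj_span l) \<and> m = line_of (mirror H ` proj_span l)"
    then have H: "H \<in> mirrors a (proj_span l)" and m: "m = line_of (mirror H ` proj_span l)" by blast+
    obtain q where "H \<in> fiber a q (proj_span l)" using H by (rule mirrorsE)
    then have "\<exists>P. reflects a q P H l m"
      unfolding reflects_iff[OF il] m using line_of_mirror(1,2)[OF l H] by blast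
    then show "\<exists>q P. reflects a q P H l m" by blast
  qed
qed

lemma is_trajectory_iff:
  "is_trajectory a S l t \<longleftrightarrow> l \<in> common_tangents a S \<and> mirror_path a (proj_span l) (map fst t) \<and>
     t = trajectory_of (proj_span l) (map fst t)"
proof (induction t arbitrary: l)
  case (Cons s t)
  obtain H m where s: "s = (H, m)" by (cases s)
  show ?case
  proof (cases "l \<in> common_tangents a S \<and> H \<in> mirrors a (proj_span l) \<and> m = line_of (mirror H ` proj_span l)")
    case True
    then have l: "l \<in> common_tangents a S" and H: "H \<in> mirrors a (proj_span l)"
      and m: "m = line_of (mirror H ` proj_span l)" by blast+
    have pm: "proj_span m = mirror H ` proj_span l" "m \<in> common_tangents a S"
      using line_of_mirror(2,3)[OF l H] m by simp_all
    have "is_trajectory a S l (s # t) \<longleftrightarrow> is_trajectory a S m t"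
      using exists_reflects_iff[OF l, of H m] l H m by (simp add: s)
    also have "\<dots> \<longleftrightarrow> mirror_path a (mirror H ` proj_span l) (map fst t) \<and>
        t = trajectory_of (mirror H ` proj_span l) (map fst t)"
      unfolding Cons.IH pm(1) using pm(2) by simp
    also have "\<dots> \<longleftrightarrow> l \<in> common_tangents a S \<and> mirror_path a (proj_span l) (map fst (s # t)) \<and>
        s # t = trajectory_of (proj_span l) (map fst (s # t))"
      using l H m by (simp add: s)
    finally show ?thesis .
  next
    case False
    then show ?thesis using exists_reflects_iff[of l H m] by (auto simp: s)
  qed
qed simp

lemma DRC_iff:
  assumes l: "l \<in> common_tangents a S"
  defines "L \<equiv> proj_span l"
  shows "DRC a l H l\<^sub>1 K l\<^sub>2 K' l\<^sub>1' H' \<longleftrightarrow> double_reflection a L H K K' H' \<and>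
    l\<^sub>1 = line_of (mirror H ` L) \<and> l\<^sub>2 = line_of (mirror K ` mirror H ` L) \<and> l\<^sub>1' = line_of (mirror K' ` L)"
proof -
  have il: "is_line l" using l common_tangents_iff by blast
  define dim_cond where "dim_cond p \<longleftrightarrow> dim (H \<inter> K \<inter> K' \<inter> H') = CARD('n) - 1 \<or>
      H = K \<and> K = K' \<and> K' = H' \<and> degenerate a p" for p
  have D: "DRC a l H l\<^sub>1 K l\<^sub>2 K' l\<^sub>1' H' \<longleftrightarrow> (\<exists>p q. (\<exists>P. reflects a p P H l l\<^sub>1) \<and> (\<exists>P. reflects a q P K l\<^sub>1 l\<^sub>2) \<and>
      (\<exists>P. reflects a q P K' l l\<^sub>1') \<and> (\<exists>P. reflects a p P H' l\<^sub>1' l\<^sub>2) \<and> dim_cond p)"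
    unfolding DRC_def dim_cond_def by blast
  show ?thesis
  proof
    assume "DRC a l H l\<^sub>1 K l\<^sub>2 K' l\<^sub>1' H'"
    then obtain p q where r: "\<exists>P. reflects a p P H l l\<^sub>1" "\<exists>P. reflects a q P K l\<^sub>1 l\<^sub>2"
      "\<exists>P. reflects a q P K' l l\<^sub>1'" "\<exists>P. reflects a p P H' l\<^sub>1' l\<^sub>2" "dim_cond p"
      unfolding D by blast
    have 1: "H \<in> fiber a p L" "is_line l\<^sub>1" "proj_span l\<^sub>1 = mirror H ` L"
      using r(1) unfolding reflects_iff[OF il] L_def by blast+
    have 2: "K' \<in> fiber a q L" "is_line l\<^sub>1'" "proj_span l\<^sub>1' = mirror K' ` L"
      using r(3) unfolding reflects_iff[OF il] L_def by blast+
    have 3: "K \<in> fiber a q (mirror H ` L)" "is_line l\<^sub>2" "proj_span l\<^sub>2 = mirror K ` mirror H ` L"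
      using r(2) unfolding reflects_iff[OF 1(2)] 1(3) by blast+
    have 4: "H' \<in> fiber a p (mirror K' ` L)" "proj_span l\<^sub>2 = mirror H' ` mirror K' ` L"
      using r(4) unfolding reflects_iff[OF 2(2)] 2(3) by blast+
    have "mirror H' ` mirror K' ` L = mirror K ` mirror H ` L" using 3(3) 4(2) by simp
    then have "double_reflection a L H K K' H'"
      unfolding double_reflection_def using 1 2 3 4 r(5)[unfolded dim_cond_def] by blast
    then show "double_reflection a L H K K' H' \<and> l\<^sub>1 = line_of (mirror H ` L) \<and>
        l\<^sub>2 = line_of (mirror K ` mirror H ` L) \<and> l\<^sub>1' = line_of (mirror K' ` L)"
      using line_of_proj_span 1 2 3 by metis
  next
    assume R: "double_reflection a L H K K' H' \<and> l\<^sub>1 = line_of (mirror H ` L) \<and>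
        l\<^sub>2 = line_of (mirror K ` mirror H ` L) \<and> l\<^sub>1' = line_of (mirror K' ` L)"
    then obtain p q where d: "H \<in> fiber a p L" "K \<in> fiber a q (mirror H ` L)" "K' \<in> fiber a q L"
      "H' \<in> fiber a p (mirror K' ` L)" "mirror H' ` mirror K' ` L = mirror K ` mirror H ` L" "dim_cond p"
      unfolding double_reflection_def dim_cond_def by blast
    have l1: "is_line l\<^sub>1" "proj_span l\<^sub>1 = mirror H ` L" "l\<^sub>1 \<in> common_tangents a S"
      using line_of_mirror[OF l] fiber_subset_mirrors[OF d(1)] R unfolding L_def by simp_all
    have l1': "is_line l\<^sub>1'" "proj_span l\<^sub>1' = mirror K' ` L"
      using line_of_mirror[OF l] fiber_subset_mirrors[OF d(3)] R unfolding L_def by simp_all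
    have "K \<in> mirrors a (proj_span l\<^sub>1)" unfolding l1(2) using fiber_subset_mirrors[OF d(2)] .
    from line_of_mirror(1,2)[OF l1(3) this]
    have l2: "is_line l\<^sub>2" "proj_span l\<^sub>2 = mirror K ` mirror H ` L" using R unfolding l1(2) by simp_all
    have "\<exists>P. reflects a p P H l l\<^sub>1" unfolding reflects_iff[OF il] using d(1) l1 L_def by blast
    moreover have "\<exists>P. reflects a q P K l\<^sub>1 l\<^sub>2" unfolding reflects_iff[OF l1(1)] l1(2) using d(2) l2 by blast
    moreover have "\<exists>P. reflects a q P K' l l\<^sub>1'" unfolding reflects_iff[OF il] using d(3) l1' L_def by blast
    moreover have "\<exists>P. reflects a p P H' l\<^sub>1' l\<^sub>2"
      unfolding reflects_iff[OF l1'(1)] l1'(2) d(5) using d(4) l2 by blast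
    ultimately show "DRC a l H l\<^sub>1 K l\<^sub>2 K' l\<^sub>1' H'" unfolding D using d(6) by blast
  qed
qed

lemma complete_eq:
  assumes l: "l \<in> common_tangents a S"
  defines "L \<equiv> proj_span l"
  assumes H: "H \<in> mirrors a L" and K: "K \<in> mirrors a (mirror H ` L)"
  shows "complete a l H (line_of (mirror H ` L)) (K, line_of (mirror K ` mirror H ` L)) =
    (transfer a L H K, line_of (mirror (transfer a L H K) ` L))"
proof -
  have R: "regular a L" unfolding L_def using regular_common_tangent[OF l] .
  have D: "(\<exists>H'. DRC a l H (line_of (mirror H ` L)) K (line_of (mirror K ` mirror H ` L)) J j H') \<longleftrightarrow>
      (\<exists>H'. double_reflection a L H K J H') \<and> j = line_of (mirror J ` L)" for J j
    unfolding DRC_iff[OF l] L_def by blast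
  obtain p where p: "H \<in> fiber a p L" using H by (rule mirrorsE)
  obtain q where q: "K \<in> fiber a q (mirror H ` L)" using K by (rule mirrorsE)
  have ex: "\<exists>H'. double_reflection a L H K (transfer a L H K) H'"
    using transfer_double_reflection[OF R p q] .
  show ?thesis
    unfolding complete_def fst_conv snd_conv D
  proof (rule the_equality)
    show "(\<exists>H'. double_reflection a L H K (fst (transfer a L H K, line_of (mirror (transfer a L H K) ` L))) H') \<and>
        snd (transfer a L H K, line_of (mirror (transfer a L H K) ` L)) =
        line_of (mirror (fst (transfer a L H K, line_of (mirror (transfer a L H K) ` L))) ` L)"
      unfolding fst_conv snd_conv using ex by blast
    fix y assume y: "(\<exists>H'. double_reflection a L H K (fst y) H') \<and> snd y = line_of (mirror (fst y) ` L)"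
    then have "fst y = transfer a L H K" using transfer_eq[OF R] by metis
    then show "y = (transfer a L H K, line_of (mirror (transfer a L H K) ` L))"
      using y by (simp add: prod_eq_iff)
  qed
qed

lemma lines_meeting_eq:
  "is_trajectory a S l t \<Longrightarrow> lines_meeting a l t =
     map (\<lambda>H. (H, line_of (mirror H ` proj_span l))) (transport a (proj_span l) (map fst t))"
proof (induction t arbitrary: l)
  case (Cons s t)
  obtain H m where s: "s = (H, m)" by (cases s)
  have l: "l \<in> common_tangents a S" and t: "is_trajectory a S m t"
    and r: "H \<in> mirrors a (proj_span l) \<and> m = line_of (mirror H ` proj_span l)"
    using Cons.prems exists_reflects_iff[of l H m] by (simp_all add: s)
  define L where "L = proj_span l"
  have H: "H \<in> mirrors a L" and m: "m = line_of (mirror H ` L)" using r by (simp_all add: L_def)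
  have pm: "proj_span m = mirror H ` L" using line_of_mirror(2)[OF l] H m unfolding L_def by simp
  have R: "regular a (mirror H ` L)" using regular_mirrors[OF regular_common_tangent[OF l]] H unfolding L_def by simp
  have "mirror_path a (mirror H ` L) (map fst t)" using t unfolding is_trajectory_iff pm by blast
  note C = set_transport[OF R this]
  have "map (complete a l H m) (lines_meeting a m t) =
      map (\<lambda>K. complete a l H m (K, line_of (mirror K ` mirror H ` L))) (transport a (mirror H ` L) (map fst t))"
    unfolding Cons.IH[OF t] pm by simp
  also have "\<dots> = map (\<lambda>K. (transfer a L H K, line_of (mirror (transfer a L H K) ` L)))
      (transport a (mirror H ` L) (map fst t))"
    by (rule map_cong[OF refl]) (use complete_eq[OF l, folded L_def, OF H] C m in blast)
  finally show ?case using m by (simp add: s L_def)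
qed simp

lemma D_map_eq: "is_trajectory a S l t \<Longrightarrow> D_map a l t = transport a (proj_span l) (map fst t)"
  unfolding D_map_def lines_meeting_eq by (simp add: comp_def)

lemma final_line_trajectory_of:
  "l \<in> common_tangents a S \<Longrightarrow> mirror_path a (proj_span l) hs \<Longrightarrow>
     final_line l (trajectory_of (proj_span l) hs) \<in> common_tangents a S \<and>
     proj_span (final_line l (trajectory_of (proj_span l) hs)) = path_end (proj_span l) hs"
proof (induction hs arbitrary: l)
  case Nil
  then show ?case by (simp add: final_line_def)
next
  case (Cons H hs)
  then have l: "l \<in> common_tangents a S" and H: "H \<in> mirrors a (proj_span l)"
    and p: "mirror_path a (mirror H ` proj_span l) hs" by auto
  let ?m = "line_of (mirror H ` proj_span l)"
  note m = line_of_mirror(2,3)[OF l H]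
  have "final_line l (trajectory_of (proj_span l) (H # hs)) = final_line ?m (trajectory_of (mirror H ` proj_span l) hs)"
    by (simp add: final_line_def)
  then show ?case using Cons.IH[OF m(2)] p unfolding m(1) by simp
qed

end

section \<open>Classes of trajectories and their divisors\<close>

locale billiard = caustics a S for a :: "real^'n::finite" and S +
  fixes l\<^sub>0 :: "'n line"
  assumes l0: "l\<^sub>0 \<in> common_tangents a S"
begin

abbreviation "L0 \<equiv> proj_span l\<^sub>0"

lemma regular_L0: "regular a L0"
  using regular_common_tangent[OF l0] .

lemma TB_iff: "t \<in> TB a S l\<^sub>0 \<longleftrightarrow> mirror_path a L0 (map fst t) \<and> t = trajectory_of L0 (map fst t)"
  unfolding TB_def using is_trajectory_iff l0 by blast

lemma trajectory_of_TB: "mirror_path a L0 hs \<Longrightarrow> trajectory_of L0 hs \<in> TB a S l\<^sub>0"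
  unfolding TB_iff map_fst_trajectory_of by blast

lemma D_map_transport: "t \<in> TB a S l\<^sub>0 \<Longrightarrow> D_map a l\<^sub>0 t = transport a L0 (map fst t)"
  using D_map_eq unfolding TB_def by blast

lemma double_reflection_move_iff:
  "(s, t) \<in> double_reflection_move a S l\<^sub>0 \<longleftrightarrow>
     s \<in> TB a S l\<^sub>0 \<and> t \<in> TB a S l\<^sub>0 \<and> (map fst s, map fst t) \<in> path_moves a L0"
proof
  assume "(s, t) \<in> double_reflection_move a S l\<^sub>0"
  then obtain xs ys H l K m K' l' H' where st: "s \<in> TB a S l\<^sub>0" "t \<in> TB a S l\<^sub>0"
    "s = xs @ [(H, l), (K, m)] @ ys" "t = xs @ [(K', l'), (H', m)] @ ys"
    and D: "DRC a (final_line l\<^sub>0 xs) H l K m K' l' H'"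
    unfolding double_reflection_move_def by blast
  have p: "mirror_path a L0 (map fst s)" "mirror_path a L0 (map fst t)" and s: "s = trajectory_of L0 (map fst s)"
    using st(1,2) TB_iff by blast+
  have "xs @ [(H, l), (K, m)] @ ys = trajectory_of L0 (map fst xs) @ trajectory_of (path_end L0 (map fst xs)) (map fst ([(H, l), (K, m)] @ ys))"
    using s unfolding st(3) map_append trajectory_of_append .
  moreover have "length xs = length (trajectory_of L0 (map fst xs))"
    using arg_cong[OF map_fst_trajectory_of, of length L0 "map fst xs"] by simp
  ultimately have xs: "xs = trajectory_of L0 (map fst xs)" using append_eq_append_conv by blast
  have "mirror_path a L0 (map fst xs)" using p(1) mirror_path_appendD unfolding st(3) map_append by blast
  from final_line_trajectory_of[OF l0 this]
  have f: "final_line l\<^sub>0 xs \<in> common_tangents a S" "proj_span (final_line l\<^sub>0 xs) = path_end L0 (map fst xs)"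
    using xs by auto
  have "double_reflection a (path_end L0 (map fst xs)) H K K' H'"
    using D unfolding DRC_iff[OF f(1)] f(2) by blast
  moreover have "map fst s = map fst xs @ [H, K] @ map fst ys" "map fst t = map fst xs @ [K', H'] @ map fst ys"
    by (simp_all add: st)
  ultimately show "s \<in> TB a S l\<^sub>0 \<and> t \<in> TB a S l\<^sub>0 \<and> (map fst s, map fst t) \<in> path_moves a L0"
    using st(1,2) p unfolding path_moves_def by blast
next
  assume R: "s \<in> TB a S l\<^sub>0 \<and> t \<in> TB a S l\<^sub>0 \<and> (map fst s, map fst t) \<in> path_moves a L0"
  then obtain xs ys H K K' H' where p: "mirror_path a L0 (map fst s)"
    and e: "map fst s = xs @ [H, K] @ ys" "map fst t = xs @ [K', H'] @ ys"
    and D: "double_reflection a (path_end L0 xs) H K K' H'"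
    unfolding path_moves_def by blast
  define L where "L = path_end L0 xs"
  have L2: "mirror H' ` mirror K' ` L = mirror K ` mirror H ` L"
    using D unfolding double_reflection_def L_def by blast
  define m where "m = line_of (mirror K ` mirror H ` L)"
  define zs where "zs = trajectory_of (mirror K ` mirror H ` L) ys"
  have s: "s = trajectory_of L0 xs @ [(H, line_of (mirror H ` L)), (K, m)] @ zs"
  proof -
    have "s = trajectory_of L0 (xs @ [H, K] @ ys)" using R TB_iff e(1) by metis
    then show ?thesis by (simp add: trajectory_of_append L_def m_def zs_def)
  qed
  have t: "t = trajectory_of L0 xs @ [(K', line_of (mirror K' ` L)), (H', m)] @ zs"
  proof -
    have "t = trajectory_of L0 (xs @ [K', H'] @ ys)" using R TB_iff e(2) by metis
    also have "\<dots> = trajectory_of L0 xs @ (K', line_of (mirror K' ` L)) #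
        (H', line_of (mirror H' ` mirror K' ` L)) # trajectory_of (mirror H' ` mirror K' ` L) ys"
      unfolding trajectory_of_append L_def append.simps trajectory_of.simps ..
    finally show ?thesis unfolding L2 m_def zs_def by simp
  qed
  have "mirror_path a L0 xs" using p mirror_path_appendD unfolding e by blast
  from final_line_trajectory_of[OF l0 this]
  have f: "final_line l\<^sub>0 (trajectory_of L0 xs) \<in> common_tangents a S"
    "proj_span (final_line l\<^sub>0 (trajectory_of L0 xs)) = L" by (auto simp: L_def)
  have "DRC a (final_line l\<^sub>0 (trajectory_of L0 xs)) H (line_of (mirror H ` L)) K m K' (line_of (mirror K' ` L)) H'"
    unfolding DRC_iff[OF f(1)] f(2) m_def using D unfolding L_def by blast
  then show "(s, t) \<in> double_reflection_move a S l\<^sub>0"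
    unfolding double_reflection_move_def using R s t by blast
qed

text \<open>Moves of trajectories are moves of mirror paths, and those generate exactly the
  permutations of the divisor. This also shows that the closure under moves is symmetric.\<close>

lemma alpha_equiv_iff:
  "(s, t) \<in> alpha_equiv a S l\<^sub>0 \<longleftrightarrow>
     s \<in> TB a S l\<^sub>0 \<and> t \<in> TB a S l\<^sub>0 \<and> mset (D_map a l\<^sub>0 s) = mset (D_map a l\<^sub>0 t)"
proof -
  have 1: "(map fst s, map fst t) \<in> (path_moves a L0)\<^sup>*" if "(s, t) \<in> (double_reflection_move a S l\<^sub>0)\<^sup>*"
    using that
  proof (induction rule: rtrancl_induct)
    case (step t u)
    then show ?case unfolding double_reflection_move_iff by (meson rtrancl.rtrancl_into_rtrancl)
  qed simp
  have 2: "(trajectory_of L0 u, trajectory_of L0 v) \<in> (double_reflection_move a S l\<^sub>0)\<^sup>*"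
    if "(u, v) \<in> (path_moves a L0)\<^sup>*" for u v
    using that
  proof (induction rule: rtrancl_induct)
    case (step v w)
    then have "mirror_path a L0 v" "mirror_path a L0 w" unfolding path_moves_def by blast+
    then have "(trajectory_of L0 v, trajectory_of L0 w) \<in> double_reflection_move a S l\<^sub>0"
      unfolding double_reflection_move_iff map_fst_trajectory_of using trajectory_of_TB step(2) by blast
    with step.IH show ?case by (rule rtrancl_into_rtrancl)
  qed simp
  show ?thesis
  proof (cases "s \<in> TB a S l\<^sub>0 \<and> t \<in> TB a S l\<^sub>0")
    case True
    then have p: "mirror_path a L0 (map fst s)" "mirror_path a L0 (map fst t)"
      "s = trajectory_of L0 (map fst s)" "t = trajectory_of L0 (map fst t)" using TB_iff by blast+
    have "(s, t) \<in> (double_reflection_move a S l\<^sub>0)\<^sup>* \<longleftrightarrow> (map fst s, map fst t) \<in> (path_moves a L0)\<^sup>*"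
      using 1 2[of "map fst s" "map fst t", folded p(3,4)] by blast
    also have "\<dots> \<longleftrightarrow> mset (D_map a l\<^sub>0 s) = mset (D_map a l\<^sub>0 t)"
      using path_moves_mset[OF regular_L0] mset_eq_imp_path_moves[OF regular_L0 p(1,2)]
        D_map_transport True by metis
    finally show ?thesis using True unfolding alpha_equiv_def by blast
  qed (auto simp: alpha_equiv_def)
qed

lemma bij_betw_D_map: "bij_betw (D_map a l\<^sub>0) (TB a S l\<^sub>0) (lists (mirrors a L0))"
proof (rule bij_betw_imageI)
  show "inj_on (D_map a l\<^sub>0) (TB a S l\<^sub>0)"
  proof (rule inj_onI)
    fix s t assume st: "s \<in> TB a S l\<^sub>0" "t \<in> TB a S l\<^sub>0" "D_map a l\<^sub>0 s = D_map a l\<^sub>0 t"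
    then have "transport a L0 (map fst s) = transport a L0 (map fst t)" using D_map_transport by metis
    then have "map fst s = map fst t" using transport_inj[OF regular_L0] st(1,2) TB_iff by blast
    then show "s = t" using st(1,2) TB_iff by metis
  qed
  show "D_map a l\<^sub>0 ` TB a S l\<^sub>0 = lists (mirrors a L0)"
  proof (intro subset_antisym subsetI)
    fix xs assume "xs \<in> D_map a l\<^sub>0 ` TB a S l\<^sub>0"
    then obtain t where t: "t \<in> TB a S l\<^sub>0" "xs = transport a L0 (map fst t)" using D_map_transport by blast
    have "mirror_path a L0 (map fst t)" using t(1) TB_iff by blast
    from set_transport[OF regular_L0 this] show "xs \<in> lists (mirrors a L0)" unfolding t(2) by blast
  next
    fix xs assume "xs \<in> lists (mirrors a L0)"
    then have "set xs \<subseteq> mirrors a L0" by blast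
    then obtain hs where hs: "mirror_path a L0 hs" "transport a L0 hs = xs"
      using transport_surj[OF regular_L0] by blast
    have "D_map a l\<^sub>0 (trajectory_of L0 hs) = xs"
      using D_map_transport[OF trajectory_of_TB[OF hs(1)]] hs(2) by (simp add: map_fst_trajectory_of)
    then show "xs \<in> D_map a l\<^sub>0 ` TB a S l\<^sub>0" using trajectory_of_TB[OF hs(1)] by blast
  qed
qed

definition trajectory_class :: "'n hyperpl multiset \<Rightarrow> 'n trajectory set" where
  "trajectory_class M = {t \<in> TB a S l\<^sub>0. mset (D_map a l\<^sub>0 t) = M}"

lemma effective_divisors_eq: "effective_divisors a S l\<^sub>0 = {M. set_mset M \<subseteq> mirrors a L0}"
  unfolding effective_divisors_def mirrors_eq_curve[OF l0] ..

lemma mset_D_map_effective: "t \<in> TB a S l\<^sub>0 \<Longrightarrow> mset (D_map a l\<^sub>0 t) \<in> effective_divisors a S l\<^sub>0"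
  using bij_betwE[OF bij_betw_D_map] unfolding effective_divisors_eq by auto

lemma B_map:
  assumes "set xs \<subseteq> mirrors a L0"
  shows "B_map a S l\<^sub>0 xs \<in> TB a S l\<^sub>0" "D_map a l\<^sub>0 (B_map a S l\<^sub>0 xs) = xs"
proof -
  have "xs \<in> D_map a l\<^sub>0 ` TB a S l\<^sub>0" using bij_betw_imp_surj_on[OF bij_betw_D_map] assms by blast
  then show "B_map a S l\<^sub>0 xs \<in> TB a S l\<^sub>0" "D_map a l\<^sub>0 (B_map a S l\<^sub>0 xs) = xs"
    unfolding B_map_def by (rule inv_into_into, rule f_inv_into_f)
qed

text \<open>All enumerations of \<open>M\<close> give the same class, and there is at least one, so
  the union in \<open>B_hat\<close> is that class.\<close>

lemma B_hat_eq:
  assumes "M \<in> effective_divisors a S l\<^sub>0"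
  shows "B_hat a S l\<^sub>0 M = trajectory_class M"
proof -
  have "alpha_equiv a S l\<^sub>0 `` {B_map a S l\<^sub>0 xs} = trajectory_class M" if "mset xs = M" for xs
  proof -
    have "set xs \<subseteq> mirrors a L0" using assms that unfolding effective_divisors_eq by auto
    note B = B_map[OF this]
    show ?thesis unfolding trajectory_class_def Image_singleton alpha_equiv_iff B(2) using B(1) that by auto
  qed
  moreover obtain xs where "mset xs = M" using ex_mset by blast
  ultimately show ?thesis unfolding B_hat_def by blast
qed

text \<open>The definite description has only one solution because the class is nonempty:
  \<open>B_map\<close> supplies a member.\<close>

lemma D_hat_eq:
  assumes "M \<in> effective_divisors a S l\<^sub>0"
  shows "D_hat a l\<^sub>0 (trajectory_class M) = M"
proof -
  obtain xs where xs: "mset xs = M" using ex_mset by blast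
  then have "set xs \<subseteq> mirrors a L0" using assms unfolding effective_divisors_eq by auto
  note B = B_map[OF this]
  have "B_map a S l\<^sub>0 xs \<in> trajectory_class M"
    unfolding trajectory_class_def mem_Collect_eq B(2) using B(1) xs by (rule conjI)
  moreover have "\<forall>t\<in>trajectory_class M. mset (D_map a l\<^sub>0 t) = M"
    unfolding trajectory_class_def by blast
  ultimately show ?thesis unfolding D_hat_def by (intro the_equality) metis+
qed

lemma TB_hat_eq: "TB_hat a S l\<^sub>0 = trajectory_class ` effective_divisors a S l\<^sub>0"
proof -
  have c: "alpha_equiv a S l\<^sub>0 `` {t} = trajectory_class (mset (D_map a l\<^sub>0 t))" if "t \<in> TB a S l\<^sub>0" for t
    unfolding trajectory_class_def Image_singleton alpha_equiv_iff using that by auto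
  show ?thesis
  proof (intro subset_antisym subsetI)
    fix c assume "c \<in> TB_hat a S l\<^sub>0"
    then obtain t where "t \<in> TB a S l\<^sub>0" "c = alpha_equiv a S l\<^sub>0 `` {t}"
      unfolding TB_hat_def by (rule quotientE)
    then show "c \<in> trajectory_class ` effective_divisors a S l\<^sub>0" using c mset_D_map_effective by blast
  next
    fix c assume "c \<in> trajectory_class ` effective_divisors a S l\<^sub>0"
    then obtain M where M: "M \<in> effective_divisors a S l\<^sub>0" "c = trajectory_class M" by blast
    obtain xs where xs: "mset xs = M" using ex_mset by blast
    then have "set xs \<subseteq> mirrors a L0" using M(1) unfolding effective_divisors_eq by auto
    note B = B_map[OF this]
    have "c = alpha_equiv a S l\<^sub>0 `` {B_map a S l\<^sub>0 xs}"
      unfolding c[OF B(1)] B(2) xs by (rule M(2))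
    then show "c \<in> TB_hat a S l\<^sub>0" unfolding TB_hat_def using quotientI[OF B(1)] by metis
  qed
qed

lemma effective_divisors_add:
  "M \<in> effective_divisors a S l\<^sub>0 \<Longrightarrow> N \<in> effective_divisors a S l\<^sub>0 \<Longrightarrow> M + N \<in> effective_divisors a S l\<^sub>0"
  unfolding effective_divisors_def by auto

lemma traj_sum_class:
  assumes "M \<in> effective_divisors a S l\<^sub>0" "N \<in> effective_divisors a S l\<^sub>0"
  shows "traj_sum a S l\<^sub>0 (trajectory_class M) (trajectory_class N) = trajectory_class (M + N)"
  unfolding traj_sum_def D_hat_eq[OF assms(1)] D_hat_eq[OF assms(2)]
  using B_hat_eq[OF effective_divisors_add[OF assms]] .

lemma comm_semigroup_TB_hat: "comm_semigroup_on (TB_hat a S l\<^sub>0) (traj_sum a S l\<^sub>0)"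
  unfolding comm_semigroup_on_def TB_hat_eq
  by (auto simp: traj_sum_class effective_divisors_add add_ac)

lemma semigroup_iso_D_hat:
  "semigroup_iso (D_hat a l\<^sub>0) (TB_hat a S l\<^sub>0) (traj_sum a S l\<^sub>0) (effective_divisors a S l\<^sub>0) (+)"
proof -
  have "bij_betw (D_hat a l\<^sub>0) (TB_hat a S l\<^sub>0) (effective_divisors a S l\<^sub>0)"
    unfolding TB_hat_eq
    by (rule bij_betw_byWitness[where f' = trajectory_class]) (auto simp: D_hat_eq)
  then show ?thesis
    unfolding semigroup_iso_def TB_hat_eq
    by (auto simp: traj_sum_class D_hat_eq effective_divisors_add)
qed

end

theorem theorem11:
  fixes a :: "real^'n::finite" and S :: "real set" and l\<^sub>0 :: "'n line"
  assumes "CARD('n) \<ge> 2"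
    and "inj (\<lambda>i. a $ i)"
    and "finite S" and "card S = CARD('n) - 1"
    and "S \<inter> range (\<lambda>i. a $ i) = {}"
    and "l\<^sub>0 \<in> common_tangents a S"
  shows "comm_semigroup_on (TB_hat a S l\<^sub>0) (traj_sum a S l\<^sub>0) \<and>
         semigroup_iso (D_hat a l\<^sub>0) (TB_hat a S l\<^sub>0) (traj_sum a S l\<^sub>0)
           (effective_divisors a S l\<^sub>0) (+)"
proof -
  interpret billiard a S l\<^sub>0 using assms by unfold_locales
  show ?thesis using comm_semigroup_TB_hat semigroup_iso_D_hat by blast
qed

end
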